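(* Let $F'/F$ be a separable quadratic extension of nonarchimedean local fields, $q$ the residue cardinality of $F$, $(V,h)$ a finite dimensional nondegenerate Hermitian space over $F'$, $d\ge1$, and $C\subset V^d$ a compact open subset. For any nonsingular $T\in\mathrm{Herm}_d(F')$ there is a polynomial $\mathrm{Den}_T(s,C)\in\mathbb{C}[q^{-s}]$ satisfying $$\mathrm{Den}_T(r,C)=\mathrm{Den}_T(C^{[r]})$$ for all $r\in\mathbb{Z}_{\ge0}$. If $F'/F$ is unramified, then in fact $\mathrm{Den}_T(s,C)\in\mathbb{C}[q^{-2s}]$.
   Context: Hermitian forms are linear in the first variable and conjugate-linear in the second. $\mathrm{Herm}_d(\cdot)$ denotes $d\times d$ Hermitian matrices; $\tau(x)=(h(x_i,x_j))_{i,j}$ is the moment matrix of $x\in V^d$; $\mathrm{Herm}_d(\mathcal{O}_{F'})^\vee=\{t\in\mathrm{Herm}_d(F'):\mathrm{Tr}(ts)\in\mathcal{O}_F\ \forall s\in\mathrm{Herm}_d(\mathcal{O}_{F'})\}$. Representation density: for a Hermitian space $V$, a nonempty compact open $C\subset V^d$ and nonsingular $T\in\mathrm{Herm}_d(F')$, $$\mathrm{Den}_T(C)=\frac{\mathrm{Vol}(\{x\in C:\tau(x)\in U\})}{\mathrm{Vol}(C)}\cdot\frac{\mathrm{Vol}(\mathrm{Herm}_d(\mathcal{O}_{F'})^\vee)}{\mathrm{Vol}(U)}$$ for any sufficiently small compact open neighborhood $U\subset\mathrm{Herm}_d(F')$ of $T$ (the value is independent of $U$ once $U$ is small enough); volumes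 are for Haar measures on $V^d$ and $\mathrm{Herm}_d(F')$. Also $\mathrm{Den}_T(\emptyset)=0$. For $r\ge0$, $W_{r,r}=(F')^{2r}$ carries the Hermitian form given by the antidiagonal matrix with all antidiagonal entries $1$, and $\Lambda_{r,r}=(\mathcal{O}_{F'})^{2r}\subset W_{r,r}$. Set $V^{[r]}=V\oplus W_{r,r}$ (orthogonal direct sum) and $C^{[r]}=C\times\Lambda_{r,r}^d\subset V^d\times W_{r,r}^d=(V^{[r]})^d$; $\mathrm{Den}_T(C^{[r]})$ is computed in $V^{[r]}$. *)

theory Defs
  imports "HOL-Analysis.Analysis" "HOL-Library.Function_Algebras"
    "HOL-Computational_Algebra.Polynomial"
begin

text \<open>
  A nonarchimedean local field: a field with a nontrivial ultrametric absolute value whose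
  topology is locally compact. The absolute value need not be normalized.
\<close>

class nonarch_local_field = field + metric_space +
  fixes absval :: "'a \<Rightarrow> real"
  assumes dist_absval: "dist x y = absval (x - y)"
    and absval_mult: "absval (x * y) = absval x * absval y"
    and absval_ultrametric: "absval (x + y) \<le> max (absval x) (absval y)"
    and absval_nontrivial: "\<exists>x. x \<noteq> 0 \<and> absval x \<noteq> 1"
    and locally_compact: "\<exists>K U. compact K \<and> open U \<and> 0 \<in> U \<and> U \<subseteq> K"

definition valuation_ring :: "'a::nonarch_local_field set" where
  "valuation_ring = {x. absval x \<le> 1}"

definition valuation_ideal :: "'a::nonarch_local_field set" where
  "valuation_ideal = {x. absval x < 1}"

definition residue_card :: "'a::nonarch_local_field itself \<Rightarrow> nat" where
  "residue_card _ =
     card ((valuation_ring :: 'a set) //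
       {(x, y). x \<in> valuation_ring \<and> y \<in> valuation_ring \<and> x - y \<in> valuation_ideal})"

text \<open>
  A separable quadratic extension \<open>\<iota> : F \<rightarrow> F'\<close> together with the nontrivial element
  \<open>\<sigma>\<close> of its Galois group. The absolute value of \<open>F\<close> is the restriction of the one of \<open>F'\<close>;
  as absolute values are not normalized, this only says that \<open>F\<close> has the subspace topology.
\<close>

locale separable_quadratic_extension =
  fixes \<iota> :: "'f::nonarch_local_field \<Rightarrow> 'e::nonarch_local_field"
    and \<sigma> :: "'e \<Rightarrow> 'e"
  assumes emb_add: "\<iota> (a + b) = \<iota> a + \<iota> b"
    and emb_mult: "\<iota> (a * b) = \<iota> a * \<iota> b"
    and emb_one: "\<iota> 1 = 1"
    and emb_absval: "absval (\<iota> a) = absval a"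
    and quadratic: "vector_space.dim (\<lambda>a x. \<iota> a * x) (UNIV :: 'e set) = 2"
    and separable: "\<exists>p. irreducible p \<and> coprime p (pderiv p) \<and> poly (map_poly \<iota> p) x = 0"
    and conj_bij: "bij \<sigma>"
    and conj_add: "\<sigma> (x + y) = \<sigma> x + \<sigma> y"
    and conj_mult: "\<sigma> (x * y) = \<sigma> x * \<sigma> y"
    and conj_emb: "\<sigma> (\<iota> a) = \<iota> a"
    and conj_nontrivial: "\<sigma> \<noteq> id"

text \<open>
  The maximal ideal of \<open>F\<close> generates the maximal ideal of \<open>F'\<close>; separability of the residue
  extension is automatic because the residue fields are finite.
\<close>

definition unramified :: "('f::nonarch_local_field \<Rightarrow> 'e::nonarch_local_field) \<Rightarrow> bool" where
  "unramified \<iota> \<longleftrightarrow>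
     (valuation_ideal :: 'e set) = {\<iota> a * y | a y. a \<in> valuation_ideal \<and> y \<in> valuation_ring}"

text \<open>
  A nondegenerate Hermitian space of finite dimension over \<open>F'\<close>, linear in the first variable.
  Its topology is pinned down by the fact that a finite dimensional vector space over a
  complete nontrivially valued field has exactly one Hausdorff vector space topology.
\<close>

locale hermitian_space =
  vector_space scale
  for scale :: "'e::nonarch_local_field \<Rightarrow> 'v::{topological_ab_group_add, t2_space} \<Rightarrow> 'v" +
  fixes \<sigma> :: "'e \<Rightarrow> 'e"
    and h :: "'v \<Rightarrow> 'v \<Rightarrow> 'e"
  assumes finite_dim: "\<exists>B. finite B \<and> span B = UNIV"
    and scale_continuous: "continuous_on UNIV (\<lambda>(a, x). scale a x)"
    and form_add_left: "h (x + y) z = h x z + h y z"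
    and form_scale_left: "h (scale a x) y = a * h x y"
    and form_hermitian: "h y x = \<sigma> (h x y)"
    and form_nondegenerate: "(\<And>y. h x y = 0) \<Longrightarrow> x = 0"

definition herm :: "('e \<Rightarrow> 'e) \<Rightarrow> ('e::nonarch_local_field ^ 'd ^ 'd) set" where
  "herm \<sigma> = {A. \<forall>i j. A $ j $ i = \<sigma> (A $ i $ j)}"

definition herm_int :: "('e \<Rightarrow> 'e) \<Rightarrow> ('e::nonarch_local_field ^ 'd ^ 'd) set" where
  "herm_int \<sigma> = {A \<in> herm \<sigma>. \<forall>i j. A $ i $ j \<in> valuation_ring}"

definition herm_int_dual ::
    "('f::nonarch_local_field \<Rightarrow> 'e::nonarch_local_field) \<Rightarrow> ('e \<Rightarrow> 'e) \<Rightarrow> ('e ^ 'd ^ 'd) set" where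
  "herm_int_dual \<iota> \<sigma> =
     {t \<in> herm \<sigma>. \<forall>s \<in> herm_int \<sigma>. trace (t ** s) \<in> \<iota> ` valuation_ring}"

definition moment_matrix :: "('w \<Rightarrow> 'w \<Rightarrow> 'e) \<Rightarrow> 'w ^ 'd \<Rightarrow> 'e ^ 'd ^ 'd" where
  "moment_matrix h x = (\<chi> i j. h (x $ i) (x $ j))"

text \<open>
  Haar measures on the Borel sets of a subgroup \<open>G\<close> with its subspace topology. Regularity is
  not required: it is automatic for the second countable locally compact groups used here.
\<close>

definition haar_measure_on :: "'g::{topological_space, ab_group_add} set \<Rightarrow> 'g measure \<Rightarrow> bool" where
  "haar_measure_on G \<mu> \<longleftrightarrow>
     sets \<mu> = sets (restrict_space borel G) \<and>
     (\<forall>a \<in> G. \<forall>A \<in> sets \<mu>. emeasure \<mu> ((\<lambda>x. a + x) ` A) = emeasure \<mu> A) \<and>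
     (\<forall>K \<subseteq> G. compact K \<longrightarrow> emeasure \<mu> K < \<infinity>) \<and>
     (\<forall>U. openin (top_of_set G) U \<and> U \<noteq> {} \<longrightarrow> emeasure \<mu> U > 0)"

text \<open>
  The representation density, for Haar measures \<open>\<mu>\<close> on the \<open>d\<close>-th power of the Hermitian space
  with form \<open>h\<close> and \<open>\<nu>\<close> on \<open>herm \<sigma>\<close>: the common value of the quotient for all sufficiently small
  compact open neighbourhoods \<open>U\<close> of \<open>T\<close>.
\<close>

definition density_quotient ::
    "('f::nonarch_local_field \<Rightarrow> 'e::nonarch_local_field) \<Rightarrow> ('e \<Rightarrow> 'e) \<Rightarrow> ('w \<Rightarrow> 'w \<Rightarrow> 'e) \<Rightarrow>
     ('w ^ 'd) measure \<Rightarrow> ('e ^ 'd ^ 'd) measure \<Rightarrow>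
     ('w ^ 'd) set \<Rightarrow> ('e ^ 'd ^ 'd) set \<Rightarrow> real" where
  "density_quotient \<iota> \<sigma> h \<mu> \<nu> C U =
     measure \<mu> {x \<in> C. moment_matrix h x \<in> U} / measure \<mu> C *
     (measure \<nu> (herm_int_dual \<iota> \<sigma>) / measure \<nu> U)"

definition rep_density ::
    "('f::nonarch_local_field \<Rightarrow> 'e::nonarch_local_field) \<Rightarrow> ('e \<Rightarrow> 'e) \<Rightarrow> ('w \<Rightarrow> 'w \<Rightarrow> 'e) \<Rightarrow>
     ('w ^ 'd) measure \<Rightarrow> ('e ^ 'd ^ 'd) measure \<Rightarrow>
     'e ^ 'd ^ 'd \<Rightarrow> ('w ^ 'd) set \<Rightarrow> real" where
  "rep_density \<iota> \<sigma> h \<mu> \<nu> T C =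
     (if C = {} then 0
      else THE c. \<exists>N. openin (top_of_set (herm \<sigma>)) N \<and> T \<in> N \<and>
             (\<forall>U. U \<subseteq> N \<and> T \<in> U \<and> compact U \<and> openin (top_of_set (herm \<sigma>)) U \<longrightarrow>
                density_quotient \<iota> \<sigma> h \<mu> \<nu> C U = c))"

text \<open>
  The space \<open>W\<^sub>r\<^sub>,\<^sub>r = (F')\<^bsup>2r\<^esup>\<close> consists of the sequences vanishing from index \<open>2 * r\<close> on, so that all
  \<open>r\<close> live in one type; the subspace topology of the product topology on sequences is the
  usual topology of \<open>(F')\<^bsup>2r\<^esup>\<close>. Elements of \<open>V\<^bsup>[r]\<^esup> = V \<oplus> W\<^sub>r\<^sub>,\<^sub>r\<close> are pairs, and \<open>(V\<^bsup>[r]\<^esup>)\<^sup>d\<close> consists of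
  vectors of pairs. Coordinates are counted from \<open>0\<close>.
\<close>

definition split_space :: "nat \<Rightarrow> (nat \<Rightarrow> 'e::nonarch_local_field) set" where
  "split_space r = {w. \<forall>k \<ge> 2 * r. w k = 0}"

definition split_lattice :: "nat \<Rightarrow> (nat \<Rightarrow> 'e::nonarch_local_field) set" where
  "split_lattice r = {w \<in> split_space r. \<forall>k < 2 * r. w k \<in> valuation_ring}"

definition split_form ::
    "('e \<Rightarrow> 'e) \<Rightarrow> nat \<Rightarrow> (nat \<Rightarrow> 'e) \<Rightarrow> (nat \<Rightarrow> 'e) \<Rightarrow> 'e::nonarch_local_field" where
  "split_form \<sigma> r w z = (\<Sum>k < 2 * r. w k * \<sigma> (z (2 * r - 1 - k)))"

definition ext_form ::
    "('e \<Rightarrow> 'e) \<Rightarrow> ('v \<Rightarrow> 'v \<Rightarrow> 'e) \<Rightarrow> nat \<Rightarrow>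
     'v \<times> (nat \<Rightarrow> 'e) \<Rightarrow> 'v \<times> (nat \<Rightarrow> 'e) \<Rightarrow> 'e::nonarch_local_field" where
  "ext_form \<sigma> h r x y = h (fst x) (fst y) + split_form \<sigma> r (snd x) (snd y)"

definition ext_space_power :: "nat \<Rightarrow> (('v \<times> (nat \<Rightarrow> 'e::nonarch_local_field)) ^ 'd) set" where
  "ext_space_power r = {x. \<forall>i. snd (x $ i) \<in> split_space r}"

definition ext_set ::
    "('v ^ 'd) set \<Rightarrow> nat \<Rightarrow> (('v \<times> (nat \<Rightarrow> 'e::nonarch_local_field)) ^ 'd) set" where
  "ext_set C r = {x. (\<chi> i. fst (x $ i)) \<in> C \<and> (\<forall>i. snd (x $ i) \<in> split_lattice r)}"

text \<open>The ring \<open>\<complex>[f]\<close> of polynomial expressions in a function \<open>f\<close> of the complex variable \<open>s\<close>.\<close>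

definition polynomials_in :: "(complex \<Rightarrow> complex) \<Rightarrow> (complex \<Rightarrow> complex) set" where
  "polynomials_in f = {\<lambda>s. poly P (f s) | P. True}"

end

theory Submission
  imports Defs
begin

text \<open>
  Let \<open>g\<close> run over the matrices over \<open>\<O>\<^sub>F\<^sub>'\<close> close to \<open>1\<close>. They act on tuples by \<open>x \<mapsto> g x\<close>, preserve
  \<open>C\<^bsup>[r]\<^esup>\<close> and its small lattices, and transform moment matrices by \<open>\<tau> \<mapsto> g \<tau> g\<^sup>*\<close>. By a Newton
  iteration every Hermitian matrix near the nonsingular \<open>T\<close> is, to any precision, of the form \<open>g T g\<^sup>*\<close>.
  Hence the number of solutions of \<open>\<tau>(x) \<equiv> T'\<close> at any level does not depend on \<open>T'\<close> near \<open>T\<close>, and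
  the density is attained at a level that is the same for all \<open>r\<close>.

  At a fixed level, write the split component as a pair \<open>(A, B)\<close> of \<open>d \<times> r\<close> matrices, so that its
  moment matrix is \<open>A B\<^sup>* + B A\<^sup>*\<close>. For given \<open>A\<close> the proportion of solutions \<open>B\<close> depends only on the
  column span \<open>M\<close> of \<open>A\<close>, not on \<open>r\<close>. Moebius inversion over the finitely many submodules of a
  finite quotient turns the average over \<open>A\<close> into a combination of the probabilities that all columns
  of \<open>A\<close> lie in \<open>N\<close>. These are \<open>r\<close>-th powers of inverse indices, which are powers of the residue cardinality
  \<open>q'\<close> of \<open>F'\<close>. Finally \<open>q'\<close> is \<open>q\<close> or \<open>q\<^sup>2\<close>, and it is \<open>q\<^sup>2\<close> in the unramified case.
\<close>

subsection \<open>Nonarchimedean fields\<close>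

text \<open>The dimension of the space grows with r, so a level taken from the smoothness of the
  moment map at its solutions would depend on r. Congruence of Hermitian matrices avoids this: the
  Newton iteration takes place among d by d matrices and sees only \<open>T\<close>, whose
  nonsingularity supplies the inverse in the correction term; an element of trace 1 replaces 1/2, so
  that characteristic 2 is included. Estimates on the split part do not deteriorate with r either,
  because ultrametric sums do not grow with the number of terms. Volumes enter as counts. Each set
  involved is a union of cosets of a small open subgroup, translation invariance turns its volume
  into a number of cosets times the mass of one, and that mass cancels. The matrix \<open>A\<close>
  may be far from full rank, so the number of solutions \<open>B\<close> varies with it. The event
  that the columns span exactly M does not split into conditions on single columns, whereas
  containment of the span in N does; this asks for Moebius inversion and produces r-th
  powers.\<close>

lemma absval_0 [simp]: "absval (0::'a::nonarch_local_field) = 0"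
  using dist_absval[of "0::'a" 0] by simp

lemma absval_nonneg [simp]: "0 \<le> absval (x::'a::nonarch_local_field)"
  using dist_absval[of x 0] by (metis diff_zero zero_le_dist)

lemma absval_eq_0_iff [simp]: "absval (x::'a::nonarch_local_field) = 0 \<longleftrightarrow> x = 0"
  using dist_absval[of x 0] by (metis diff_zero dist_eq_0_iff)

lemma absval_pos_iff [simp]: "0 < absval (x::'a::nonarch_local_field) \<longleftrightarrow> x \<noteq> 0"
  by (metis absval_eq_0_iff absval_nonneg order_less_le)

lemma absval_1 [simp]: "absval (1::'a::nonarch_local_field) = 1"
  using absval_mult[of "1::'a" 1] by (metis absval_eq_0_iff mult_cancel_left1 mult_1 one_neq_zero)

lemma absval_minus [simp]: "absval (- x) = absval (x::'a::nonarch_local_field)"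
  using dist_absval[of x 0] dist_absval[of 0 x] by (simp add: dist_commute)

lemma absval_minus_commute: "absval (x - y) = absval (y - x::'a::nonarch_local_field)"
  using absval_minus[of "x - y"] by simp

lemma absval_inverse: "absval (inverse x) = inverse (absval (x::'a::nonarch_local_field))"
proof (cases "x = 0")
  case False
  then show ?thesis
    using absval_mult[of x "inverse x"] by (simp add: field_simps)
qed simp

lemma absval_divide: "absval (x / y) = absval x / absval (y::'a::nonarch_local_field)"
  by (simp add: divide_inverse absval_mult absval_inverse)

lemma absval_power: "absval (x ^ n) = absval (x::'a::nonarch_local_field) ^ n"
  by (induction n) (auto simp: absval_mult)

lemma absval_add_le:
  "absval x \<le> r \<Longrightarrow> absval y \<le> r \<Longrightarrow> absval (x + y :: 'a::nonarch_local_field) \<le> r"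
  using absval_ultrametric[of x y] by simp

lemma absval_diff_le:
  "absval x \<le> r \<Longrightarrow> absval y \<le> r \<Longrightarrow> absval (x - y :: 'a::nonarch_local_field) \<le> r"
  using absval_add_le[of x r "- y"] by simp

lemma absval_add_less:
  "absval x < r \<Longrightarrow> absval y < r \<Longrightarrow> absval (x + y :: 'a::nonarch_local_field) < r"
  using absval_ultrametric[of x y] by simp

lemma absval_sum_le:
  assumes "\<And>i. i \<in> A \<Longrightarrow> absval (f i :: 'a::nonarch_local_field) \<le> r" "0 \<le> r"
  shows "absval (sum f A) \<le> r"
  using assms by (induction A rule: infinite_finite_induct) (auto intro: absval_add_le)

lemma absval_mult_le:
  assumes "absval x \<le> r" "absval (y::'a::nonarch_local_field) \<le> s"
  shows "absval (x * y) \<le> r * s"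
  using assms by (auto simp: absval_mult intro: mult_mono order_trans[OF absval_nonneg])

lemma absval_mult_le_left:
  assumes "absval x \<le> 1" "absval (y::'a::nonarch_local_field) \<le> s"
  shows "absval (x * y) \<le> s"
  using absval_mult_le[OF assms] by simp

lemma absval_mult_le_right:
  assumes "absval x \<le> s" "absval (y::'a::nonarch_local_field) \<le> 1"
  shows "absval (x * y) \<le> s"
  using absval_mult_le[OF assms] by simp

text \<open>Besides the bound on the sum, \<open>x\<close> is recovered as
  \<open>(x + y) + (- y)\<close>; the ultrametric inequality for this sum excludes a smaller value,
  because \<open>y\<close> alone cannot reach the size of \<open>x\<close>.\<close>

lemma absval_add_eq:
  assumes "absval y < absval (x::'a::nonarch_local_field)"
  shows "absval (x + y) = absval x"
  using absval_ultrametric[of x y] absval_ultrametric[of "x + y" "- y"] assms by auto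

lemma exists_absval_less_1: "\<exists>p::'a::nonarch_local_field. p \<noteq> 0 \<and> absval p < 1"
proof -
  obtain x :: 'a where x: "x \<noteq> 0" "absval x \<noteq> 1"
    using absval_nontrivial by blast
  then consider "absval x < 1" | "absval (inverse x) < 1"
    by (smt (verit) absval_inverse inverse_less_1_iff)
  then show ?thesis
  proof cases
    case 2
    with x show ?thesis
      by (intro exI[of _ "inverse x"]) simp
  qed (use x in blast)
qed

lemma exists_absval_small:
  assumes "0 < r"
  shows "\<exists>c::'a::nonarch_local_field. c \<noteq> 0 \<and> absval c < r"
proof -
  obtain p :: 'a where p: "p \<noteq> 0" "absval p < 1"
    using exists_absval_less_1 by blast
  obtain n where "absval p ^ n < r"
    using real_arch_pow_inv[OF assms p(2)] by blast
  with p show ?thesis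
    by (intro exI[of _ "p ^ n"]) (simp add: absval_power)
qed

lemma continuous_on_lipschitz_absval:
  fixes f :: "'a::nonarch_local_field \<Rightarrow> 'b::nonarch_local_field"
  assumes "\<And>x y. absval (f x - f y) \<le> L * absval (x - y)"
  shows "continuous_on A f"
proof -
  have "(max L 0)-lipschitz_on A f"
    unfolding lipschitz_on_def dist_absval
    using assms by (fastforce intro: order_trans[OF _ mult_right_mono])
  then show ?thesis
    by (rule lipschitz_on_continuous_on)
qed

definition val_ball :: "real \<Rightarrow> 'a::nonarch_local_field set" where
  "val_ball r = {x. absval x \<le> r}"

lemma val_ball_eq_cball: "val_ball r = cball 0 r"
  by (auto simp: val_ball_def dist_absval)

lemma closed_val_ball: "closed (val_ball r)"
  by (simp add: val_ball_eq_cball)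

lemma open_val_ball:
  assumes "0 < r"
  shows "open (val_ball r)"
  unfolding open_dist
proof
  fix x :: 'a assume x: "x \<in> val_ball r"
  have "y \<in> val_ball r" if "dist y x < r" for y
    using absval_add_le[of "y - x" r x] x that by (simp add: val_ball_def dist_absval)
  then show "\<exists>e>0. \<forall>y. dist y x < e \<longrightarrow> y \<in> val_ball r"
    using assms by blast
qed

text \<open>Local compactness yields one compact ball of some small radius \<open>e\<close>.
  Multiplication by a small \<open>c\<close> maps \<open>val_ball r\<close> into it, and division by
  \<open>c\<close> is continuous, so every radius follows.\<close>

lemma compact_val_ball: "compact (val_ball r :: 'a::nonarch_local_field set)"
proof (cases "0 < r")
  case True
  obtain K U :: "'a set" where KU: "compact K" "open U" "0 \<in> U" "U \<subseteq> K"
    using locally_compact by blast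
  obtain e where e: "e > 0" "cball 0 e \<subseteq> U"
    using KU open_contains_cball by blast
  have "compact (K \<inter> cball 0 e)"
    using KU by (intro compact_Int_closed) auto
  moreover have "K \<inter> cball 0 e = cball 0 e"
    using e KU by auto
  ultimately have cpt: "compact (val_ball e :: 'a set)"
    by (simp add: val_ball_eq_cball)
  obtain c :: 'a where c: "c \<noteq> 0" "absval c < e / r"
    using exists_absval_small[of "e / r"] e True by auto
  have "continuous_on UNIV (\<lambda>x. x / c)"
    by (rule continuous_on_lipschitz_absval[of _ "1 / absval c"])
       (simp add: absval_divide flip: diff_divide_distrib)
  then have cpt2: "compact ((\<lambda>x. x / c) ` val_ball e)"
    using cpt compact_continuous_image continuous_on_subset by blast
  have "val_ball r \<subseteq> (\<lambda>x. x / c) ` val_ball e"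
  proof
    fix x :: 'a assume x: "x \<in> val_ball r"
    have "absval (c * x) \<le> (e / r) * r"
      using x c by (intro absval_mult_le) (auto simp: val_ball_def)
    then show "x \<in> (\<lambda>x. x / c) ` val_ball e"
      using c True by (intro image_eqI[of _ _ "c * x"]) (auto simp: val_ball_def)
  qed
  then show ?thesis
    using compact_Int_closed[OF cpt2 closed_val_ball, of r] by (simp add: Int_absorb1)
next
  case False
  then have "(val_ball r :: 'a set) \<subseteq> {0}"
    by (auto simp: val_ball_def) (metis absval_nonneg absval_eq_0_iff antisym not_less order_trans)
  then show ?thesis
    using finite_subset finite_imp_compact by blast
qed

lemma continuous_on_absval: "continuous_on A absval"
proof -
  have "continuous_on A (\<lambda>x. dist x 0)"
    by (intro continuous_intros)
  then show ?thesis
    by (simp add: dist_absval)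
qed

text \<open>Tychonoff's theorem for functions, carried over by the continuous map that packs a
  function into a vector.\<close>

lemma compact_vec:
  fixes S :: "'n::finite \<Rightarrow> 'a::topological_space set"
  assumes "\<And>i. compact (S i)"
  shows "compact {x :: 'a ^ 'n. \<forall>i. x $ i \<in> S i}"
proof -
  have "compactin (product_topology (\<lambda>_. euclidean) UNIV) (PiE UNIV S)"
    using assms by (simp add: compactin_PiE)
  then have "compact (PiE UNIV S)"
    by (simp add: euclidean_product_topology)
  then have "compact ((\<lambda>f. \<chi> i. f i) ` PiE UNIV S)"
    by (intro compact_continuous_image continuous_intros)
       (auto intro: continuous_on_subset[OF continuous_on_product_coordinates])
  moreover have "(\<lambda>f. \<chi> i. f i) ` PiE UNIV S = {x :: 'a ^ 'n. \<forall>i. x $ i \<in> S i}"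
  proof
    show "{x :: 'a ^ 'n. \<forall>i. x $ i \<in> S i} \<subseteq> (\<lambda>f. \<chi> i. f i) ` PiE UNIV S"
    proof
      fix x :: "'a ^ 'n" assume "x \<in> {x. \<forall>i. x $ i \<in> S i}"
      then show "x \<in> (\<lambda>f. \<chi> i. f i) ` PiE UNIV S"
        by (intro image_eqI[of _ _ "vec_nth x"]) (auto simp: vec_eq_iff)
    qed
  qed auto
  ultimately show ?thesis
    by simp
qed

lemma open_vec_all:
  fixes S :: "'n::finite \<Rightarrow> 'a::topological_space set"
  assumes "\<And>i. open (S i)"
  shows "open {x :: 'a ^ 'n. \<forall>i. x $ i \<in> S i}"
  unfolding open_vec_def using assms by blast

lemma val_cball_eq: "{x. absval (x - t) \<le> \<epsilon>} = cball t \<epsilon>"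
  by (auto simp: dist_absval absval_minus_commute)

lemma compact_val_cball: "compact {x::'a::nonarch_local_field. absval (x - t) \<le> \<epsilon>}"
proof -
  have "{x. absval (x - t) \<le> \<epsilon>} \<subseteq> val_ball (max \<epsilon> (absval t))"
  proof clarify
    fix x assume "absval (x - t) \<le> \<epsilon>"
    then show "x \<in> val_ball (max \<epsilon> (absval t))"
      using absval_ultrametric[of "x - t" t] by (auto simp: val_ball_def)
  qed
  moreover have "compact (val_ball (max \<epsilon> (absval t)) \<inter> {x. absval (x - t) \<le> \<epsilon>})"
    by (intro compact_Int_closed compact_val_ball) (simp add: val_cball_eq)
  ultimately show ?thesis
    by (simp add: Int_absorb1)
qed

lemma open_val_cball:
  assumes "0 < \<epsilon>"
  shows "open {x::'a::nonarch_local_field. absval (x - t) \<le> \<epsilon>}"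
proof -
  have "continuous_on UNIV (\<lambda>x. x - t)"
    by (rule continuous_on_lipschitz_absval[of _ 1]) simp
  moreover have "open (val_ball \<epsilon> :: 'a set)"
    by (rule open_val_ball[OF assms])
  ultimately have "open ((\<lambda>x. x - t) -` val_ball \<epsilon>)"
    by (simp add: continuous_on_open_vimage)
  then show ?thesis
    by (simp add: val_ball_def vimage_def)
qed

subsection \<open>The conjugation of a separable quadratic extension\<close>

context separable_quadratic_extension
begin

lemma emb_0 [simp]: "\<iota> 0 = 0"
  using emb_add[of 0 0] by (metis add_cancel_left_left add_0)

lemma emb_minus: "\<iota> (- a) = - \<iota> a"
  using emb_add[of a "- a"] by (simp add: eq_neg_iff_add_eq_0 add.commute)

lemma emb_diff: "\<iota> (a - b) = \<iota> a - \<iota> b"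
  using emb_add[of a "- b"] by (simp add: emb_minus)

lemma conj_0 [simp]: "\<sigma> 0 = 0"
  using conj_add[of 0 0] by (metis add_cancel_left_left add_0)

lemma conj_1 [simp]: "\<sigma> 1 = 1"
  using conj_emb[of 1] by (simp add: emb_one)

lemma conj_minus: "\<sigma> (- a) = - \<sigma> a"
  using conj_add[of a "- a"] by (simp add: eq_neg_iff_add_eq_0 add.commute)

lemma conj_diff: "\<sigma> (a - b) = \<sigma> a - \<sigma> b"
  using conj_add[of a "- b"] by (simp add: conj_minus)

lemma conj_sum: "\<sigma> (sum f A) = (\<Sum>i\<in>A. \<sigma> (f i))"
  by (induction A rule: infinite_finite_induct) (auto simp: conj_add)

lemma conj_eq_0_iff [simp]: "\<sigma> x = 0 \<longleftrightarrow> x = 0"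
  using conj_bij conj_0 by (metis bij_pointE)

lemma conj_power: "\<sigma> (x ^ n) = \<sigma> x ^ n"
  by (induction n) (auto simp: conj_mult)

lemma conj_divide: "\<sigma> (x / y) = \<sigma> x / \<sigma> y"
proof (cases "y = 0")
  case False
  then have "\<sigma> (x / y) * \<sigma> y = \<sigma> x"
    by (simp flip: conj_mult)
  with False show ?thesis
    by (simp add: field_simps)
qed simp

sublocale F_space: vector_space "\<lambda>a x. \<iota> a * x"
  by unfold_locales (auto simp: algebra_simps emb_add emb_mult emb_one)

text \<open>For \<open>y\<close> outside \<open>F\<close> the pair \<open>1, y\<close> is
  independent, and a basis containing it has no room for a third element, the dimension being
  2.\<close>

lemma decompose:
  assumes "y \<notin> range \<iota>"
  obtains a b where "x = \<iota> a + \<iota> b * y"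
proof -
  have "y \<notin> F_space.span {1}"
    using assms by (auto simp: F_space.span_singleton)
  moreover have "F_space.independent {1}"
    by simp
  ultimately have indep: "F_space.independent {y, 1}"
    using F_space.independent_insert[of y "{1}"] by auto
  have "y \<noteq> 1"
    using assms emb_one by (metis rangeI)
  then have card: "card {y, 1} = 2"
    by simp
  obtain B where B: "{y, 1} \<subseteq> B" "B \<subseteq> UNIV" "F_space.independent B" "UNIV \<subseteq> F_space.span B"
    by (rule F_space.maximal_independent_subset_extend[OF subset_UNIV indep])
  have "F_space.dim (UNIV :: 'e set) = card B"
    by (rule F_space.dim_unique[OF subset_UNIV B(4,3) refl])
  then have "card B = 2"
    using quadratic by simp
  then have "finite B"
    using card.infinite by fastforce
  with B(1) card \<open>card B = 2\<close> have "B = {y, 1}"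
    by (metis card_subset_eq)
  then have "x \<in> F_space.span {y, 1}"
    using B by auto
  then obtain k where "x - \<iota> k * y \<in> F_space.span {1}"
    using F_space.span_breakdown[of y "{y, 1}" x] \<open>y \<noteq> 1\<close> by auto
  then obtain l where "x - \<iota> k * y = \<iota> l"
    by (auto simp: F_space.span_singleton)
  then show ?thesis
    using that[of l k] by (simp add: algebra_simps)
qed

lemma exists_not_fixed: "\<exists>y. \<sigma> y \<noteq> y"
  using conj_nontrivial by fastforce

text \<open>\<open>\<sigma>\<close> is only given as a nontrivial automorphism over
  \<open>F\<close>. For a moved \<open>y\<close>, both \<open>y\<close> and
  \<open>\<sigma> y\<close> are roots of one monic quadratic over \<open>F\<close>; hence their sum
  lies in \<open>F\<close>, so \<open>\<sigma>\<close> swaps them, and \<open>1, y\<close> span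
  \<open>F'\<close>.\<close>

lemma conj_conj [simp]: "\<sigma> (\<sigma> x) = x"
proof -
  obtain y where y: "\<sigma> y \<noteq> y"
    using exists_not_fixed by blast
  then have nr: "y \<notin> range \<iota>"
    using conj_emb by auto
  obtain a b where ab: "y * y = \<iota> a + \<iota> b * y"
    using decompose[OF nr] .
  have "\<sigma> y * \<sigma> y = \<iota> a + \<iota> b * \<sigma> y"
    using arg_cong[OF ab, of \<sigma>] by (simp add: conj_mult conj_add conj_emb)
  with ab have "(\<sigma> y - y) * (\<sigma> y + y - \<iota> b) = 0"
    by (simp add: algebra_simps)
  then have "\<sigma> y + y - \<iota> b = 0"
    using y by (simp only: mult_eq_0_iff right_minus_eq) blast
  then have *: "\<sigma> y = \<iota> b - y"
    by (simp add: algebra_simps)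
  obtain c d where "x = \<iota> c + \<iota> d * y"
    using decompose[OF nr] .
  then show ?thesis
    by (simp add: * conj_mult conj_add conj_emb conj_diff)
qed

lemma fixed_imp_range:
  assumes "\<sigma> x = x"
  shows "x \<in> range \<iota>"
proof -
  obtain y where y: "\<sigma> y \<noteq> y"
    using exists_not_fixed by blast
  then have nr: "y \<notin> range \<iota>"
    using conj_emb by auto
  obtain c d where x: "x = \<iota> c + \<iota> d * y"
    using decompose[OF nr] .
  then have "\<iota> d * (\<sigma> y - y) = 0"
    using assms by (simp add: conj_mult conj_add conj_emb algebra_simps)
  with y x show ?thesis
    by auto
qed

text \<open>The Newton iteration splits an error into \<open>c\<close> times it and
  \<open>\<sigma> c\<close> times it. The choice \<open>c = 1/2\<close> fails in characteristic 2;
  for a moved \<open>y\<close>, the element \<open>y / (y - \<sigma> y)\<close> works in every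
  characteristic.\<close>

lemma exists_trace_one: "\<exists>c. c + \<sigma> c = 1"
proof -
  obtain y where y: "\<sigma> y \<noteq> y"
    using exists_not_fixed by blast
  then have "y / (y - \<sigma> y) + \<sigma> (y / (y - \<sigma> y)) = 1"
    by (simp add: conj_divide conj_diff divide_simps) (simp add: algebra_simps)
  then show ?thesis
    by blast
qed

text \<open>An element \<open>y\<close> outside \<open>F\<close> has a positive distance
  \<open>\<delta>\<close> from \<open>F\<close>: the elements of \<open>F\<close> not larger than
  \<open>y\<close> form a compact set missing \<open>y\<close>, and a larger one is as far from
  \<open>y\<close> as it is large. This bounds the \<open>y\<close>-coordinate of \<open>x\<close>
  by \<open>absval x / \<delta>\<close>.\<close>

lemma conj_bounded: "\<exists>R. \<forall>x. absval (\<sigma> x) \<le> R * absval x"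
proof -
  obtain y where y: "\<sigma> y \<noteq> y"
    using exists_not_fixed by blast
  then have nr: "y \<notin> range \<iota>"
    using conj_emb by auto
  have y0: "y \<noteq> 0"
    using y by auto
  have "continuous_on (val_ball (absval y)) \<iota>"
    by (rule continuous_on_lipschitz_absval[of _ 1]) (simp add: emb_absval flip: emb_diff)
  then have "compact (\<iota> ` val_ball (absval y))"
    using compact_val_ball compact_continuous_image by blast
  then have "open (- \<iota> ` val_ball (absval y))"
    using compact_imp_closed by blast
  moreover have "y \<in> - \<iota> ` val_ball (absval y)"
    using nr by auto
  ultimately obtain e where e: "e > 0" "ball y e \<subseteq> - \<iota> ` val_ball (absval y)"
    using open_contains_ball by blast
  define \<delta> where "\<delta> = min e (absval y)"
  have \<delta>: "\<delta> > 0"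
    using e y0 by (simp add: \<delta>_def)
  have far: "\<delta> \<le> absval (y - \<iota> a)" for a
  proof (cases "absval a \<le> absval y")
    case True
    then have "\<iota> a \<notin> ball y e"
      using e(2) by (auto simp: val_ball_def)
    then show ?thesis
      by (simp add: dist_absval \<delta>_def)
  next
    case False
    then have "absval (- \<iota> a + y) = absval (- \<iota> a)"
      by (intro absval_add_eq) (simp add: emb_absval)
    with False show ?thesis
      by (simp add: emb_absval \<delta>_def)
  qed
  define R where "R = max 1 (absval (\<sigma> y - y) / \<delta>)"
  have "absval (\<sigma> x) \<le> R * absval x" for x
  proof -
    obtain a b where x: "x = \<iota> a + \<iota> b * y"
      using decompose[OF nr] .
    have "absval b * \<delta> \<le> absval x"
    proof (cases "b = 0")
      case False
      have "x = \<iota> b * (y - \<iota> (- a / b))"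
      proof -
        have "\<iota> b * \<iota> (- a / b) = - \<iota> a"
          using False by (simp add: emb_minus flip: emb_mult)
        then show ?thesis
          by (simp add: x algebra_simps)
      qed
      then show ?thesis
        using far[of "- a / b"] by (simp add: absval_mult emb_absval mult_left_mono)
    qed auto
    then have "absval b * absval (\<sigma> y - y) \<le> R * absval x"
    proof -
      have "absval b * absval (\<sigma> y - y) = (absval b * \<delta>) * (absval (\<sigma> y - y) / \<delta>)"
        using \<delta> by simp
      also have "\<dots> \<le> absval x * R"
        using \<open>absval b * \<delta> \<le> absval x\<close> \<delta> by (intro mult_mono) (auto simp: R_def)
      finally show ?thesis
        by (simp add: mult.commute)
    qed
    moreover have "absval x \<le> R * absval x"
      using mult_right_mono[of 1 R "absval x"] by (simp add: R_def)
    moreover have "\<sigma> x = x + \<iota> b * (\<sigma> y - y)"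
      by (simp add: x conj_add conj_mult conj_emb algebra_simps)
    ultimately show ?thesis
      by (auto intro!: absval_add_le simp: absval_mult emb_absval)
  qed
  then show ?thesis
    by blast
qed

text \<open>Multiplicativity turns the bound \<open>\<bar>\<sigma> x\<bar> \<le> R \<bar>x\<bar>\<close>, applied to all powers of \<open>x\<close>, into one with \<open>R = 1\<close>.\<close>

lemma absval_conj_le: "absval (\<sigma> x) \<le> absval x"
proof (rule ccontr)
  assume less: "\<not> ?thesis"
  then have x: "x \<noteq> 0"
    by auto
  obtain R where R: "\<And>x. absval (\<sigma> x) \<le> R * absval x"
    using conj_bounded by blast
  define t where "t = absval (\<sigma> x) / absval x"
  have t: "1 < t"
    using less x by (simp add: t_def)
  have "t ^ n \<le> R" for n
  proof -
    have "t ^ n * absval (x ^ n) = absval (\<sigma> (x ^ n))"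
      using x by (simp add: t_def absval_power conj_power power_divide)
    also have "\<dots> \<le> R * absval (x ^ n)"
      by (rule R)
    finally show ?thesis
      using x by simp
  qed
  moreover obtain n where "R < t ^ n"
    using real_arch_pow[OF t] by blast
  ultimately show False
    using not_less by blast
qed

lemma absval_conj [simp]: "absval (\<sigma> x) = absval x"
  using absval_conj_le[of x] absval_conj_le[of "\<sigma> x"] by simp

end

subsection \<open>Cosets and Haar measures\<close>

definition add_subgroup :: "'g::ab_group_add set \<Rightarrow> bool" where
  "add_subgroup K \<longleftrightarrow> 0 \<in> K \<and> (\<forall>x\<in>K. \<forall>y\<in>K. x - y \<in> K)"

text \<open>\<open>X\<close> need not be a union of cosets: the classes that it meets are counted.
  Infinitely many count as 0, in accordance with \<open>measure\<close>, which gives a set of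
  infinite mass the value 0.\<close>

definition coset_index :: "'g::ab_group_add set \<Rightarrow> 'g set \<Rightarrow> nat" where
  "coset_index K X = card ((\<lambda>x. {y. y - x \<in> K}) ` X)"

definition coset_reps :: "'g::ab_group_add set \<Rightarrow> 'g set \<Rightarrow> 'g set \<Rightarrow> bool" where
  "coset_reps K X I \<longleftrightarrow> I \<subseteq> X \<and> (\<forall>x\<in>X. \<exists>!i. i \<in> I \<and> x - i \<in> K)"

definition coset_stable :: "'g::ab_group_add set \<Rightarrow> 'g set \<Rightarrow> bool" where
  "coset_stable K X \<longleftrightarrow> (\<forall>x\<in>X. \<forall>k\<in>K. x + k \<in> X)"

lemma add_subgroupD:
  assumes "add_subgroup K"
  shows add_subgroup_0: "0 \<in> K"
    and add_subgroup_diff: "\<And>x y. x \<in> K \<Longrightarrow> y \<in> K \<Longrightarrow> x - y \<in> K"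
    and add_subgroup_minus: "\<And>x. x \<in> K \<Longrightarrow> - x \<in> K"
    and add_subgroup_add: "\<And>x y. x \<in> K \<Longrightarrow> y \<in> K \<Longrightarrow> x + y \<in> K"
proof -
  show 0: "0 \<in> K" and d: "\<And>x y. x \<in> K \<Longrightarrow> y \<in> K \<Longrightarrow> x - y \<in> K"
    using assms by (auto simp: add_subgroup_def)
  show m: "- x \<in> K" if "x \<in> K" for x
    using d[OF 0 that] by simp
  show "x + y \<in> K" if "x \<in> K" "y \<in> K" for x y
    using d[OF that(1) m[OF that(2)]] by simp
qed

lemma add_subgroup_diff_commute:
  "add_subgroup K \<Longrightarrow> x - y \<in> K \<Longrightarrow> y - x \<in> K"
  using add_subgroup_minus[of K "x - y"] by simp

lemma add_subgroup_diff_trans: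
  "add_subgroup K \<Longrightarrow> x - y \<in> K \<Longrightarrow> y - z \<in> K \<Longrightarrow> x - z \<in> K"
  using add_subgroup_add[of K "x - y" "y - z"] by simp

lemma coset_eq_iff:
  assumes "add_subgroup K"
  shows "{z. z - x \<in> K} = {z. z - y \<in> K} \<longleftrightarrow> x - y \<in> K"
proof
  assume "{z. z - x \<in> K} = {z. z - y \<in> K}"
  then show "x - y \<in> K"
    using add_subgroup_0[OF assms] by (metis diff_self mem_Collect_eq)
next
  assume "x - y \<in> K"
  then show "{z. z - x \<in> K} = {z. z - y \<in> K}"
    using add_subgroup_diff_trans[OF assms] add_subgroup_diff_commute[OF assms] by blast
qed

lemma coset_repsD:
  assumes "coset_reps K X I"
  shows "I \<subseteq> X" and "\<And>x. x \<in> X \<Longrightarrow> \<exists>!i. i \<in> I \<and> x - i \<in> K"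
  using assms by (auto simp: coset_reps_def)

lemma coset_reps_unique:
  assumes "add_subgroup K" "coset_reps K X I" "i \<in> I" "j \<in> I" "i - j \<in> K"
  shows "i = j"
  using assms add_subgroup_0[OF assms(1)] unfolding coset_reps_def
  by (metis diff_self subsetD)

lemma coset_index_eq_card:
  assumes K: "add_subgroup K" and I: "coset_reps K X I"
  shows "coset_index K X = card I"
proof -
  have "bij_betw (\<lambda>x. {y. y - x \<in> K}) I ((\<lambda>x. {y. y - x \<in> K}) ` X)"
    unfolding bij_betw_def
  proof
    show "inj_on (\<lambda>x. {y. y - x \<in> K}) I"
      using coset_reps_unique[OF K I] by (auto simp: inj_on_def coset_eq_iff[OF K])
    have "{y. y - x \<in> K} \<in> (\<lambda>x. {y. y - x \<in> K}) ` I" if x: "x \<in> X" for x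
    proof -
      obtain i where "i \<in> I" "x - i \<in> K"
        using coset_repsD(2)[OF I x] by blast
      then show ?thesis
        by (intro image_eqI[of _ _ i]) (simp_all only: coset_eq_iff[OF K])
    qed
    then show "(\<lambda>x. {y. y - x \<in> K}) ` I = (\<lambda>x. {y. y - x \<in> K}) ` X"
      using coset_repsD(1)[OF I] by (intro equalityI image_mono image_subsetI) auto
  qed
  then show ?thesis
    by (simp add: coset_index_def bij_betw_same_card)
qed

text \<open>Choice is applied to a predicate that is the same for congruent points, so one point is
  selected per class. Any finite set \<open>F\<close> meeting every class then bounds the number of
  selected points, even if \<open>F\<close> is only found later.\<close>

lemma exists_coset_reps:
  assumes K: "add_subgroup K"
  shows "\<exists>I. coset_reps K X I \<and> (\<forall>F. finite F \<longrightarrow> (\<forall>x\<in>X. \<exists>f\<in>F. f \<in> X \<and> x - f \<in> K) \<longrightarrow> finite I)"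
proof -
  define \<rho> where "\<rho> x = (SOME y. y \<in> X \<and> x - y \<in> K)" for x
  have \<rho>: "\<rho> x \<in> X" "x - \<rho> x \<in> K" if "x \<in> X" for x
    using someI[of "\<lambda>y. y \<in> X \<and> x - y \<in> K" x] that add_subgroup_0[OF K]
    by (auto simp: \<rho>_def)
  have \<rho>_eq: "\<rho> x = \<rho> y" if "x - y \<in> K" for x y
  proof -
    have "x - z \<in> K \<longleftrightarrow> y - z \<in> K" for z
      using that add_subgroup_diff_trans[OF K] add_subgroup_diff_commute[OF K] by blast
    then show ?thesis
      by (simp add: \<rho>_def)
  qed
  have "coset_reps K X (\<rho> ` X)"
    unfolding coset_reps_def
  proof (intro conjI ballI)
    fix x assume x: "x \<in> X"
    show "\<exists>!i. i \<in> \<rho> ` X \<and> x - i \<in> K"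
    proof (intro ex1I[of _ "\<rho> x"] conjI)
      fix i assume i: "i \<in> \<rho> ` X \<and> x - i \<in> K"
      then obtain y where y: "y \<in> X" "i = \<rho> y"
        by blast
      then have "x - y \<in> K"
        using i \<rho>(2)[of y] add_subgroup_diff_trans[OF K] add_subgroup_diff_commute[OF K] by blast
      then show "i = \<rho> x"
        using \<rho>_eq y by simp
    qed (use x \<rho> in auto)
  qed (use \<rho> in auto)
  moreover have "finite (\<rho> ` X)" if "finite F" "\<forall>x\<in>X. \<exists>f\<in>F. f \<in> X \<and> x - f \<in> K" for F
  proof (rule finite_subset)
    show "\<rho> ` X \<subseteq> \<rho> ` F"
      using that(2) \<rho>_eq by (metis imageI image_subsetI)
  qed (use that in simp)
  ultimately show ?thesis
    by blast
qed

text \<open>Compactness supplies the finite set that \<open>exists_coset_reps\<close> asks for, as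
  soon as each class is relatively open in \<open>X\<close>.\<close>

lemma exists_finite_coset_reps:
  fixes X :: "'g::{ab_group_add, topological_space} set"
  assumes K: "add_subgroup K" and X: "compact X"
    and loc: "\<And>x. x \<in> X \<Longrightarrow> \<exists>O'. open O' \<and> x \<in> O' \<and> (\<forall>y\<in>O' \<inter> X. y - x \<in> K)"
  shows "\<exists>I. finite I \<and> coset_reps K X I"
proof -
  obtain N where N: "\<And>x. x \<in> X \<Longrightarrow> open (N x) \<and> x \<in> N x \<and> (\<forall>y\<in>N x \<inter> X. y - x \<in> K)"
    using loc by metis
  obtain F where F: "F \<subseteq> X" "finite F" "X \<subseteq> (\<Union>c\<in>F. N c)"
    using compactE_image[OF X, of X N] N by (metis UN_I subsetI)
  obtain I where I: "coset_reps K X I"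
      "\<forall>F. finite F \<longrightarrow> (\<forall>x\<in>X. \<exists>f\<in>F. f \<in> X \<and> x - f \<in> K) \<longrightarrow> finite I"
    using exists_coset_reps[OF K] by blast
  have "\<forall>x\<in>X. \<exists>f\<in>F. f \<in> X \<and> x - f \<in> K"
    using F N by blast
  with I F show ?thesis
    by blast
qed

lemma coset_reps_Int:
  assumes K: "add_subgroup K" and I: "coset_reps K X I" and Y: "Y \<subseteq> X" "coset_stable K Y"
  shows "coset_reps K Y (I \<inter> Y)"
  unfolding coset_reps_def
proof (intro conjI ballI)
  fix y assume y: "y \<in> Y"
  then have *: "\<exists>!i. i \<in> I \<and> y - i \<in> K"
    using coset_repsD(2)[OF I] Y by blast
  then obtain i where i: "i \<in> I" "y - i \<in> K"
    by blast
  have "y + (i - y) \<in> Y"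
    using Y(2) y add_subgroup_diff_commute[OF K i(2)] unfolding coset_stable_def by blast
  then show "\<exists>!i. i \<in> I \<inter> Y \<and> y - i \<in> K"
    using i * by (auto simp: Ex1_def)
qed auto

lemma coset_index_eq_card_indexed:
  assumes K: "add_subgroup K" and f: "f ` J \<subseteq> X"
    and ex: "\<And>x. x \<in> X \<Longrightarrow> \<exists>j\<in>J. x - f j \<in> K"
    and un: "\<And>i j. i \<in> J \<Longrightarrow> j \<in> J \<Longrightarrow> f i - f j \<in> K \<Longrightarrow> i = j"
  shows "coset_index K X = card J"
proof -
  have inj: "inj_on f J"
    using un add_subgroup_0[OF K] by (auto simp: inj_on_def)
  have "coset_reps K X (f ` J)"
    unfolding coset_reps_def
  proof (intro conjI ballI)
    fix x assume "x \<in> X"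
    then obtain j where j: "j \<in> J" "x - f j \<in> K"
      using ex by blast
    show "\<exists>!i. i \<in> f ` J \<and> x - i \<in> K"
    proof (intro ex1I[of _ "f j"])
      fix i assume "i \<in> f ` J \<and> x - i \<in> K"
      then show "i = f j"
        using un j add_subgroup_diff_trans[OF K] add_subgroup_diff_commute[OF K] by blast
    qed (use j in auto)
  qed (use f in auto)
  then show ?thesis
    using coset_index_eq_card[OF K] card_image[OF inj] by metis
qed

lemma coset_index_image:
  assumes K: "add_subgroup K" "add_subgroup K'"
    and f: "\<And>x y. x \<in> X \<Longrightarrow> y \<in> X \<Longrightarrow> f x - f y \<in> K' \<longleftrightarrow> x - y \<in> K"
  shows "coset_index K' (f ` X) = coset_index K X"
proof -
  obtain I where I: "coset_reps K X I"
    using exists_coset_reps[OF K(1)] by blast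
  have "coset_index K' (f ` X) = card I"
  proof (rule coset_index_eq_card_indexed[OF K(2)])
    show "f ` I \<subseteq> f ` X"
      using coset_repsD(1)[OF I] by blast
    show "\<exists>i\<in>I. y - f i \<in> K'" if "y \<in> f ` X" for y
      using that coset_repsD[OF I] f by blast
    show "i = j" if "i \<in> I" "j \<in> I" "f i - f j \<in> K'" for i j
      using that coset_repsD(1)[OF I] f coset_reps_unique[OF K(1) I] by blast
  qed
  then show ?thesis
    by (simp add: coset_index_eq_card[OF K(1) I])
qed

text \<open>A Lebesgue number argument. Finitely many centres \<open>c\<close> suffice; a point
  \<open>u\<close> near \<open>c\<close> differs from it by an element of the group
  \<open>K (e c)\<close>, so moving \<open>u\<close> by a small \<open>k\<close> amounts to moving
  \<open>c\<close> by \<open>(u - c) + k\<close>, again an element of that group.\<close>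

lemma compact_coset_stable:
  fixes U :: "'g::{ab_group_add, topological_space} set" and K :: "real \<Rightarrow> 'g set"
  assumes K: "\<And>\<epsilon>. 0 < \<epsilon> \<Longrightarrow> add_subgroup (K \<epsilon>)" "\<And>\<epsilon> \<epsilon>'. \<epsilon> \<le> \<epsilon>' \<Longrightarrow> K \<epsilon> \<subseteq> K \<epsilon>'" and U: "compact U"
    and loc: "\<And>u. u \<in> U \<Longrightarrow> \<exists>\<epsilon>>0. \<forall>k\<in>K \<epsilon>. u + k \<in> U"
    and nb: "\<And>u \<epsilon>. u \<in> U \<Longrightarrow> 0 < \<epsilon> \<Longrightarrow> \<exists>O'. open O' \<and> u \<in> O' \<and> (\<forall>y\<in>O' \<inter> U. y - u \<in> K \<epsilon>)"
  shows "\<exists>\<epsilon>>0. \<forall>\<epsilon>'\<le>\<epsilon>. coset_stable (K \<epsilon>') U"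
proof -
  obtain e where e: "\<And>u. u \<in> U \<Longrightarrow> 0 < e u" "\<And>u k. u \<in> U \<Longrightarrow> k \<in> K (e u) \<Longrightarrow> u + k \<in> U"
    using loc by metis
  obtain N where N: "\<And>u. u \<in> U \<Longrightarrow> open (N u) \<and> u \<in> N u \<and> (\<forall>y\<in>N u \<inter> U. y - u \<in> K (e u))"
  proof -
    have "\<exists>O'. open O' \<and> u \<in> O' \<and> (\<forall>y\<in>O' \<inter> U. y - u \<in> K (e u))" if "u \<in> U" for u
      using nb[OF that e(1)[OF that]] .
    then show ?thesis
      using that by metis
  qed
  obtain F where F: "F \<subseteq> U" "finite F" "U \<subseteq> (\<Union>c\<in>F. N c)"
    using compactE_image[OF U, of U N] N by (metis UN_I subsetI)
  define m where "m = Min (insert 1 (e ` F))"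
  have "0 < m"
    using F e(1) by (auto simp: m_def)
  moreover have "u + k \<in> U" if u: "u \<in> U" and k: "k \<in> K \<epsilon>" "\<epsilon> \<le> m" for u k \<epsilon>
  proof -
    obtain c where c: "c \<in> F" "u \<in> N c"
      using F u by blast
    have "m \<le> e c"
      using c F by (simp add: m_def)
    then have "k \<in> K (e c)"
      using K(2)[of \<epsilon> "e c"] k by auto
    moreover have cU: "c \<in> U" and "u - c \<in> K (e c)"
      using N F u c by blast+
    ultimately have "c + ((u - c) + k) \<in> U"
      using e(2) add_subgroup_add[OF K(1)[OF e(1)[OF cU]]] by blast
    then show ?thesis
      by simp
  qed
  ultimately show ?thesis
    unfolding coset_stable_def by blast
qed

text \<open>The cosets of \<open>K\<close> inside \<open>X\<close> are disjoint translates of equal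
  mass. If there are infinitely many, \<open>X\<close> either has infinite mass or is not
  measurable, and both sides are 0.\<close>

lemma haar_measure_coset_index:
  fixes \<mu> :: "'g::{topological_space, ab_group_add} measure"
  assumes \<mu>: "haar_measure_on G \<mu>" and K: "add_subgroup K" "K \<in> sets \<mu>"
    and fin: "0 < emeasure \<mu> K" "emeasure \<mu> K < \<infinity>"
    and X: "X \<subseteq> G" "coset_stable K X"
  shows "measure \<mu> X = real (coset_index K X) * measure \<mu> K"
proof -
  obtain I where I: "coset_reps K X I"
    using exists_coset_reps[OF K(1)] by blast
  have tr: "emeasure \<mu> ((\<lambda>x. a + x) ` K) = emeasure \<mu> K" if "a \<in> I" for a
    using \<mu> K X coset_repsD(1)[OF I] that unfolding haar_measure_on_def by blast
  \<comment> \<open>Invariance is an equation of masses and does not assert that a translate is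
    measurable. This follows here because a nonmeasurable set has mass 0, while \<open>K\<close> has
    positive mass.\<close>
  have tr_sets: "(\<lambda>x. a + x) ` K \<in> sets \<mu>" if "a \<in> I" for a
    using tr[OF that] fin emeasure_notin_sets by (metis less_irrefl)
  have disj: "disjoint_family_on (\<lambda>a. (\<lambda>x. a + x) ` K) I"
    unfolding disjoint_family_on_def
  proof safe
    fix a b k l assume ab: "a \<in> I" "b \<in> I" "a \<noteq> b" and kl: "k \<in> K" "l \<in> K" "a + k = b + l"
    then have "a - b = l - k"
      by (simp add: algebra_simps)
    then have "a - b \<in> K"
      using add_subgroup_diff[OF K(1)] kl by simp
    then show "a + k \<in> {}"
      using coset_reps_unique[OF K(1) I] ab by blast
  qed
  have sub: "(\<lambda>x. a + x) ` K \<subseteq> X" if "a \<in> I" for a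
    using X(2) that coset_repsD(1)[OF I] unfolding coset_stable_def by blast
  have em: "emeasure \<mu> (\<Union>a\<in>J. (\<lambda>x. a + x) ` K) = of_nat (card J) * emeasure \<mu> K"
    if J: "J \<subseteq> I" "finite J" for J
  proof -
    have "(\<Sum>a\<in>J. emeasure \<mu> ((\<lambda>x. a + x) ` K)) = emeasure \<mu> (\<Union>a\<in>J. (\<lambda>x. a + x) ` K)"
      using J tr_sets disj by (intro sum_emeasure) (auto intro: disjoint_family_on_mono)
    moreover have "(\<Sum>a\<in>J. emeasure \<mu> ((\<lambda>x. a + x) ` K)) = (\<Sum>a\<in>J. emeasure \<mu> K)"
      using J tr by (intro sum.cong) auto
    ultimately show ?thesis
      by simp
  qed
  have idx: "coset_index K X = card I"
    by (rule coset_index_eq_card[OF K(1) I])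
  show ?thesis
  proof (cases "finite I")
    case True
    have "X = (\<Union>a\<in>I. (\<lambda>x. a + x) ` K)"
    proof
      show "X \<subseteq> (\<Union>a\<in>I. (\<lambda>x. a + x) ` K)"
      proof
        fix x assume "x \<in> X"
        then obtain i where "i \<in> I" "x - i \<in> K"
          using coset_repsD(2)[OF I] by blast
        then show "x \<in> (\<Union>a\<in>I. (\<lambda>x. a + x) ` K)"
          by (metis UN_I add.commute diff_add_cancel imageI)
      qed
    qed (use sub in blast)
    then show ?thesis
      using em[OF subset_refl True] idx
      by (simp add: measure_def enn2real_mult ennreal_of_nat_eq_real_of_nat)
  next
    case False
    have "measure \<mu> X = 0"
    proof (cases "X \<in> sets \<mu>")
      case True
      have ge: "of_nat n * emeasure \<mu> K \<le> emeasure \<mu> X" for n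
      proof -
        obtain J where J: "J \<subseteq> I" "finite J" "card J = n"
          using infinite_arbitrarily_large[OF False] by blast
        then have "emeasure \<mu> (\<Union>a\<in>J. (\<lambda>x. a + x) ` K) \<le> emeasure \<mu> X"
          using True sub by (intro emeasure_mono) blast+
        then show ?thesis
          using em[OF J(1,2)] J by simp
      qed
      have "emeasure \<mu> X = \<infinity>"
      proof (rule ccontr)
        assume "emeasure \<mu> X \<noteq> \<infinity>"
        then obtain c where c: "emeasure \<mu> X = ennreal c" "0 \<le> c"
          by (metis ennreal_cases infinity_ennreal_def)
        obtain k where k: "emeasure \<mu> K = ennreal k" "0 < k"
          using fin by (metis ennreal_cases ennreal_eq_0_iff infinity_ennreal_def less_irrefl not_less)
        obtain n where n: "c < of_nat n * k"
          using k(2) by (meson ex_less_of_nat_mult)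
        have "ennreal (of_nat n * k) \<le> ennreal c"
          using ge[of n] k c by (simp add: ennreal_mult ennreal_of_nat_eq_real_of_nat)
        then show False
          using n c by (simp add: ennreal_le_iff)
      qed
      then show ?thesis
        by (simp add: measure_def)
    qed (simp add: measure_notin_sets)
    with False idx show ?thesis
      by simp
  qed
qed

subsection \<open>Residue fields\<close>

lemma add_subgroup_valuation_ideal: "add_subgroup valuation_ideal"
  using absval_add_less[of _ 1 "- _"] by (auto simp: add_subgroup_def valuation_ideal_def)

lemma exists_finite_reps_residue:
  "\<exists>S :: 'a::nonarch_local_field set.
     finite S \<and> coset_reps valuation_ideal valuation_ring S"
proof (rule exists_finite_coset_reps)
  show "compact (valuation_ring :: 'a set)"
    using compact_val_ball[of 1] by (simp add: val_ball_def valuation_ring_def)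
  show "\<exists>O'. open O' \<and> x \<in> O' \<and> (\<forall>y\<in>O' \<inter> valuation_ring. y - x \<in> valuation_ideal)" for x :: 'a
    by (intro exI[of _ "ball x 1"]) (auto simp: valuation_ideal_def dist_absval absval_minus_commute)
qed (rule add_subgroup_valuation_ideal)

lemma residue_card_eq:
  "residue_card TYPE('a::nonarch_local_field)
     = coset_index valuation_ideal (valuation_ring :: 'a set)"
proof -
  let ?R = "{(x, y::'a). x \<in> valuation_ring \<and> y \<in> valuation_ring \<and> x - y \<in> valuation_ideal}"
  have ring: "y \<in> valuation_ring"
    if "x \<in> valuation_ring" "y - x \<in> valuation_ideal" for x y :: 'a
    using that absval_add_le[of "y - x" 1 x] by (auto simp: valuation_ring_def valuation_ideal_def)
  have "?R `` {x} = {y. y - x \<in> valuation_ideal}" if "x \<in> valuation_ring" for x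
    using that ring by (auto simp: valuation_ideal_def absval_minus_commute)
  then have "valuation_ring // ?R = (\<lambda>x. {y. y - x \<in> valuation_ideal}) ` valuation_ring"
    unfolding quotient_def by auto
  then show ?thesis
    by (simp add: residue_card_def coset_index_def)
qed

lemma residue_card_eq_card:
  assumes "coset_reps valuation_ideal (valuation_ring :: 'a::nonarch_local_field set) S"
  shows "residue_card TYPE('a) = card S"
  using coset_index_eq_card[OF add_subgroup_valuation_ideal assms] by (simp add: residue_card_eq)

lemma residue_card_pos: "0 < residue_card TYPE('a::nonarch_local_field)"
proof -
  obtain S :: "'a set" where S: "finite S" "coset_reps valuation_ideal valuation_ring S"
    using exists_finite_reps_residue by blast
  moreover have "S \<noteq> {}"
    using coset_repsD(2)[OF S(2), of 0] by (auto simp: valuation_ring_def)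
  ultimately show ?thesis
    by (simp add: residue_card_eq_card card_gt_0_iff)
qed

text \<open>A uniformizer. The open unit ball is also closed, so the valuation ideal is compact and
  \<open>absval\<close> attains its maximum on it; this is where discreteness of the valuation comes
  from.\<close>

lemma valuation_ideal_max:
  obtains \<pi> :: "'a::nonarch_local_field"
  where "\<pi> \<in> valuation_ideal" "\<pi> \<noteq> 0" "\<And>x::'a. x \<in> valuation_ideal \<Longrightarrow> absval x \<le> absval \<pi>"
proof -
  obtain p :: 'a where p: "p \<noteq> 0" "absval p < 1"
    using exists_absval_less_1 by blast
  have "closed (ball (0::'a) 1)"
  proof -
    have "open (- ball (0::'a) 1)"
      unfolding open_dist
    proof
      fix x :: 'a assume x: "x \<in> - ball 0 1"
      have "y \<in> - ball 0 1" if "dist y x < 1" for y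
        using absval_add_less[of "x - y" 1 y] x that
        by (force simp: dist_absval absval_minus_commute)
      then show "\<exists>e>0. \<forall>y. dist y x < e \<longrightarrow> y \<in> - ball 0 1"
        by (intro exI[of _ 1]) auto
    qed
    then show ?thesis
      by (simp add: closed_def)
  qed
  then have "compact (val_ball 1 \<inter> ball (0::'a) 1)"
    using compact_val_ball by blast
  moreover have "val_ball 1 \<inter> ball (0::'a) 1 = valuation_ideal"
    by (auto simp: val_ball_def valuation_ideal_def dist_absval)
  ultimately have "compact (valuation_ideal :: 'a set)"
    by simp
  moreover have "(valuation_ideal :: 'a set) \<noteq> {}"
    by (auto simp: valuation_ideal_def intro: exI[of _ 0])
  ultimately obtain \<pi> :: 'a where \<pi>: "\<pi> \<in> valuation_ideal" "\<And>x::'a. x \<in> valuation_ideal \<Longrightarrow> absval x \<le> absval \<pi>"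
    using continuous_attains_sup[of "valuation_ideal :: 'a set" absval] continuous_on_absval
    by (metis (no_types))
  moreover have "\<pi> \<noteq> 0"
    using \<pi>(2)[of p] p absval_nonneg[of p] absval_eq_0_iff[of p]
    by (auto simp: valuation_ideal_def simp del: absval_nonneg absval_eq_0_iff)
  ultimately show ?thesis
    using that by blast
qed

context separable_quadratic_extension
begin

lemma emb_divide: "\<iota> (a / b) = \<iota> a / \<iota> b"
proof (cases "b = 0")
  case False
  then have "\<iota> b \<noteq> 0"
    by (metis absval_eq_0_iff emb_absval)
  moreover have "\<iota> (a / b) * \<iota> b = \<iota> a"
    using False by (simp flip: emb_mult)
  ultimately show ?thesis
    by (simp add: field_simps)
qed simp

text \<open>If the residue of \<open>y\<close> is new, then \<open>1, y\<close> is an integral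
  basis. Were \<open>b\<close> the larger coefficient and not integral, dividing by it would
  approximate \<open>y\<close> by an integral element of \<open>F\<close>; were \<open>a\<close>
  strictly larger and not integral, it would dominate and \<open>z\<close> would not be
  integral.\<close>

lemma residue_generator:
  assumes y: "y \<in> valuation_ring" "\<And>a. a \<in> valuation_ring \<Longrightarrow> y - \<iota> a \<notin> valuation_ideal"
    and z: "z \<in> valuation_ring"
  obtains a b where "a \<in> valuation_ring" "b \<in> valuation_ring" "z = \<iota> a + \<iota> b * y"
proof -
  have "y \<notin> range \<iota>"
  proof
    assume "y \<in> range \<iota>"
    then obtain a where "y = \<iota> a" by blast
    then show False
      using y(1) y(2)[of a] by (simp add: valuation_ring_def emb_absval valuation_ideal_def)
  qed
  then obtain a b where ab: "z = \<iota> a + \<iota> b * y"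
    using decompose by blast
  have "absval b \<le> 1 \<and> absval a \<le> 1"
  proof (rule ccontr)
    assume *: "\<not> ?thesis"
    show False
    proof (cases "absval a \<le> absval b")
      case True
      then have b: "absval b > 1"
        using * by auto
      then have "b \<noteq> 0"
        by auto
      then have "y - \<iota> (- a / b) = z / \<iota> b"
        by (simp add: emb_divide emb_minus ab divide_simps) (metis absval_eq_0_iff emb_absval)
      moreover have "absval (z / \<iota> b) < 1"
        using z b by (simp add: absval_divide emb_absval valuation_ring_def divide_less_eq)
      moreover have "- a / b \<in> valuation_ring"
        using True b by (simp add: absval_divide valuation_ring_def divide_le_eq)
      ultimately show False
        using y(2)[of "- a / b"] by (simp add: valuation_ideal_def)
    next
      case False
      then have "absval a > 1"
        using * by auto
      moreover have "absval (\<iota> b * y) < absval (\<iota> a)"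
        using mult_left_mono[of "absval y" 1 "absval b"] y(1) False
        by (simp add: absval_mult emb_absval valuation_ring_def)
      ultimately show False
        using absval_add_eq[of "\<iota> b * y" "\<iota> a"] z
        by (simp add: ab emb_absval valuation_ring_def)
    qed
  qed
  then show ?thesis
    using that[of a b] ab by (simp add: valuation_ring_def)
qed

text \<open>
  The residue field extension has degree at most \<open>2\<close>. If it has degree \<open>1\<close> and the extension is
  unramified, every integral element is approximated to any precision by \<open>F\<close>, so that it is fixed
  by the isometry \<open>\<sigma>\<close>.
\<close>

lemma residue_card_extension:
  obtains f where "residue_card TYPE('e) = residue_card TYPE('f) ^ f" "unramified \<iota> \<Longrightarrow> f = 2"
proof -
  obtain S :: "'f set" where S: "finite S" "coset_reps valuation_ideal valuation_ring S"
    using exists_finite_reps_residue by blast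
  have S_ring: "s \<in> valuation_ring" if "s \<in> S" for s
    using coset_repsD(1)[OF S(2)] that by blast
  have S_eq: "s = t" if "s \<in> S" "t \<in> S" "absval (s - t) < 1" for s t
    using coset_reps_unique[OF add_subgroup_valuation_ideal S(2) that(1,2)] that(3)
    by (simp add: valuation_ideal_def)
  have S_ex: "\<exists>s\<in>S. absval (a - s) < 1" if "absval a \<le> 1" for a
    using coset_repsD(2)[OF S(2), of a] that by (auto simp: valuation_ring_def valuation_ideal_def)
  have card_S: "card S = residue_card TYPE('f)"
    using residue_card_eq_card[OF S(2)] by simp
  show ?thesis
  proof (cases "\<forall>y\<in>valuation_ring. \<exists>a\<in>valuation_ring. y - \<iota> a \<in> valuation_ideal")
    case True
    have "coset_index valuation_ideal (valuation_ring :: 'e set) = card S"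
    proof (rule coset_index_eq_card_indexed[OF add_subgroup_valuation_ideal])
      show "\<iota> ` S \<subseteq> valuation_ring"
        using S_ring by (auto simp: valuation_ring_def emb_absval)
      show "\<exists>s\<in>S. z - \<iota> s \<in> valuation_ideal" if z: "z \<in> valuation_ring" for z
      proof -
        obtain a where a: "absval a \<le> 1" "absval (z - \<iota> a) < 1"
          using True z by (auto simp: valuation_ring_def valuation_ideal_def)
        obtain s where s: "s \<in> S" "absval (a - s) < 1"
          using S_ex a by blast
        then have "absval (\<iota> a - \<iota> s) < 1"
          by (simp add: emb_absval flip: emb_diff)
        then have "absval (z - \<iota> s) < 1"
          using absval_add_less[OF a(2), of "\<iota> a - \<iota> s"] by simp
        then show ?thesis
          using s by (auto simp: valuation_ideal_def)
      qed
      show "s = t" if "s \<in> S" "t \<in> S" "\<iota> s - \<iota> t \<in> valuation_ideal" for s t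
        using that S_eq by (simp add: valuation_ideal_def emb_absval flip: emb_diff)
    qed
    then have "residue_card TYPE('e) = residue_card TYPE('f) ^ 1"
      using card_S by (simp add: residue_card_eq)
    moreover have "\<not> unramified \<iota>"
    proof
      assume u: "unramified \<iota>"
      obtain \<pi> :: 'f where \<pi>: "\<pi> \<in> valuation_ideal" "\<pi> \<noteq> 0"
          "\<And>x::'f. x \<in> valuation_ideal \<Longrightarrow> absval x \<le> absval \<pi>"
        using valuation_ideal_max by blast
      have \<pi>0: "\<iota> \<pi> \<noteq> 0"
        using \<pi>(2) by (metis absval_eq_0_iff emb_absval)
      have \<pi>1: "absval \<pi> < 1"
        using \<pi> by (simp add: valuation_ideal_def)
      have le: "absval x \<le> absval \<pi>" if "absval x < 1" for x :: 'e
      proof -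
        have "x \<in> {\<iota> a * y | a y. a \<in> valuation_ideal \<and> y \<in> valuation_ring}"
          using u that unfolding unramified_def by (auto simp: valuation_ideal_def)
        then obtain a y where "x = \<iota> a * y" "a \<in> valuation_ideal" "y \<in> valuation_ring"
          by blast
        then show ?thesis
          using \<pi>(3) by (auto simp: valuation_ring_def emb_absval intro: absval_mult_le_right)
      qed
      have approx: "\<exists>a. absval (z - \<iota> a) \<le> absval \<pi> ^ n" if "absval z \<le> 1" for z n
        using that
      proof (induction n arbitrary: z)
        case 0
        then show ?case
          by (intro exI[of _ 0]) simp
      next
        case (Suc n)
        obtain a where a: "absval (z - \<iota> a) < 1"
          using True Suc.prems by (auto simp: valuation_ring_def valuation_ideal_def)
        define w where "w = (z - \<iota> a) / \<iota> \<pi>"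
        have w: "\<iota> \<pi> * w = z - \<iota> a"
          using \<pi>0 by (simp add: w_def)
        have "absval w \<le> 1"
          unfolding w_def using le[OF a] \<pi>(2) by (simp add: absval_divide emb_absval)
        then obtain b where b: "absval (w - \<iota> b) \<le> absval \<pi> ^ n"
          using Suc.IH by blast
        have "z - \<iota> (a + \<pi> * b) = \<iota> \<pi> * (w - \<iota> b)"
          by (simp add: right_diff_distrib w emb_add emb_mult)
        then have "absval (z - \<iota> (a + \<pi> * b)) \<le> absval \<pi> ^ Suc n"
          using b by (simp add: absval_mult emb_absval mult_left_mono)
        then show ?case
          by blast
      qed
      have fixed: "\<sigma> z = z" if "absval z \<le> 1" for z
      proof (rule ccontr)
        assume "\<sigma> z \<noteq> z"
        then have "0 < absval (\<sigma> z - z)"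
          by simp
        then obtain n where n: "absval \<pi> ^ n < absval (\<sigma> z - z)"
          using real_arch_pow_inv[OF _ \<pi>1] by blast
        obtain a where a: "absval (z - \<iota> a) \<le> absval \<pi> ^ n"
          using approx \<open>absval z \<le> 1\<close> by blast
        then have "absval (\<sigma> (z - \<iota> a) - (z - \<iota> a)) \<le> absval \<pi> ^ n"
          using absval_diff_le[of "\<sigma> (z - \<iota> a)" _ "z - \<iota> a"] by simp
        then show False
          using n by (simp add: conj_diff conj_emb)
      qed
      \<comment> \<open>A moved element, scaled into the valuation ring by some \<open>c\<close>
        from \<open>F\<close>, contradicts \<open>fixed\<close>.\<close>
      obtain y where y: "\<sigma> y \<noteq> y"
        using exists_not_fixed by blast
      then have "y \<noteq> 0"
        by auto
      then obtain c :: 'f where c: "c \<noteq> 0" "absval c < 1 / absval y"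
        using exists_absval_small[of "1 / absval y"] by auto
      then have "absval (\<iota> c * y) \<le> 1"
        using \<open>y \<noteq> 0\<close> by (simp add: absval_mult emb_absval field_simps)
      then have "\<iota> c * \<sigma> y = \<iota> c * y"
        using fixed[of "\<iota> c * y"] by (simp add: conj_mult conj_emb)
      moreover have "\<iota> c \<noteq> 0"
        using c(1) by (metis absval_eq_0_iff emb_absval)
      ultimately show False
        using y by simp
    qed
    ultimately show ?thesis
      using that by blast
  next
    case False
    then obtain y where y: "y \<in> valuation_ring"
        "\<And>a. a \<in> valuation_ring \<Longrightarrow> y - \<iota> a \<notin> valuation_ideal"
      by blast
    \<comment> \<open>Here the residue degree is 2: the residues of \<open>1\<close> and
      \<open>y\<close> are independent over the residue field of \<open>F\<close>, so pairs of
      digits from \<open>S\<close> represent the residue field of \<open>F'\<close>.\<close>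
    define g where "g = (\<lambda>(s, t). \<iota> s + \<iota> t * y)"
    have y1: "absval y \<le> 1"
      using y by (simp add: valuation_ring_def)
    have zero: "absval a < 1 \<and> absval b < 1"
      if ab: "absval a \<le> 1" "absval b \<le> 1" "absval (\<iota> a + \<iota> b * y) < 1" for a b
    proof -
      have b: "absval b < 1"
      proof (rule ccontr)
        assume "\<not> absval b < 1"
        then have b: "absval b = 1" "b \<noteq> 0"
          using ab by auto
        then have "\<iota> b \<noteq> 0"
          by (metis absval_eq_0_iff emb_absval)
        then have "y - \<iota> (- a / b) = (\<iota> a + \<iota> b * y) / \<iota> b"
          by (simp add: emb_divide emb_minus divide_simps)
        then have "y - \<iota> (- a / b) \<in> valuation_ideal"
          using ab b by (simp add: valuation_ideal_def absval_divide emb_absval)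
        moreover have "- a / b \<in> valuation_ring"
          using ab b by (simp add: absval_divide valuation_ring_def)
        ultimately show False
          using y by blast
      qed
      have "absval (\<iota> b * y) < 1"
        using b y1 mult_left_mono[OF y1, of "absval b"] by (simp add: absval_mult emb_absval)
      then have "absval (\<iota> a) < 1"
        using ab(3) absval_add_less[of "\<iota> a + \<iota> b * y" 1 "- (\<iota> b * y)"] by simp
      with b show ?thesis
        by (simp add: emb_absval)
    qed
    have "coset_index valuation_ideal (valuation_ring :: 'e set) = card (S \<times> S)"
    proof (rule coset_index_eq_card_indexed[OF add_subgroup_valuation_ideal])
      show "g ` (S \<times> S) \<subseteq> valuation_ring"
        using S_ring y1
        by (auto simp: g_def valuation_ring_def emb_absval intro!: absval_add_le absval_mult_le_left)
      show "\<exists>p\<in>S \<times> S. z - g p \<in> valuation_ideal" if z: "z \<in> valuation_ring" for z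
      proof -
        obtain a b where ab: "absval a \<le> 1" "absval b \<le> 1" "z = \<iota> a + \<iota> b * y"
          using residue_generator[OF y z] by (auto simp: valuation_ring_def)
        obtain s t where st: "s \<in> S" "t \<in> S" "absval (a - s) < 1" "absval (b - t) < 1"
          using S_ex ab by meson
        have "absval (\<iota> (a - s) + \<iota> (b - t) * y) < 1"
          using st mult_left_mono[OF y1, of "absval (b - t)"]
          by (intro absval_add_less) (auto simp: emb_absval absval_mult)
        then have "z - g (s, t) \<in> valuation_ideal"
          by (simp add: g_def ab emb_diff algebra_simps valuation_ideal_def)
        then show ?thesis
          using st by blast
      qed
      show "p = p'" if "p \<in> S \<times> S" "p' \<in> S \<times> S" "g p - g p' \<in> valuation_ideal" for p p'
      proof -
        obtain s t s' t' where p: "p = (s, t)" "p' = (s', t')"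
          by (meson surj_pair)
        have "absval (\<iota> (s - s') + \<iota> (t - t') * y) < 1"
          using that(3) by (simp add: p g_def emb_diff algebra_simps valuation_ideal_def)
        moreover have "absval (s - s') \<le> 1" "absval (t - t') \<le> 1"
          using that S_ring by (auto simp: p valuation_ring_def intro!: absval_diff_le)
        ultimately show ?thesis
          using zero S_eq that by (auto simp: p)
      qed
    qed
    then have "residue_card TYPE('e) = residue_card TYPE('f) ^ 2"
      using card_S by (simp add: residue_card_eq card_cartesian_product power2_eq_square)
    then show ?thesis
      using that by blast
  qed
qed

end

subsection \<open>Finite dimensional Hausdorff vector spaces\<close>

lemma compact_combinations:
  fixes scale :: "'e::topological_space \<Rightarrow> 'v::topological_ab_group_add \<Rightarrow> 'v"
  assumes scale: "\<And>b. continuous_on UNIV (\<lambda>a. scale a b)"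
    and B: "finite B" and F: "\<And>b. b \<in> B \<Longrightarrow> compact (F b)"
  shows "compact {\<Sum>b\<in>B. scale (x b) b | x. \<forall>b\<in>B. x b \<in> F b}"
  using B F
proof (induction B)
  case empty
  then show ?case by simp
next
  case (insert b B)
  let ?S = "{\<Sum>b\<in>B. scale (x b) b | x. \<forall>b\<in>B. x b \<in> F b}"
  have "compact ((\<lambda>a. scale a b) ` F b)"
    using insert.prems scale continuous_on_subset by (intro compact_continuous_image) blast+
  then have "compact (((\<lambda>a. scale a b) ` F b) \<times> ?S)"
    using insert by (intro compact_Times) auto
  then have "compact ((\<lambda>p. fst p + snd p) ` (((\<lambda>a. scale a b) ` F b) \<times> ?S))"
    by (intro compact_continuous_image continuous_intros)
  moreover have "(\<lambda>p. fst p + snd p) ` (((\<lambda>a. scale a b) ` F b) \<times> ?S)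
      = {\<Sum>b\<in>insert b B. scale (x b) b | x. \<forall>b\<in>insert b B. x b \<in> F b}" (is "?L = ?R")
  proof
    show "?L \<subseteq> ?R"
    proof clarsimp
      fix a x assume a: "a \<in> F b" and x: "\<forall>b\<in>B. x b \<in> F b"
      have "(\<Sum>c\<in>B. scale ((x(b := a)) c) c) = (\<Sum>c\<in>B. scale (x c) c)"
        using insert.hyps by (intro sum.cong) auto
      then have "scale a b + (\<Sum>c\<in>B. scale (x c) c) = (\<Sum>c\<in>insert b B. scale ((x(b := a)) c) c)"
        using insert.hyps by simp
      then show "\<exists>y. scale a b + (\<Sum>c\<in>B. scale (x c) c) = (\<Sum>c\<in>insert b B. scale (y c) c) \<and>
          y b \<in> F b \<and> (\<forall>b\<in>B. y b \<in> F b)"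
        using a x insert.hyps by (intro exI[of _ "x(b := a)"]) auto
    qed
    show "?R \<subseteq> ?L"
      using insert.hyps by (force simp: image_iff)
  qed
  ultimately show ?case
    by simp
qed

context hermitian_space
begin

lemma continuous_on_scale:
  assumes "continuous_on A f" "continuous_on A g"
  shows "continuous_on A (\<lambda>x. scale (f x) (g x))"
proof -
  have "continuous_on A (\<lambda>x. (\<lambda>(a, x). scale a x) (f x, g x))"
    using assms by (intro continuous_on_compose2[OF scale_continuous] continuous_intros) auto
  then show ?thesis
    by simp
qed

lemma exists_finite_basis: "\<exists>B. finite B \<and> independent B \<and> span B = UNIV"
proof -
  obtain B0 where B0: "finite B0" "span B0 = UNIV"
    using finite_dim by blast
  obtain B where B: "B \<subseteq> B0" "independent B" "B0 \<subseteq> span B"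
    by (rule maximal_independent_subset)
  have "span B = UNIV"
    using B0(2) span_mono[OF B(3)] by (simp add: span_span top.extremum_unique)
  then show ?thesis
    using B(2) finite_subset[OF B(1) B0(1)] by (intro exI[of _ B]) simp
qed

text \<open>
  A nonzero vector can be scaled into the compact set of vectors whose coordinates are integral
  with one of them equal to \<open>1\<close>. This set avoids \<open>0\<close>, hence a neighbourhood of \<open>0\<close>.
\<close>

lemma coordinates_bounded:
  assumes B: "finite B" "independent B" "span B = UNIV"
  obtains W where "open W" "0 \<in> W"
    "\<And>v b. v \<in> W \<Longrightarrow> b \<in> B \<Longrightarrow> absval (representation B v b) \<le> 1"
proof -
  define S where "S c = {\<Sum>b\<in>B. scale (x b) b | x. \<forall>b\<in>B. x b \<in> (if b = c then {1} else val_ball 1)}" for c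
  have "compact (S c)" for c
    unfolding S_def
    by (rule compact_combinations[OF _ B(1)])
       (auto intro!: continuous_on_scale continuous_intros compact_val_ball)
  then have "open (- (\<Union>c\<in>B. S c))"
    using B(1) compact_imp_closed by (intro open_Compl closed_UN) auto
  then have "open ((\<lambda>(a, x). scale a x) -` (- (\<Union>c\<in>B. S c)))"
    using scale_continuous by (simp add: continuous_on_open_vimage)
  moreover have "0 \<notin> S c" if "c \<in> B" for c
  proof
    assume "0 \<in> S c"
    then obtain x where x: "(\<Sum>b\<in>B. scale (x b) b) = 0" "\<forall>b\<in>B. x b \<in> (if b = c then {1} else val_ball 1)"
      by (auto simp: S_def)
    then have "x c = 0"
      using independentD[OF B(2,1) subset_refl x(1) that] by simp
    then show False
      using x that by auto
  qed
  then have "(0, 0) \<in> (\<lambda>(a, x). scale a x) -` (- (\<Union>c\<in>B. S c))"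
    by auto
  ultimately obtain A W0 where AW: "open A" "open W0" "(0, 0) \<in> A \<times> W0"
      "A \<times> W0 \<subseteq> (\<lambda>(a, x). scale a x) -` (- (\<Union>c\<in>B. S c))"
    by (rule open_prod_elim)
  obtain e where e: "0 < e" "ball 0 e \<subseteq> A"
    using AW open_contains_ball by (metis mem_Sigma_iff)
  obtain c :: 'e where c: "c \<noteq> 0" "absval c < e"
    using exists_absval_small[OF e(1)] by blast
  \<comment> \<open>\<open>t\<close> times \<open>v\<close> is \<open>t * c\<close> times
    \<open>v / c\<close>, and \<open>t * c\<close> stays in \<open>A\<close> for every integral
    \<open>t\<close>. One condition on \<open>v\<close> therefore handles all these scalings at
    once.\<close>
  have avoid: "scale t v \<notin> S b" if "scale (1 / c) v \<in> W0" "absval t \<le> 1" "b \<in> B" for t v b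
  proof -
    have "absval (t * c) \<le> absval c"
      using that by (intro absval_mult_le_left) auto
    then have "t * c \<in> A"
      using e c by (auto simp: dist_absval subset_iff)
    then have "(t * c, scale (1 / c) v) \<in> (\<lambda>(a, x). scale a x) -` (- (\<Union>c\<in>B. S c))"
      using subsetD[OF AW(4), of "(t * c, scale (1 / c) v)"] that(1) by simp
    then have "scale (t * c) (scale (1 / c) v) \<notin> S b"
      using that(3) by simp
    then show ?thesis
      using c by simp
  qed
  show ?thesis
  proof
    have "continuous_on UNIV (\<lambda>v. scale (1 / c) v)"
      by (intro continuous_on_scale continuous_intros)
    then show "open ((\<lambda>v. scale (1 / c) v) -` W0)"
      using AW by (simp add: continuous_on_open_vimage)
    show "0 \<in> (\<lambda>v. scale (1 / c) v) -` W0"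
      using AW by simp
    fix v b assume v: "v \<in> (\<lambda>v. scale (1 / c) v) -` W0" and b: "b \<in> B"
    show "absval (representation B v b) \<le> 1"
    proof (rule ccontr)
      assume big: "\<not> ?thesis"
      let ?x = "representation B v"
      obtain d where d: "d \<in> B" "\<And>b. b \<in> B \<Longrightarrow> absval (?x b) \<le> absval (?x d)"
      proof -
        let ?M = "Max ((\<lambda>b. absval (?x b)) ` B)"
        have "?M \<in> (\<lambda>b. absval (?x b)) ` B"
          using B(1) b by (intro Max_in) auto
        then obtain d where "d \<in> B" "?M = absval (?x d)"
          by blast
        moreover have "absval (?x b) \<le> ?M" if "b \<in> B" for b
          using B(1) that by (intro Max_ge) auto
        ultimately show ?thesis
          using that by simp
      qed
      then have xd: "1 < absval (?x d)"
        using big b by force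
      then have xd0: "?x d \<noteq> 0"
        by auto
      let ?t = "1 / ?x d"
      have "v = (\<Sum>b\<in>B. scale (?x b) b)"
        using sum_representation_eq[OF B(2) _ B(1) subset_refl, of v] B(3) by simp
      then have "scale ?t v = scale ?t (\<Sum>b\<in>B. scale (?x b) b)"
        by simp
      also have "\<dots> = (\<Sum>b\<in>B. scale (?t * ?x b) b)"
        by (simp add: scale_sum_right)
      finally have eq: "scale ?t v = (\<Sum>b\<in>B. scale (?t * ?x b) b)" .
      have "\<forall>b\<in>B. ?t * ?x b \<in> (if b = d then {1} else val_ball 1)"
        using d xd xd0 by (auto simp: val_ball_def absval_divide)
      with eq have "scale ?t v \<in> S d"
        unfolding S_def mem_Collect_eq by (intro exI[of _ "\<lambda>b. ?t * ?x b"] conjI)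
      moreover have "absval ?t \<le> 1"
        using xd by (simp add: absval_divide divide_le_eq)
      ultimately show False
        using avoid v d by blast
    qed
  qed
qed

text \<open>The counterpart of \<open>coordinates_bounded\<close>: continuity of addition and scalar
  multiplication puts a whole coordinate box into a given neighbourhood of 0. Together they identify
  the topology.\<close>

lemma small_combinations:
  assumes "finite B" "open U" "0 \<in> U"
  shows "\<exists>r>0. \<forall>x. (\<forall>b\<in>B. absval (x b) \<le> r) \<longrightarrow> (\<Sum>b\<in>B. scale (x b) b) \<in> U"
  using assms
proof (induction B arbitrary: U)
  case empty
  then show ?case
    by (auto intro: exI[of _ 1])
next
  case (insert b B)
  have "continuous_on UNIV (\<lambda>p::'v \<times> 'v. fst p + snd p)"
    by (intro continuous_intros)
  then have "open ((\<lambda>p::'v \<times> 'v. fst p + snd p) -` U)"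
    using insert by (simp add: continuous_on_open_vimage)
  moreover have "(0, 0) \<in> (\<lambda>p::'v \<times> 'v. fst p + snd p) -` U"
    using insert by simp
  ultimately obtain U1 U2 where U: "open U1" "open U2" "(0, 0) \<in> U1 \<times> U2"
      "U1 \<times> U2 \<subseteq> (\<lambda>p::'v \<times> 'v. fst p + snd p) -` U"
    by (rule open_prod_elim)
  then obtain r where r: "r > 0"
      "\<And>x. (\<forall>b\<in>B. absval (x b) \<le> r) \<Longrightarrow> (\<Sum>b\<in>B. scale (x b) b) \<in> U2"
    using insert.IH[of U2] by auto
  have "continuous_on UNIV (\<lambda>a. scale a b)"
    by (intro continuous_on_scale continuous_intros)
  then have "open ((\<lambda>a. scale a b) -` U1)"
    using U by (simp add: continuous_on_open_vimage)
  moreover have "0 \<in> (\<lambda>a. scale a b) -` U1"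
    using U by simp
  ultimately obtain e where e: "e > 0" "ball 0 e \<subseteq> (\<lambda>a. scale a b) -` U1"
    using open_contains_ball by metis
  show ?case
  proof (intro exI[of _ "min r (e / 2)"] conjI allI impI)
    fix x :: "'v \<Rightarrow> 'e" assume x: "\<forall>b\<in>insert b B. absval (x b) \<le> min r (e / 2)"
    then have "x b \<in> ball 0 e"
      using e by (auto simp: dist_absval)
    then have "scale (x b) b \<in> U1"
      using e by auto
    moreover have "(\<Sum>b\<in>B. scale (x b) b) \<in> U2"
      using r x by auto
    ultimately show "(\<Sum>b\<in>insert b B. scale (x b) b) \<in> U"
      using insert.hyps U(4) by auto
  qed (use r e in auto)
qed

lemma form_bound_left:
  assumes "finite B" "0 \<le> M" "\<And>b. b \<in> B \<Longrightarrow> absval (h b w) \<le> M"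
    and "0 \<le> r" "\<And>b. b \<in> B \<Longrightarrow> absval (x b) \<le> r"
  shows "absval (h (\<Sum>b\<in>B. scale (x b) b) w) \<le> r * M"
proof -
  have h0: "h 0 w = 0"
    using form_scale_left[of 0 0 w] by simp
  have "h (\<Sum>b\<in>B. scale (x b) b) w = (\<Sum>b\<in>B. x b * h b w)"
    using \<open>finite B\<close> by (induction B) (auto simp: h0 form_add_left form_scale_left)
  then show ?thesis
    using assms by (auto intro!: absval_sum_le absval_mult_le)
qed

text \<open>The maximum of the coordinates in a basis does it. Its balls give the abstract topology
  of \<open>V\<close> a scale of open subgroups, and the maximum of \<open>h\<close> over pairs of
  basis vectors becomes the bound \<open>H\<close>.\<close>

lemma exists_norm:
  assumes \<sigma>: "\<And>x. absval (\<sigma> x) = absval x"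
  obtains nv :: "'v \<Rightarrow> real" and H where
    "\<And>v. 0 \<le> nv v" "\<And>v w. nv (v + w) \<le> max (nv v) (nv w)"
    "\<And>a v. nv (scale a v) = absval a * nv v"
    "\<And>r. 0 < r \<Longrightarrow> open {v. nv v \<le> r}"
    "\<And>U. open U \<Longrightarrow> 0 \<in> U \<Longrightarrow> \<exists>r>0. \<forall>v. nv v \<le> r \<longrightarrow> v \<in> U"
    "0 \<le> H" "\<And>v w. absval (h v w) \<le> H * nv v * nv w"
proof -
  obtain B where B: "finite B" "independent B" "span B = UNIV"
    using exists_finite_basis by blast
  define nv where "nv v = Max (insert 0 ((\<lambda>b. absval (representation B v b)) ` B))" for v
  have nv_le: "nv v \<le> r \<longleftrightarrow> 0 \<le> r \<and> (\<forall>b\<in>B. absval (representation B v b) \<le> r)" for v r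
    using B(1) by (simp add: nv_def)
  have rep_le: "absval (representation B v b) \<le> nv v" if "b \<in> B" for v b
    using nv_le[of v "nv v"] that by simp
  have nonneg: "0 \<le> nv v" for v
    using nv_le[of v "nv v"] by simp
  have add: "nv (v + w) \<le> max (nv v) (nv w)" for v w
  proof -
    have "absval (representation B (v + w) b) \<le> max (nv v) (nv w)" if "b \<in> B" for b
      using rep_le[OF that, of v] rep_le[OF that, of w]
      by (simp add: representation_add B) (intro absval_add_le; simp)
    then show ?thesis
      using nonneg[of v] by (auto simp: nv_le)
  qed
  have le: "nv (scale a v) \<le> absval a * nv v" for a v
    using rep_le[of _ v] nonneg[of v]
    by (auto simp: nv_le representation_scale B absval_mult intro: mult_left_mono)
  have scale: "nv (scale a v) = absval a * nv v" for a v
  proof (cases "a = 0")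
    case True
    then show ?thesis
      using le[of a v] nonneg[of "scale a v"] by simp
  next
    case False
    have "nv v \<le> absval (1 / a) * nv (scale a v)"
      using le[of "1 / a" "scale a v"] False by simp
    then have "absval a * nv v \<le> nv (scale a v)"
      using False by (simp add: absval_divide field_simps)
    then show ?thesis
      using le[of a v] by simp
  qed
  obtain W where W: "open W" "0 \<in> W"
      "\<And>v b. v \<in> W \<Longrightarrow> b \<in> B \<Longrightarrow> absval (representation B v b) \<le> 1"
    using coordinates_bounded[OF B] by blast
  have opn: "open {v. nv v \<le> r}" if r: "0 < r" for r
  proof (rule topological_space_class.openI)
    fix v assume v: "v \<in> {v. nv v \<le> r}"
    obtain c :: 'e where c: "c \<noteq> 0" "absval c < r"
      using exists_absval_small[OF r] by blast
    have "continuous_on UNIV (\<lambda>w. scale (1 / c) (w - v))"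
      by (intro continuous_on_scale continuous_intros)
    then have "open ((\<lambda>w. scale (1 / c) (w - v)) -` W)"
      using W by (simp add: continuous_on_open_vimage)
    moreover have "nv w \<le> r" if "scale (1 / c) (w - v) \<in> W" for w
    proof -
      have "nv (scale (1 / c) (w - v)) \<le> 1"
        using W(3)[OF that] by (simp add: nv_le)
      then have "nv (w - v) \<le> absval c"
        using c by (simp add: scale absval_divide)
      then show ?thesis
        using add[of "w - v" v] c v by simp
    qed
    ultimately show "\<exists>T. open T \<and> v \<in> T \<and> T \<subseteq> {v. nv v \<le> r}"
      using W(2) by (intro exI[of _ "(\<lambda>w. scale (1 / c) (w - v)) -` W"]) auto
  qed
  have repr: "v = (\<Sum>b\<in>B. scale (representation B v b) b)" for v
    using sum_representation_eq[OF B(2) _ B(1) subset_refl, of v] B(3) by simp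
  have nb: "\<exists>r>0. \<forall>v. nv v \<le> r \<longrightarrow> v \<in> U" if U: "open U" "0 \<in> U" for U
  proof -
    obtain r where r: "r > 0" "\<And>x. (\<forall>b\<in>B. absval (x b) \<le> r) \<Longrightarrow> (\<Sum>b\<in>B. scale (x b) b) \<in> U"
      using small_combinations[OF B(1) U] by blast
    have "v \<in> U" if "nv v \<le> r" for v
      using that r(2)[of "representation B v"] repr[of v] by (simp add: nv_le)
    with r(1) show ?thesis
      by blast
  qed
  define H where "H = Max (insert 0 ((\<lambda>(b, c). absval (h b c)) ` (B \<times> B)))"
  have H: "0 \<le> H" "\<And>b c. b \<in> B \<Longrightarrow> c \<in> B \<Longrightarrow> absval (h b c) \<le> H"
    using B(1) by (auto simp: H_def intro!: Max_ge)
  have hb: "absval (h b w) \<le> nv w * H" if "b \<in> B" for b w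
  proof -
    have "absval (h (\<Sum>c\<in>B. scale (representation B w c) c) b) \<le> nv w * H"
      using B(1) H rep_le nonneg that by (intro form_bound_left) auto
    then have "absval (h w b) \<le> nv w * H"
      using repr[of w] by simp
    then show ?thesis
      using form_hermitian[of b w] \<sigma> by simp
  qed
  have "absval (h v w) \<le> H * nv v * nv w" for v w
  proof -
    have "absval (h (\<Sum>b\<in>B. scale (representation B v b) b) w) \<le> nv v * (nv w * H)"
      using B(1) H rep_le nonneg hb by (intro form_bound_left) auto
    then show ?thesis
      using repr[of v] by (simp add: mult_ac)
  qed
  with that nonneg add scale opn nb H(1) show ?thesis
    by blast
qed

end

subsection \<open>Congruence of Hermitian matrices\<close>

definition mat_ball :: "real \<Rightarrow> ('a::nonarch_local_field ^ 'm ^ 'n) set" where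
  "mat_ball r = {X. \<forall>i j. absval (X $ i $ j) \<le> r}"

definition one_ball :: "real \<Rightarrow> ('a::nonarch_local_field ^ 'n ^ 'n) set" where
  "one_ball s = {g. g - mat 1 \<in> mat_ball s}"

lemma add_subgroup_mat_ball: "0 \<le> r \<Longrightarrow> add_subgroup (mat_ball r)"
  by (auto simp: add_subgroup_def mat_ball_def intro: absval_diff_le)

lemma mat_ball_mono: "r \<le> s \<Longrightarrow> mat_ball r \<subseteq> mat_ball s"
  unfolding mat_ball_def using order_trans by blast

lemma mat_ball_mult:
  fixes X Y :: "'a::nonarch_local_field ^ 'n::finite ^ 'n"
  assumes "X \<in> mat_ball r" "Y \<in> mat_ball s" "0 \<le> r" "0 \<le> s"
  shows "X ** Y \<in> mat_ball (r * s)"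
  using assms by (auto simp: mat_ball_def matrix_matrix_mult_def intro!: absval_sum_le absval_mult_le)

lemma mat_ball_mult_left:
  fixes X Y :: "'a::nonarch_local_field ^ 'n::finite ^ 'n"
  assumes "X \<in> mat_ball 1" "Y \<in> mat_ball s" "0 \<le> s"
  shows "X ** Y \<in> mat_ball s"
  using mat_ball_mult[OF assms(1,2)] assms(3) by simp

lemma mat_ball_mult_right:
  fixes X Y :: "'a::nonarch_local_field ^ 'n::finite ^ 'n"
  assumes "X \<in> mat_ball s" "Y \<in> mat_ball 1" "0 \<le> s"
  shows "X ** Y \<in> mat_ball s"
  using mat_ball_mult[OF assms(1,2)] assms(3) by simp

lemma mat_mult_component:
  fixes X :: "'a::semiring_1 ^ 'n::finite ^ 'n"
  shows "(mat c ** X) $ i $ j = c * X $ i $ j" and "(X ** mat c) $ i $ j = X $ i $ j * c"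
  by (simp_all add: matrix_matrix_mult_def mat_def if_distrib[of "\<lambda>x. x * _"]
      if_distrib[of "\<lambda>x. _ * x"] cong: if_cong)

lemma mat_1_in_mat_ball: "mat 1 \<in> mat_ball 1"
  by (simp add: mat_ball_def mat_def)

lemma one_ball_nonneg: "g \<in> one_ball s \<Longrightarrow> 0 \<le> s"
  unfolding one_ball_def mat_ball_def using absval_nonneg order_trans by blast

lemma matrix_add_left:
  fixes A B C :: "'a::comm_ring_1 ^ 'n::finite ^ 'n"
  shows "(A + B) ** C = A ** C + B ** C"
  by (simp add: vec_eq_iff matrix_matrix_mult_def distrib_right sum.distrib)

lemma matrix_diff_left:
  fixes A B C :: "'a::comm_ring_1 ^ 'n::finite ^ 'n"
  shows "(A - B) ** C = A ** C - B ** C"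
  by (simp add: vec_eq_iff matrix_matrix_mult_def left_diff_distrib sum_subtractf)

lemma matrix_diff_right:
  fixes A B C :: "'a::comm_ring_1 ^ 'n::finite ^ 'n"
  shows "C ** (A - B) = C ** A - C ** B"
  by (simp add: vec_eq_iff matrix_matrix_mult_def right_diff_distrib sum_subtractf)

lemma one_ball_subset: "s \<le> 1 \<Longrightarrow> one_ball s \<subseteq> mat_ball 1"
proof
  fix g :: "'a ^ 'n ^ 'n" assume "s \<le> 1" "g \<in> one_ball s"
  then have "g - mat 1 \<in> mat_ball 1"
    using mat_ball_mono by (auto simp: one_ball_def)
  then show "g \<in> mat_ball 1"
    using add_subgroup_add[OF add_subgroup_mat_ball, of 1 "g - mat 1" "mat 1"] mat_1_in_mat_ball
    by simp
qed

lemma one_ball_mult: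
  fixes g h :: "'a::nonarch_local_field ^ 'n::finite ^ 'n"
  assumes "g \<in> one_ball s" "h \<in> one_ball s" "0 \<le> s" "s \<le> 1"
  shows "g ** h \<in> one_ball s"
proof -
  have "g ** h - mat 1 = (g - mat 1) ** h + (h - mat 1)"
    by (simp add: matrix_diff_left)
  moreover have "(g - mat 1) ** h \<in> mat_ball s"
    using assms one_ball_subset by (intro mat_ball_mult_right) (auto simp: one_ball_def)
  moreover have "h - mat 1 \<in> mat_ball s"
    using assms by (simp add: one_ball_def)
  ultimately show ?thesis
    using add_subgroup_add[OF add_subgroup_mat_ball[OF assms(3)], of "(g - mat 1) ** h" "h - mat 1"]
    unfolding one_ball_def mem_Collect_eq by metis
qed

text \<open>At a coordinate where \<open>v\<close> is largest, the correction coming from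
  \<open>g - mat 1\<close> is strictly smaller and cannot change the absolute value.\<close>

lemma one_ball_isometry:
  fixes g :: "'a::nonarch_local_field ^ 'n::finite ^ 'n"
  assumes g: "g \<in> one_ball s" "s < 1" and r: "0 \<le> r" "\<And>i. absval ((g *v v) $ i) \<le> r"
  shows "absval (v $ j) \<le> r"
proof -
  let ?M = "Max (range (\<lambda>j. absval (v $ j)))"
  have "?M \<in> range (\<lambda>j. absval (v $ j))"
    by (intro Max_in) auto
  then obtain i where "?M = absval (v $ i)"
    by blast
  moreover have "absval (v $ j) \<le> ?M" for j
    by (intro Max_ge) auto
  ultimately have i: "absval (v $ j) \<le> absval (v $ i)" for j
    by simp
  show ?thesis
  proof (cases "v $ i = 0")
    case True
    then show ?thesis
      using i[of j] r(1) by simp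
  next
    case False
    have "s \<ge> 0"
      using g(1) by (rule one_ball_nonneg)
    have eq: "(g *v v) $ i = v $ i + ((g - mat 1) *v v) $ i"
      by (simp add: matrix_vector_mult_diff_rdistrib)
    have "absval (((g - mat 1) *v v) $ i) \<le> s * absval (v $ i)"
      unfolding matrix_vector_mult_def using g i \<open>s \<ge> 0\<close>
      by (auto simp: one_ball_def mat_ball_def intro!: absval_sum_le absval_mult_le)
    also have "\<dots> < absval (v $ i)"
      using False g by simp
    finally have "absval ((g *v v) $ i) = absval (v $ i)"
      by (simp only: eq absval_add_eq)
    then show ?thesis
      using r(2)[of i] i[of j] by simp
  qed
qed

text \<open>The isometry property gives injectivity, hence a left inverse, which is two-sided for
  square matrices. Applied to the columns of the inverse it shows them integral, and
  \<open>g' - mat 1\<close>, being minus the product of \<open>g'\<close> and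
  \<open>g - mat 1\<close>, is then small.\<close>

lemma one_ball_inverse:
  fixes g :: "'a::nonarch_local_field ^ 'n::finite ^ 'n"
  assumes g: "g \<in> one_ball s" "s < 1"
  obtains g' where "g ** g' = mat 1" "g' ** g = mat 1" "g' \<in> one_ball s"
proof -
  have s: "s \<ge> 0"
    using g(1) by (rule one_ball_nonneg)
  have "inj ((*v) g)"
  proof (rule injI)
    fix x y assume "g *v x = g *v y"
    then have "g *v (x - y) = 0"
      by (simp add: matrix_vector_mult_diff_distrib)
    then have "absval ((x - y) $ j) \<le> 0" for j
      using one_ball_isometry[OF g, of 0 "x - y"] by simp
    then show "x = y"
      by (simp add: vec_eq_iff) (metis absval_eq_0_iff absval_nonneg antisym eq_iff_diff_eq_0)
  qed
  then obtain g' where g': "g' ** g = mat 1"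
    using matrix_left_invertible_injective[of g] by blast
  then have g'2: "g ** g' = mat 1"
    by (simp add: matrix_left_right_inverse)
  have "absval (g' $ i $ j) \<le> 1" for i j
  proof -
    have "(g *v column j g') $ k = (mat 1 :: 'a ^ 'n ^ 'n) $ k $ j" for k
      unfolding g'2[symmetric] by (simp add: matrix_vector_mult_def matrix_matrix_mult_def column_def)
    then have "absval ((g *v column j g') $ k) \<le> 1" for k
      by (simp add: mat_def)
    then show ?thesis
      using one_ball_isometry[OF g, of 1 "column j g'" i] by (simp add: column_def)
  qed
  then have "g' ** (g - mat 1) \<in> mat_ball s"
    using g s by (intro mat_ball_mult_left) (auto simp: mat_ball_def one_ball_def)
  then have "- (g' ** (g - mat 1)) \<in> mat_ball s"
    by (simp add: mat_ball_def)
  moreover have "- (g' ** (g - mat 1)) = g' - mat 1"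
    by (simp add: matrix_diff_right g')
  ultimately have "g' \<in> one_ball s"
    by (simp add: one_ball_def)
  with g' g'2 that show ?thesis
    by blast
qed

context separable_quadratic_extension
begin

definition ctrans :: "'e ^ 'n ^ 'm \<Rightarrow> 'e ^ 'm ^ 'n" where
  "ctrans X = (\<chi> i j. \<sigma> (X $ j $ i))"

lemma ctrans_component [simp]: "ctrans X $ i $ j = \<sigma> (X $ j $ i)"
  by (simp add: ctrans_def)

lemma ctrans_ctrans [simp]: "ctrans (ctrans X) = X"
  by (simp add: vec_eq_iff)

lemma ctrans_add: "ctrans (X + Y) = ctrans X + ctrans Y"
  by (simp add: vec_eq_iff conj_add)

lemma ctrans_diff: "ctrans (X - Y) = ctrans X - ctrans Y"
  by (simp add: vec_eq_iff conj_diff)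

lemma ctrans_mat [simp]: "ctrans (mat c) = mat (\<sigma> c)"
  by (simp add: vec_eq_iff mat_def)

lemma ctrans_mult:
  fixes X Y :: "'e ^ 'n::finite ^ 'n"
  shows "ctrans (X ** Y) = ctrans Y ** ctrans X"
  by (simp add: vec_eq_iff matrix_matrix_mult_def conj_sum conj_mult mult.commute)

lemma ctrans_mat_ball [simp]: "ctrans X \<in> mat_ball r \<longleftrightarrow> X \<in> mat_ball r"
  by (auto simp: mat_ball_def)

lemma mat_ball_congruence:
  fixes g X :: "'e ^ 'n::finite ^ 'n"
  assumes "g \<in> mat_ball 1" "X \<in> mat_ball r" "0 \<le> r"
  shows "g ** X ** ctrans g \<in> mat_ball r"
  using assms by (intro mat_ball_mult_right mat_ball_mult_left) auto

lemma herm_iff_ctrans: "X \<in> herm \<sigma> \<longleftrightarrow> ctrans X = X"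
  unfolding herm_def vec_eq_iff ctrans_component mem_Collect_eq by metis

lemma herm_congruence:
  fixes g X :: "'e ^ 'n::finite ^ 'n"
  assumes "X \<in> herm \<sigma>"
  shows "g ** X ** ctrans g \<in> herm \<sigma>"
  using assms by (simp add: herm_iff_ctrans ctrans_mult matrix_mul_assoc)

text \<open>
  Newton iteration for \<open>g T g\<^sup>* = T\<^sub>1\<close>. If the current error is \<open>g E g\<^sup>*\<close>, replacing \<open>g\<close> by \<open>g (1 + X)\<close>
  with \<open>X = c E T\<^bsup>-1\<^esup>\<close> and \<open>c + \<sigma> c = 1\<close> cancels it up to \<open>g X T X\<^sup>* g\<^sup>*\<close>, which is quadratic in \<open>E\<close>.
\<close>

lemma approximate_congruence:
  fixes T :: "'e ^ 'n::finite ^ 'n"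
  assumes T: "T \<in> herm \<sigma>" "det T \<noteq> 0" and s: "0 < s" "s < 1"
  obtains R where "0 < R"
    "\<And>T\<^sub>1 \<epsilon>. T\<^sub>1 \<in> herm \<sigma> \<Longrightarrow> T\<^sub>1 - T \<in> mat_ball R \<Longrightarrow> 0 < \<epsilon> \<Longrightarrow>
       \<exists>g\<in>one_ball s. T\<^sub>1 - g ** T ** ctrans g \<in> mat_ball \<epsilon>"
proof -
  obtain T' where T': "T ** T' = mat 1" "T' ** T = mat 1"
    using T(2) by (auto simp: invertible_det_nz[symmetric] invertible_def)
  obtain c where c: "c + \<sigma> c = 1"
    using exists_trace_one by blast
  define M where "M = Max (insert 1 (range (\<lambda>(i, j). absval (T' $ i $ j))))"
  have M1: "1 \<le> M"
    by (simp add: M_def)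
  have T'M: "T' \<in> mat_ball M"
  proof -
    have "absval (T' $ i $ j) \<in> range (\<lambda>(i, j). absval (T' $ i $ j))" for i j
      by (intro image_eqI[of _ _ "(i, j)"]) auto
    then show ?thesis
      unfolding mat_ball_def M_def mem_Collect_eq by (intro allI Max_ge insertI2) auto
  qed
  \<comment> \<open>The element \<open>c\<close> of trace 1 need not be integral, so its size enters
    the bounds, like that of the inverse \<open>T'\<close>.\<close>
  define L where "L = max 1 (absval c)"
  have L1: "1 \<le> L" "absval c \<le> L"
    by (auto simp: L_def)
  have matL: "mat c \<in> mat_ball L"
    using L1 by (auto simp: mat_ball_def mat_def)
  \<comment> \<open>The first bound keeps the correction \<open>X\<close> in
    \<open>mat_ball s\<close>, so that the iterates stay in \<open>one_ball s\<close>. The second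
    makes the new error, of size at most \<open>L * L * M * r * r\<close>, at most half of the old
    error \<open>r\<close>.\<close>
  define R where "R = min (s / (L * M)) (1 / (2 * L * L * M))"
  have R: "0 < R" "L * M * R \<le> s" "L * L * M * R \<le> 1 / 2"
  proof -
    show "0 < R"
      using s L1 M1 by (simp add: R_def)
    have "L * M * R \<le> L * M * (s / (L * M))"
      using L1 M1 by (intro mult_left_mono) (auto simp: R_def)
    then show "L * M * R \<le> s"
      using L1 M1 by simp
    have "L * L * M * R \<le> L * L * M * (1 / (2 * L * L * M))"
      using L1 M1 by (intro mult_left_mono) (auto simp: R_def)
    then show "L * L * M * R \<le> 1 / 2"
      using L1 M1 by simp
  qed
  have step: "\<exists>g\<in>one_ball s. T\<^sub>1 - g ** T ** ctrans g \<in> mat_ball (R / 2 ^ n)"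
    if T1: "T\<^sub>1 \<in> herm \<sigma>" "T\<^sub>1 - T \<in> mat_ball R" for T\<^sub>1 n
  proof (induction n)
    case 0
    then show ?case
      using T1 s by (intro bexI[of _ "mat 1"]) (auto simp: one_ball_def mat_ball_def)
  next
    case (Suc n)
    define r where "r = R / 2 ^ n"
    have r: "0 < r" "r \<le> R"
      using R(1) by (auto simp: r_def divide_le_eq)
    obtain g where g: "g \<in> one_ball s" "T\<^sub>1 - g ** T ** ctrans g \<in> mat_ball r"
      using Suc by (auto simp: r_def)
    obtain g' where g': "g ** g' = mat 1" "g' ** g = mat 1" "g' \<in> one_ball s"
      using one_ball_inverse[OF g(1) s(2)] by blast
    have g1: "g \<in> mat_ball 1" "g' \<in> mat_ball 1"
      using g g' s one_ball_subset[of s] by auto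
    define E where "E = g' ** (T\<^sub>1 - g ** T ** ctrans g) ** ctrans g'"
    have E_ball: "E \<in> mat_ball r"
      unfolding E_def using g1 g r by (simp add: mat_ball_congruence)
    have "T\<^sub>1 - g ** T ** ctrans g \<in> herm \<sigma>"
      using T1(1) herm_congruence[OF T(1), of g] by (simp add: herm_iff_ctrans ctrans_diff)
    then have E_herm: "ctrans E = E"
      using herm_congruence herm_iff_ctrans by (auto simp: E_def)
    have "g ** E ** ctrans g
        = (g ** g') ** (T\<^sub>1 - g ** T ** ctrans g) ** (ctrans g' ** ctrans g)"
      by (simp add: E_def matrix_mul_assoc)
    then have gE: "g ** E ** ctrans g = T\<^sub>1 - g ** T ** ctrans g"
      using g' by (simp add: flip: ctrans_mult)
    define X where "X = mat c ** E ** T'"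
    have X_ball: "X \<in> mat_ball (L * r * M)"
      unfolding X_def using matL E_ball T'M L1 r M1 by (intro mat_ball_mult) auto
    have X_s: "X \<in> mat_ball s"
    proof -
      have "L * r * M \<le> L * M * R"
        using r L1 M1 by (simp add: mult_ac mult_left_mono)
      then show ?thesis
        using X_ball R(2) mat_ball_mono[of "L * r * M" s] by auto
    qed
    have XT: "X ** T = mat c ** E"
      using T' by (simp add: X_def flip: matrix_mul_assoc)
    have "T ** ctrans T' = mat 1"
    proof -
      have "ctrans (T' ** T) = mat 1"
        using T' by simp
      then show ?thesis
        using T(1) by (simp add: ctrans_mult herm_iff_ctrans)
    qed
    then have TX: "T ** ctrans X = E ** mat (\<sigma> c)"
      by (simp add: X_def ctrans_mult E_herm matrix_mul_assoc)
    have lin: "X ** T + T ** ctrans X = E"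
    proof -
      have "(mat c ** E + E ** mat (\<sigma> c)) $ i $ j = E $ i $ j" for i j
      proof -
        have "(mat c ** E + E ** mat (\<sigma> c)) $ i $ j = (c + \<sigma> c) * E $ i $ j"
          by (simp add: mat_mult_component algebra_simps)
        then show ?thesis
          by (simp add: c)
      qed
      then show ?thesis
        by (simp add: XT TX vec_eq_iff)
    qed
    have quad: "X ** T ** ctrans X \<in> mat_ball (r / 2)"
    proof -
      \<comment> \<open>\<open>X ** T\<close> has been rewritten as \<open>mat c ** E\<close>, which
        keeps the size of \<open>T\<close> itself out of the estimate.\<close>
      have "mat c ** E ** ctrans X \<in> mat_ball (L * r * (L * r * M))"
        using matL E_ball X_ball L1 r M1 by (intro mat_ball_mult) auto
      moreover have "L * r * (L * r * M) \<le> r / 2"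
      proof -
        have "L * L * M * r \<le> 1 / 2"
        proof -
          have "L * L * M * r \<le> L * L * M * R"
            using r L1 M1 by (intro mult_left_mono) auto
          then show ?thesis
            using R(3) by linarith
        qed
        then have "r * (L * L * M * r) \<le> r * (1 / 2)"
          using r by (intro mult_left_mono) auto
        then show ?thesis
          by (simp add: mult_ac)
      qed
      ultimately show ?thesis
        unfolding XT by (rule subsetD[OF mat_ball_mono, rotated])
    qed
    define g2 where "g2 = g ** (mat 1 + X)"
    have "mat 1 + X \<in> one_ball s"
      using X_s by (simp add: one_ball_def)
    then have "g2 \<in> one_ball s"
      unfolding g2_def using g s by (intro one_ball_mult) auto
    moreover have "T\<^sub>1 - g2 ** T ** ctrans g2 = - (g ** (X ** T ** ctrans X) ** ctrans g)"
    proof -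
      have "(mat 1 + X) ** T ** ctrans (mat 1 + X) = T + (X ** T + T ** ctrans X) + X ** T ** ctrans X"
        by (simp add: ctrans_add matrix_add_ldistrib matrix_add_left)
      then have "(mat 1 + X) ** T ** ctrans (mat 1 + X) = T + E + X ** T ** ctrans X"
        by (simp add: lin)
      then have "g ** ((mat 1 + X) ** T ** ctrans (mat 1 + X)) ** ctrans g
          = g ** T ** ctrans g + g ** E ** ctrans g + g ** (X ** T ** ctrans X) ** ctrans g"
        by (simp add: matrix_add_ldistrib matrix_add_left)
      moreover have "g2 ** T ** ctrans g2 = g ** ((mat 1 + X) ** T ** ctrans (mat 1 + X)) ** ctrans g"
        by (simp add: g2_def ctrans_mult matrix_mul_assoc)
      ultimately show ?thesis
        by (simp add: gE)
    qed
    moreover have "g ** (X ** T ** ctrans X) ** ctrans g \<in> mat_ball (r / 2)"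
      using g1 quad r by (simp add: mat_ball_congruence)
    ultimately show ?case
      by (intro bexI[of _ g2]) (auto simp: mat_ball_def r_def mult.commute)
  qed
  have "\<exists>g\<in>one_ball s. T\<^sub>1 - g ** T ** ctrans g \<in> mat_ball \<epsilon>"
    if "T\<^sub>1 \<in> herm \<sigma>" "T\<^sub>1 - T \<in> mat_ball R" "0 < \<epsilon>" for T\<^sub>1 \<epsilon>
  proof -
    have "0 < \<epsilon> / R"
      using that(3) R(1) by simp
    then obtain n where "(1 / 2) ^ n < \<epsilon> / R"
      using real_arch_pow_inv[of "\<epsilon> / R" "1 / 2"] by auto
    then have "R / 2 ^ n \<le> \<epsilon>"
      using R(1) by (simp add: power_divide field_simps)
    then show ?thesis
      using step[OF that(1,2), of n] mat_ball_mono by blast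
  qed
  with that R(1) show ?thesis
    by blast
qed

end

subsection \<open>The action of matrices on tuples of vectors\<close>

text \<open>Algebraic laws alone are collected here, to be applied for every \<open>r\<close> on the
  type of pairs with a sequence. On that type \<open>ext_form\<close> ignores all coordinates from
  \<open>2 * r\<close> on, so it is degenerate there.\<close>

locale sesquilinear_form =
  separable_quadratic_extension \<iota> \<sigma> + W_space: vector_space scale
  for \<iota> :: "'f::nonarch_local_field \<Rightarrow> 'e::nonarch_local_field" and \<sigma> :: "'e \<Rightarrow> 'e"
    and scale :: "'e \<Rightarrow> 'w::ab_group_add \<Rightarrow> 'w" +
  fixes h :: "'w \<Rightarrow> 'w \<Rightarrow> 'e"
  assumes add_left: "h (x + y) z = h x z + h y z"
    and scale_left: "h (scale a x) y = a * h x y"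
    and hermitian: "h y x = \<sigma> (h x y)"
begin

lemma add_right: "h z (x + y) = h z x + h z y"
  by (simp add: hermitian[of z] add_left conj_add)

lemma scale_right: "h y (scale a x) = \<sigma> a * h y x"
  by (simp add: hermitian[of y] scale_left conj_mult)

lemma zero_left [simp]: "h 0 y = 0"
  using scale_left[of 0 0 y] by simp

lemma zero_right [simp]: "h y 0 = 0"
  using scale_right[of y 0 0] by simp

lemma sum_left: "h (sum f A) y = (\<Sum>i\<in>A. h (f i) y)"
  by (induction A rule: infinite_finite_induct) (auto simp: add_left)

lemma sum_right: "h y (sum f A) = (\<Sum>i\<in>A. h y (f i))"
  by (induction A rule: infinite_finite_induct) (auto simp: add_right)

lemma moment_matrix_in_herm: "moment_matrix h x \<in> herm \<sigma>"
  unfolding herm_def moment_matrix_def mem_Collect_eq vec_lambda_beta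
  by (intro allI) (rule hermitian)

definition act :: "'e ^ 'd ^ 'd \<Rightarrow> 'w ^ 'd \<Rightarrow> 'w ^ 'd" where
  "act g x = (\<chi> i. \<Sum>j\<in>UNIV. scale (g $ i $ j) (x $ j))"

lemma act_diff: "act g (x - y) = act g x - act g y"
  by (simp add: act_def vec_eq_iff W_space.scale_right_diff_distrib sum_subtractf)

lemma act_mat_1: "act (mat 1) (x :: 'w ^ 'd::finite) = x"
proof -
  have "scale ((mat 1 :: 'e ^ 'd ^ 'd) $ i $ j) (x $ j) = (if j = i then x $ j else 0)" for i j
    by (simp add: mat_def)
  then show ?thesis
    by (simp add: act_def vec_eq_iff)
qed

lemma act_act: "act g (act g' (x :: 'w ^ 'd::finite)) = act (g ** g') x"
proof -
  have "(\<Sum>j\<in>UNIV. scale (g $ i $ j) (\<Sum>k\<in>UNIV. scale (g' $ j $ k) (x $ k)))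
      = (\<Sum>k\<in>UNIV. scale (\<Sum>j\<in>UNIV. g $ i $ j * g' $ j $ k) (x $ k))" for i
    unfolding W_space.scale_sum_right W_space.scale_sum_left W_space.scale_scale
    by (rule sum.swap)
  then show ?thesis
    by (simp add: act_def matrix_matrix_mult_def vec_eq_iff)
qed

lemma moment_matrix_act:
  "moment_matrix h (act g (x :: 'w ^ 'd::finite)) = g ** moment_matrix h x ** ctrans g"
proof -
  have "h (\<Sum>k\<in>UNIV. scale (g $ i $ k) (x $ k)) (\<Sum>l\<in>UNIV. scale (g $ j $ l) (x $ l))
      = (\<Sum>l\<in>UNIV. (\<Sum>k\<in>UNIV. g $ i $ k * h (x $ k) (x $ l)) * \<sigma> (g $ j $ l))" for i j
    by (simp only: sum_right scale_right sum_left scale_left mult.commute[of "\<sigma> _"])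
  then show ?thesis
    by (simp add: moment_matrix_def act_def matrix_matrix_mult_def vec_eq_iff)
qed

text \<open>\<open>act g\<close> maps the solutions for \<open>T\<close> onto those for
  \<open>T\<^sub>1\<close>, with inverse \<open>act g'\<close>, and matches classes of
  \<open>K\<close> in both directions. Congruence of the targets up to \<open>\<epsilon>\<close> is
  enough, because solutions are counted up to \<open>\<epsilon>\<close>.\<close>

lemma coset_index_congruent:
  fixes T T\<^sub>1 :: "'e ^ 'd::finite ^ 'd"
  assumes K: "add_subgroup K" and s: "s < 1"
    and stable: "\<And>g x. g \<in> one_ball s \<Longrightarrow> x \<in> C \<Longrightarrow> act g x \<in> C"
      "\<And>g x. g \<in> one_ball s \<Longrightarrow> x \<in> K \<Longrightarrow> act g x \<in> K"
    and g: "g \<in> one_ball s" "T\<^sub>1 - g ** T ** ctrans g \<in> mat_ball \<epsilon>" and \<epsilon>: "0 \<le> \<epsilon>"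
  shows "coset_index K {x \<in> C. moment_matrix h x - T\<^sub>1 \<in> mat_ball \<epsilon>}
       = coset_index K {x \<in> C. moment_matrix h x - T \<in> mat_ball \<epsilon>}" (is "coset_index K ?X1 = coset_index K ?X")
proof -
  obtain g' where g': "g ** g' = mat 1" "g' ** g = mat 1" "g' \<in> one_ball s"
    using one_ball_inverse[OF g(1) s] by blast
  have g1: "g \<in> mat_ball 1" "g' \<in> mat_ball 1"
    using g g' s one_ball_subset[of s] by auto
  note diff = add_subgroup_diff[OF add_subgroup_mat_ball[OF \<epsilon>]]
  note add = add_subgroup_add[OF add_subgroup_mat_ball[OF \<epsilon>]]
  have "act g ` ?X = ?X1"
  proof
    show "act g ` ?X \<subseteq> ?X1"
    proof safe
      fix x assume x: "x \<in> C" "moment_matrix h x - T \<in> mat_ball \<epsilon>"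
      then show "act g x \<in> C"
        using stable g by blast
      have "g ** (moment_matrix h x - T) ** ctrans g \<in> mat_ball \<epsilon>"
        using g1 x \<epsilon> by (simp add: mat_ball_congruence)
      from diff[OF this g(2)] show "moment_matrix h (act g x) - T\<^sub>1 \<in> mat_ball \<epsilon>"
        by (simp add: moment_matrix_act matrix_diff_left matrix_diff_right)
    qed
    show "?X1 \<subseteq> act g ` ?X"
    proof safe
      fix y assume y: "y \<in> C" "moment_matrix h y - T\<^sub>1 \<in> mat_ball \<epsilon>"
      have "y = act g (act g' y)"
        by (simp add: act_act g' act_mat_1)
      moreover have "act g' y \<in> C"
        using stable g' y by blast
      moreover have "moment_matrix h (act g' y) - T \<in> mat_ball \<epsilon>"
      proof -
        have "ctrans g ** ctrans g' = mat 1"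
          using g'(2) by (simp flip: ctrans_mult)
        then have "g' ** (g ** T ** ctrans g) ** ctrans g' = T"
          using g'(2) by (metis matrix_mul_assoc matrix_mul_lid matrix_mul_rid)
        then have "moment_matrix h (act g' y) - T
            = g' ** ((moment_matrix h y - T\<^sub>1) + (T\<^sub>1 - g ** T ** ctrans g)) ** ctrans g'"
          by (simp add: moment_matrix_act matrix_diff_left matrix_diff_right)
        also have "\<dots> \<in> mat_ball \<epsilon>"
          using g1 add[OF y(2) g(2)] \<epsilon> by (simp add: mat_ball_congruence)
        finally show ?thesis .
      qed
      ultimately show "y \<in> act g ` ?X"
        by blast
    qed
  qed
  moreover have "act g x - act g y \<in> K \<longleftrightarrow> x - y \<in> K" for x y
  proof
    assume "act g x - act g y \<in> K"
    then have "act g' (act g (x - y)) \<in> K"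
      using stable(2) g'(3) unfolding act_diff[of g, symmetric] by blast
    then show "x - y \<in> K"
      by (simp add: act_act g' act_mat_1)
  next
    assume "x - y \<in> K"
    then show "act g x - act g y \<in> K"
      using stable(2) g(1) by (metis act_diff)
  qed
  ultimately show ?thesis
    using coset_index_image[OF K K, of ?X "act g"] by simp
qed

end

subsection \<open>Finite quotients of lattices\<close>

text \<open>The system is triangular: the coefficient of a minimal member \<open>M0\<close> occurs
  only in the equation for \<open>M0\<close>, so it can be chosen last. No values of a Moebius
  function have to be computed.\<close>

lemma moebius_expansion:
  fixes \<phi> :: "'a set \<Rightarrow> real"
  assumes "finite \<L>"
  shows "\<exists>c. \<forall>M\<in>\<L>. \<phi> M = (\<Sum>N\<in>{N\<in>\<L>. M \<subseteq> N}. c N)"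
  using assms
proof (induction "card \<L>" arbitrary: \<L>)
  case 0
  then show ?case
    by simp
next
  case (Suc n)
  then have "\<L> \<noteq> {}"
    by auto
  then obtain M0 where M0: "M0 \<in> \<L>" "\<forall>M\<in>\<L>. M \<subseteq> M0 \<longrightarrow> M0 = M"
    using finite_has_minimal[OF Suc.prems] by blast
  have "card (\<L> - {M0}) = n"
    using Suc.hyps(2) M0(1) Suc.prems by simp
  then obtain c where c: "\<forall>M\<in>\<L> - {M0}. \<phi> M = (\<Sum>N\<in>{N\<in>\<L> - {M0}. M \<subseteq> N}. c N)"
    using Suc.hyps(1)[of "\<L> - {M0}"] Suc.prems by auto
  define c' where "c' = c(M0 := \<phi> M0 - (\<Sum>N\<in>{N\<in>\<L> - {M0}. M0 \<subseteq> N}. c N))"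
  have c'_eq: "(\<Sum>N\<in>{N\<in>\<L> - {M0}. M \<subseteq> N}. c' N) = (\<Sum>N\<in>{N\<in>\<L> - {M0}. M \<subseteq> N}. c N)" for M
    by (intro sum.cong) (auto simp: c'_def)
  have "\<phi> M = (\<Sum>N\<in>{N\<in>\<L>. M \<subseteq> N}. c' N)" if M: "M \<in> \<L>" for M
  proof (cases "M = M0")
    case True
    then have "{N\<in>\<L>. M \<subseteq> N} = insert M0 {N\<in>\<L> - {M0}. M0 \<subseteq> N}"
      using M0(1) by auto
    then show ?thesis
      using Suc.prems True c'_eq[of M0] by (simp add: c'_def)
  next
    case False
    then have "{N\<in>\<L>. M \<subseteq> N} = {N\<in>\<L> - {M0}. M \<subseteq> N}"
      using M0(2) M by blast
    then show ?thesis
      using c M False c'_eq[of M] by simp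
  qed
  then show ?case
    by blast
qed

definition vec_ball :: "real \<Rightarrow> ('a::nonarch_local_field ^ 'n) set" where
  "vec_ball r = {x. \<forall>i. absval (x $ i) \<le> r}"

lemma add_subgroup_vec_ball: "0 \<le> r \<Longrightarrow> add_subgroup (vec_ball r)"
  by (auto simp: add_subgroup_def vec_ball_def intro: absval_diff_le)

lemma vec_ball_scale: "absval a \<le> 1 \<Longrightarrow> x \<in> vec_ball r \<Longrightarrow> a *s x \<in> vec_ball r"
  by (auto simp: vec_ball_def intro: absval_mult_le_left)

text \<open>Submodules of the finite module \<open>vec_ball 1\<close> modulo
  \<open>vec_ball \<epsilon>\<close>, represented by their preimages.\<close>

definition int_submodule :: "real \<Rightarrow> ('a::nonarch_local_field ^ 'n) set \<Rightarrow> bool" where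
  "int_submodule \<epsilon> N \<longleftrightarrow> add_subgroup N \<and> vec_ball \<epsilon> \<subseteq> N \<and> N \<subseteq> vec_ball 1 \<and>
     (\<forall>a x. absval a \<le> 1 \<longrightarrow> x \<in> N \<longrightarrow> a *s x \<in> N)"

text \<open>The preimage of the span of the first \<open>r\<close> vectors in the quotient by
  \<open>vec_ball \<epsilon>\<close>. Integrality of \<open>c\<close> is asked at all indices, so
  witnesses have to be extended beyond \<open>r\<close>, for instance by 0.\<close>

definition int_span ::
    "real \<Rightarrow> nat \<Rightarrow> (nat \<Rightarrow> 'a::nonarch_local_field ^ 'n) \<Rightarrow> ('a ^ 'n) set" where
  "int_span \<epsilon> r A = {x. \<exists>c. (\<forall>k. absval (c k) \<le> 1) \<and> x - (\<Sum>k<r. c k *s A k) \<in> vec_ball \<epsilon>}"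

lemma int_submoduleD:
  assumes "int_submodule \<epsilon> N"
  shows "add_subgroup N" "vec_ball \<epsilon> \<subseteq> N" "N \<subseteq> vec_ball 1"
    "\<And>a x. absval a \<le> 1 \<Longrightarrow> x \<in> N \<Longrightarrow> a *s x \<in> N"
  using assms by (auto simp: int_submodule_def)

lemma add_subgroup_sum:
  assumes "add_subgroup K" "\<And>i. i \<in> A \<Longrightarrow> f i \<in> K"
  shows "sum f A \<in> K"
  using assms(2)
  by (induction A rule: infinite_finite_induct)
     (auto simp: add_subgroup_0[OF assms(1)] add_subgroup_add[OF assms(1)])

lemma int_submodule_int_span:
  assumes A: "\<And>k. k < r \<Longrightarrow> A k \<in> vec_ball 1" and \<epsilon>: "0 \<le> \<epsilon>" "\<epsilon> \<le> 1"
  shows "int_submodule \<epsilon> (int_span \<epsilon> r A)"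
proof -
  note sg = add_subgroup_vec_ball[OF \<epsilon>(1)]
  note sg1 = add_subgroup_vec_ball[OF zero_le_one]
  show ?thesis
    unfolding int_submodule_def
  proof (intro conjI allI impI)
    show "add_subgroup (int_span \<epsilon> r A)"
      unfolding add_subgroup_def
    proof (intro conjI ballI)
      show "0 \<in> int_span \<epsilon> r A"
        unfolding int_span_def
        using add_subgroup_0[OF sg] by (auto intro!: exI[of _ "\<lambda>_. 0"])
      fix x y assume "x \<in> int_span \<epsilon> r A" "y \<in> int_span \<epsilon> r A"
      then obtain c d where c: "\<forall>k. absval (c k) \<le> 1" "x - (\<Sum>k<r. c k *s A k) \<in> vec_ball \<epsilon>"
          and d: "\<forall>k. absval (d k) \<le> 1" "y - (\<Sum>k<r. d k *s A k) \<in> vec_ball \<epsilon>"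
        unfolding int_span_def by blast
      have eq: "(x - y) - (\<Sum>k<r. (c k - d k) *s A k)
          = (x - (\<Sum>k<r. c k *s A k)) - (y - (\<Sum>k<r. d k *s A k))"
        by (simp add: vector_ssub_ldistrib vec.scale_left_diff_distrib sum_subtractf)
      have "(x - y) - (\<Sum>k<r. (c k - d k) *s A k) \<in> vec_ball \<epsilon>"
        unfolding eq by (rule add_subgroup_diff[OF sg c(2) d(2)])
      moreover have "\<forall>k. absval (c k - d k) \<le> 1"
        using c d by (auto intro: absval_diff_le)
      ultimately show "x - y \<in> int_span \<epsilon> r A"
        unfolding int_span_def mem_Collect_eq by (intro exI[of _ "\<lambda>k. c k - d k"] conjI)
    qed
    show "vec_ball \<epsilon> \<subseteq> int_span \<epsilon> r A"
      unfolding int_span_def by (auto intro!: exI[of _ "\<lambda>_. 0"])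
    show "int_span \<epsilon> r A \<subseteq> vec_ball 1"
    proof
      fix x assume "x \<in> int_span \<epsilon> r A"
      then obtain c where c: "\<forall>k. absval (c k) \<le> 1" "x - (\<Sum>k<r. c k *s A k) \<in> vec_ball \<epsilon>"
        unfolding int_span_def by blast
      have "(\<Sum>k<r. c k *s A k) \<in> vec_ball 1"
        using c A by (intro add_subgroup_sum[OF sg1]) (auto simp: vec_ball_def intro: absval_mult_le_left)
      moreover have "x - (\<Sum>k<r. c k *s A k) \<in> vec_ball 1"
        using c(2) \<epsilon>(2) unfolding vec_ball_def by (auto intro: order_trans)
      ultimately show "x \<in> vec_ball 1"
        using add_subgroup_add[OF sg1] by fastforce
    qed
    fix a :: 'a and x assume a: "absval a \<le> 1" and "x \<in> int_span \<epsilon> r A"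
    then obtain c where c: "\<forall>k. absval (c k) \<le> 1" "x - (\<Sum>k<r. c k *s A k) \<in> vec_ball \<epsilon>"
      unfolding int_span_def by blast
    have "a *s x - (\<Sum>k<r. (a * c k) *s A k) = a *s (x - (\<Sum>k<r. c k *s A k))"
      by (simp add: vec.scale_right_diff_distrib vec.scale_sum_right)
    also have "\<dots> \<in> vec_ball \<epsilon>"
      using c(2) a by (intro vec_ball_scale)
    finally show "a *s x \<in> int_span \<epsilon> r A"
      unfolding int_span_def using a c(1) by (auto intro!: exI[of _ "\<lambda>k. a * c k"] absval_mult_le_left)
  qed
qed

text \<open>Containment of the span splits into one condition per vector, so that the number of
  tuples \<open>A\<close> with span in \<open>N\<close> becomes an \<open>r\<close>-th
  power.\<close>

lemma int_span_subset_iff: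
  assumes N: "int_submodule \<epsilon> N" and \<epsilon>: "0 \<le> \<epsilon>"
  shows "int_span \<epsilon> r A \<subseteq> N \<longleftrightarrow> (\<forall>k<r. A k \<in> N)"
proof safe
  fix k assume *: "int_span \<epsilon> r A \<subseteq> N" and k: "k < r"
  have "(\<Sum>l<r. (if l = k then 1 else 0) *s A l) = A k"
    using k by (simp add: if_distrib[of "\<lambda>a. a *s _"] cong: if_cong)
  then have "A k - (\<Sum>l<r. (if l = k then 1 else 0) *s A l) \<in> vec_ball \<epsilon>"
    using \<epsilon> by (simp add: vec_ball_def)
  then have "A k \<in> int_span \<epsilon> r A"
    unfolding int_span_def by (auto intro!: exI[of _ "\<lambda>l. if l = k then 1 else 0"])
  with * show "A k \<in> N"
    by blast
next
  fix x assume A: "\<forall>k<r. A k \<in> N" and "x \<in> int_span \<epsilon> r A"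
  then obtain c where c: "\<forall>k. absval (c k) \<le> 1" "x - (\<Sum>k<r. c k *s A k) \<in> vec_ball \<epsilon>"
    unfolding int_span_def by blast
  have "(\<Sum>k<r. c k *s A k) \<in> N"
    using c A int_submoduleD[OF N] by (intro add_subgroup_sum) auto
  then show "x \<in> N"
    using add_subgroup_add[OF int_submoduleD(1)[OF N]] int_submoduleD(2)[OF N] c(2) by fastforce
qed

lemma exists_finite_reps_vec_ball:
  assumes "0 < \<epsilon>"
  shows "\<exists>Q :: ('a::nonarch_local_field ^ 'n::finite) set. finite Q \<and> coset_reps (vec_ball \<epsilon>) (vec_ball 1) Q"
proof (rule exists_finite_coset_reps)
  have "vec_ball 1 = {x :: 'a ^ 'n. \<forall>i. x $ i \<in> val_ball 1}"
    by (simp add: vec_ball_def val_ball_def)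
  also have "compact \<dots>"
    by (intro compact_vec compact_val_ball)
  finally show "compact (vec_ball 1 :: ('a ^ 'n) set)" .
  fix x :: "'a ^ 'n"
  have "open {y :: 'a ^ 'n. \<forall>i. y $ i \<in> {z. absval (z - x $ i) \<le> \<epsilon>}}"
    by (intro open_vec_all open_val_cball assms)
  then show "\<exists>O'. open O' \<and> x \<in> O' \<and> (\<forall>y\<in>O' \<inter> vec_ball 1. y - x \<in> vec_ball \<epsilon>)"
    using assms by (intro exI conjI) (assumption, auto simp: vec_ball_def)
qed (use assms in \<open>simp add: add_subgroup_vec_ball\<close>)

context
  fixes \<epsilon> :: real and Q :: "('a::nonarch_local_field ^ 'n::finite) set"
  assumes \<epsilon>: "0 < \<epsilon>" "\<epsilon> \<le> 1" and Q: "finite Q" "coset_reps (vec_ball \<epsilon>) (vec_ball 1) Q"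
begin

text \<open>A single system \<open>Q\<close> serves all submodules at once, because each of them is
  a union of classes of \<open>vec_ball \<epsilon>\<close>.\<close>

lemma int_submodule_reps:
  assumes "int_submodule \<epsilon> N"
  shows "coset_reps (vec_ball \<epsilon>) N (Q \<inter> N)"
proof (rule coset_reps_Int[OF add_subgroup_vec_ball Q(2)])
  show "coset_stable (vec_ball \<epsilon>) N"
    using int_submoduleD(2)[OF assms] add_subgroup_add[OF int_submoduleD(1)[OF assms]]
    by (auto simp: coset_stable_def)
qed (use \<epsilon> int_submoduleD[OF assms] in auto)

text \<open>\<open>Q \<inter> N\<close> determines \<open>N\<close>, since \<open>N\<close> is the
  union of the classes of its points; and \<open>Q\<close> has finitely many subsets.\<close>

lemma finite_int_submodules: "finite {N :: ('a ^ 'n) set. int_submodule \<epsilon> N}"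
proof (rule finite_imageD)
  show "finite ((\<lambda>N. Q \<inter> N) ` {N. int_submodule \<epsilon> N})"
    by (rule finite_subset[of _ "Pow Q"]) (use Q in auto)
  have sub: "N \<subseteq> M" if NM: "int_submodule \<epsilon> N" "int_submodule \<epsilon> M" "Q \<inter> N = Q \<inter> M" for M N
  proof
    fix x assume "x \<in> N"
    then obtain y where y: "y \<in> Q \<inter> M" "x - y \<in> vec_ball \<epsilon>"
      using coset_repsD(2)[OF int_submodule_reps[OF NM(1)]] NM(3) by blast
    then have "(x - y) + y \<in> M"
      using int_submoduleD[OF NM(2)] add_subgroup_add by blast
    then show "x \<in> M"
      by simp
  qed
  show "inj_on (\<lambda>N. Q \<inter> N) {N. int_submodule \<epsilon> N}"
    using sub by (intro inj_onI subset_antisym) auto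
qed

text \<open>
  A vector \<open>x \<notin> N\<close> for which \<open>N + \<O> x\<close> is smallest is annihilated by the maximal ideal
  modulo \<open>N\<close> (Nakayama's lemma).
\<close>

lemma int_submodule_extend:
  assumes N: "int_submodule \<epsilon> N" "N \<noteq> vec_ball 1"
  obtains M where "int_submodule \<epsilon> M"
    "card (Q \<inter> M) = residue_card TYPE('a) * card (Q \<inter> N)" "card (Q \<inter> N) < card (Q \<inter> M)"
proof -
  define E where "E x = {y. \<exists>a. absval a \<le> 1 \<and> y - a *s x \<in> N}" for x
  note D = int_submoduleD[OF N(1)]
  have E_sub: "int_submodule \<epsilon> (E x)" if x: "x \<in> vec_ball 1" for x
    unfolding int_submodule_def
  proof (intro conjI allI impI)
    show "add_subgroup (E x)"
      unfolding add_subgroup_def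
    proof (intro conjI ballI)
      show "0 \<in> E x"
        using add_subgroup_0[OF D(1)] by (auto simp: E_def intro!: exI[of _ 0])
      fix y z assume "y \<in> E x" "z \<in> E x"
      then obtain a b where ab: "absval a \<le> 1" "y - a *s x \<in> N" "absval b \<le> 1" "z - b *s x \<in> N"
        by (auto simp: E_def)
      have eq: "(y - z) - (a - b) *s x = (y - a *s x) - (z - b *s x)"
        by (simp add: vec.scale_left_diff_distrib)
      have "(y - z) - (a - b) *s x \<in> N"
        unfolding eq by (rule add_subgroup_diff[OF D(1) ab(2,4)])
      moreover have "absval (a - b) \<le> 1"
        using ab by (intro absval_diff_le)
      ultimately show "y - z \<in> E x"
        by (auto simp: E_def)
    qed
    show "vec_ball \<epsilon> \<subseteq> E x"
      using D(2) by (auto simp: E_def intro!: exI[of _ 0])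
    show "E x \<subseteq> vec_ball 1"
    proof
      fix y assume "y \<in> E x"
      then obtain a where a: "absval a \<le> 1" "y - a *s x \<in> N"
        by (auto simp: E_def)
      then have "y - a *s x \<in> vec_ball 1"
        using D(3) by blast
      moreover have "a *s x \<in> vec_ball 1"
        using a x by (auto simp: vec_ball_def intro: absval_mult_le_left)
      ultimately show "y \<in> vec_ball 1"
        using add_subgroup_add[OF add_subgroup_vec_ball[OF zero_le_one]] by fastforce
    qed
    fix b :: 'a and y assume b: "absval b \<le> 1" and "y \<in> E x"
    then obtain a where a: "absval a \<le> 1" "y - a *s x \<in> N"
      by (auto simp: E_def)
    have "b *s y - (b * a) *s x = b *s (y - a *s x)"
      by (simp add: vec.scale_right_diff_distrib)
    then have "b *s y - (b * a) *s x \<in> N"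
      using D(4)[OF b a(2)] by simp
    then show "b *s y \<in> E x"
      using absval_mult_le_left[OF b a(1)] by (auto simp: E_def)
  qed
  have E_self: "x \<in> E x" for x
    using add_subgroup_0[OF D(1)] by (auto simp: E_def intro!: exI[of _ 1])
  have N_E: "N \<subseteq> E x" for x
    by (auto simp: E_def intro!: exI[of _ 0])
  obtain x0 where "x0 \<in> vec_ball 1" "x0 \<notin> N"
    using N(2) D(3) by blast
  then obtain x where x: "x \<in> vec_ball 1" "x \<notin> N"
      and min: "\<And>y. y \<in> vec_ball 1 \<Longrightarrow> y \<notin> N \<Longrightarrow> card (Q \<inter> E x) \<le> card (Q \<inter> E y)"
    using ex_has_least_nat[of "\<lambda>x. x \<in> vec_ball 1 \<and> x \<notin> N" x0 "\<lambda>x. card (Q \<inter> E x)"] by blast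
  have unit: "x \<in> N" if "absval a = 1" "a *s x \<in> N" for a
  proof -
    have "(1 / a) *s (a *s x) \<in> N"
      using D(4)[of "1 / a" "a *s x"] that by (simp only: absval_divide absval_1)
    moreover have "a \<noteq> 0"
      using that(1) by auto
    ultimately show ?thesis
      by (simp add: vec.scale_scale)
  qed
  have ann: "a *s x \<in> N" if a: "absval a < 1" for a
  proof (rule ccontr)
    assume not: "a *s x \<notin> N"
    have ax: "a *s x \<in> vec_ball 1"
      using a x by (auto simp: vec_ball_def intro: absval_mult_le_left)
    have sub: "E (a *s x) \<subseteq> E x"
    proof
      fix y assume "y \<in> E (a *s x)"
      then obtain b where "absval b \<le> 1" "y - b *s (a *s x) \<in> N"
        by (auto simp: E_def)
      then show "y \<in> E x"
        using a absval_mult_le_left[of b a 1] by (auto simp: E_def vec.scale_scale intro!: exI[of _ "b * a"])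
    qed
    \<comment> \<open>By minimality \<open>x\<close> lies in \<open>E (a *s x)\<close> up to
      \<open>vec_ball \<epsilon>\<close>. So \<open>(1 - b * a) *s x\<close> lies in
      \<open>N\<close> for some integral \<open>b\<close>, and \<open>1 - b * a\<close> is a
      unit.\<close>
    have "Q \<inter> E (a *s x) = Q \<inter> E x"
      using sub min[OF ax not] Q(1) by (intro card_seteq) auto
    moreover obtain y where y: "y \<in> Q \<inter> E x" "x - y \<in> vec_ball \<epsilon>"
      using coset_repsD(2)[OF int_submodule_reps[OF E_sub[OF x(1)]] E_self] by blast
    ultimately obtain b where b: "absval b \<le> 1" "y - b *s (a *s x) \<in> N"
      by (auto simp: E_def)
    have "(x - y) + (y - b *s (a *s x)) \<in> N"
      using b(2) y(2) D(2) by (intro add_subgroup_add[OF D(1)]) auto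
    then have "(1 - b * a) *s x \<in> N"
      by (simp add: vec.scale_left_diff_distrib vec.scale_scale)
    moreover have "absval (1 - b * a) = 1"
    proof -
      have "absval (- (b * a)) < absval (1 :: 'a)"
        using b a mult_right_mono[of "absval b" 1 "absval a"] by (simp add: absval_mult)
      from absval_add_eq[OF this] show ?thesis
        by simp
    qed
    ultimately show False
      using unit x(2) by blast
  qed
  obtain S :: "'a set" where S: "finite S" "coset_reps valuation_ideal valuation_ring S"
    using exists_finite_reps_residue by blast
  have S1: "absval s \<le> 1" if "s \<in> S" for s
    using coset_repsD(1)[OF S(2)] that by (auto simp: valuation_ring_def)
  have red: "\<exists>z\<in>Q. y - z \<in> vec_ball \<epsilon>" if "y \<in> vec_ball 1" for y
    using coset_repsD(2)[OF Q(2) that] by blast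
  \<comment> \<open>\<open>f\<close> sends \<open>(s, y)\<close> to \<open>y + s *s x\<close>,
    reduced to \<open>Q\<close>. As the maximal ideal maps \<open>x\<close> into \<open>N\<close>,
    the quotient of \<open>E x\<close> by \<open>N\<close> is a line over the residue field, which
    makes \<open>f\<close> a bijection.\<close>
  define f where "f = (\<lambda>(s, y). SOME z. z \<in> Q \<and> (y + s *s x) - z \<in> vec_ball \<epsilon>)"
  have f: "f (s, y) \<in> Q" "(y + s *s x) - f (s, y) \<in> vec_ball \<epsilon>" if sy: "s \<in> S" "y \<in> Q \<inter> N" for s y
  proof -
    have "y + s *s x \<in> vec_ball 1"
      using sy S1[OF sy(1)] x D(3) by (intro add_subgroup_add[OF add_subgroup_vec_ball])
        (auto simp: vec_ball_def intro: absval_mult_le_left)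
    from red[OF this] have "\<exists>z. z \<in> Q \<and> (y + s *s x) - z \<in> vec_ball \<epsilon>"
      by blast
    from someI_ex[OF this] show "f (s, y) \<in> Q" "(y + s *s x) - f (s, y) \<in> vec_ball \<epsilon>"
      by (simp_all add: f_def)
  qed
  note sg = add_subgroup_vec_ball[OF less_imp_le[OF \<epsilon>(1)]]
  have "bij_betw f (S \<times> (Q \<inter> N)) (Q \<inter> E x)"
    unfolding bij_betw_def
  proof
    show "inj_on f (S \<times> (Q \<inter> N))"
    proof (rule inj_onI, clarify)
      fix s y s' y' assume *: "s \<in> S" "y \<in> Q" "y \<in> N" "s' \<in> S" "y' \<in> Q" "y' \<in> N"
        and eq: "f (s, y) = f (s', y')"
      have "((y + s *s x) - f (s, y)) - ((y' + s' *s x) - f (s', y')) \<in> vec_ball \<epsilon>"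
        using * by (intro add_subgroup_diff[OF sg f(2) f(2)]) auto
      moreover have "((y + s *s x) - f (s, y)) - ((y' + s' *s x) - f (s', y')) = (y - y') + (s - s') *s x"
        by (simp add: eq vec.scale_left_diff_distrib)
      ultimately have d: "(y - y') + (s - s') *s x \<in> vec_ball \<epsilon>"
        by simp
      then have "((y - y') + (s - s') *s x) - (y - y') \<in> N"
        using D(2) * by (intro add_subgroup_diff[OF D(1)]) (auto intro: add_subgroup_diff[OF D(1)])
      then have sx: "(s - s') *s x \<in> N"
        by simp
      have "absval (s - s') \<le> 1"
        using S1 * by (intro absval_diff_le) auto
      then have "absval (s - s') < 1"
        using unit[OF _ sx] x(2) by fastforce
      then have ss: "s = s'"
        using coset_reps_unique[OF add_subgroup_valuation_ideal S(2) *(1,4)]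
        by (simp add: valuation_ideal_def)
      then have "y = y'"
        using coset_reps_unique[OF sg Q(2) *(2,5)] d by simp
      with ss show "s = s' \<and> y = y'"
        by simp
    qed
    show "f ` (S \<times> (Q \<inter> N)) = Q \<inter> E x"
    proof
      show "f ` (S \<times> (Q \<inter> N)) \<subseteq> Q \<inter> E x"
      proof clarify
        fix s y assume *: "s \<in> S" "y \<in> Q" "y \<in> N"
        have "y - ((y + s *s x) - f (s, y)) \<in> N"
          using * by (intro add_subgroup_diff[OF D(1) _ subsetD[OF D(2) f(2)]]) auto
        then have "f (s, y) - s *s x \<in> N"
          by simp
        then show "f (s, y) \<in> Q \<inter> E x"
          using f[of s y] * S1 by (auto simp: E_def)
      qed
      show "Q \<inter> E x \<subseteq> f ` (S \<times> (Q \<inter> N))"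
      proof
        fix z assume z: "z \<in> Q \<inter> E x"
        then obtain a where a: "absval a \<le> 1" "z - a *s x \<in> N"
          by (auto simp: E_def)
        obtain s where s: "s \<in> S" "absval (a - s) < 1"
          using coset_repsD(2)[OF S(2), of a] a(1) by (auto simp: valuation_ring_def valuation_ideal_def)
        have "(z - a *s x) + (a - s) *s x \<in> N"
          using a(2) ann[OF s(2)] by (rule add_subgroup_add[OF D(1)])
        then have zs: "z - s *s x \<in> N"
          by (simp add: vec.scale_left_diff_distrib)
        then obtain y where y: "y \<in> Q \<inter> N" "(z - s *s x) - y \<in> vec_ball \<epsilon>"
          using coset_repsD(2)[OF int_submodule_reps[OF N(1)]] by blast
        have "((z - s *s x) - y) + ((y + s *s x) - f (s, y)) \<in> vec_ball \<epsilon>"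
          using y f s by (intro add_subgroup_add[OF sg]) auto
        then have "z - f (s, y) \<in> vec_ball \<epsilon>"
          by simp
        then have "z = f (s, y)"
          using coset_reps_unique[OF sg Q(2)] z f s y by blast
        then show "z \<in> f ` (S \<times> (Q \<inter> N))"
          using s y by blast
      qed
    qed
  qed
  then have "card (Q \<inter> E x) = card S * card (Q \<inter> N)"
    using bij_betw_same_card by (fastforce simp: card_cartesian_product)
  moreover have "card (Q \<inter> N) < card (Q \<inter> E x)"
  proof (rule psubset_card_mono)
    show "finite (Q \<inter> E x)"
      using Q by simp
    have "Q \<inter> N \<noteq> Q \<inter> E x"
    proof
      assume eq: "Q \<inter> N = Q \<inter> E x"
      obtain y where y: "y \<in> Q \<inter> E x" "x - y \<in> vec_ball \<epsilon>"
        using coset_repsD(2)[OF int_submodule_reps[OF E_sub[OF x(1)]] E_self] by blast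
      then have "(x - y) + y \<in> N"
        using eq D(2) by (intro add_subgroup_add[OF D(1)]) auto
      then show False
        using x by simp
    qed
    then show "Q \<inter> N \<subset> Q \<inter> E x"
      using N_E by blast
  qed
  ultimately show ?thesis
    using that E_sub[OF x(1)] residue_card_eq_card[OF S(2)] by simp
qed

text \<open>Extensions of index \<open>residue_card\<close> lead from \<open>N\<close> up to
  \<open>vec_ball 1\<close>; the chain ends because the number of classes grows strictly and is at
  most \<open>card Q\<close>.\<close>

lemma card_int_submodule:
  assumes "int_submodule \<epsilon> N"
  shows "\<exists>k. card Q = residue_card TYPE('a) ^ k * card (Q \<inter> N)"
  using assms
proof (induction "card Q - card (Q \<inter> N)" arbitrary: N rule: less_induct)
  case less
  show ?case
  proof (cases "N = vec_ball 1")
    case True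
    then have "Q \<inter> N = Q"
      using coset_repsD(1)[OF Q(2)] by blast
    then show ?thesis
      by (intro exI[of _ 0]) simp
  next
    case False
    then obtain M where M: "int_submodule \<epsilon> M"
        "card (Q \<inter> M) = residue_card TYPE('a) * card (Q \<inter> N)" "card (Q \<inter> N) < card (Q \<inter> M)"
      using int_submodule_extend[OF less.prems] by blast
    have "card (Q \<inter> M) \<le> card Q"
      using Q by (intro card_mono) auto
    then have "card Q - card (Q \<inter> M) < card Q - card (Q \<inter> N)"
      using M(3) by simp
    then obtain k where "card Q = residue_card TYPE('a) ^ k * card (Q \<inter> M)"
      using less.hyps M(1) by blast
    then show ?thesis
      using M(2) by (intro exI[of _ "Suc k"]) simp
  qed
qed

end

subsection \<open>Counting solutions in the split space\<close>

context separable_quadratic_extension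
begin

text \<open>The contribution of one hyperbolic pair of coordinates to the moment matrix,
  \<open>a\<close> and \<open>b\<close> being the columns of the tuple at the two paired
  positions.\<close>

definition sym_outer :: "'e ^ 'd \<Rightarrow> 'e ^ 'd \<Rightarrow> 'e ^ 'd ^ 'd" where
  "sym_outer a b = (\<chi> i j. a $ i * \<sigma> (b $ j) + b $ i * \<sigma> (a $ j))"

lemma sym_outer_add: "sym_outer a (b + c) = sym_outer a b + sym_outer a c"
  and sym_outer_diff: "sym_outer a (b - c) = sym_outer a b - sym_outer a c"
  by (simp_all add: sym_outer_def vec_eq_iff conj_add conj_diff algebra_simps)

lemma sym_outer_ball:
  assumes "a \<in> vec_ball 1" "b \<in> vec_ball \<epsilon>"
  shows "sym_outer a b \<in> mat_ball \<epsilon>"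
proof -
  have "absval (a $ i * \<sigma> (b $ j)) \<le> \<epsilon>" "absval (b $ i * \<sigma> (a $ j)) \<le> \<epsilon>" for i j
    using assms absval_mult_le_left[of "a $ i" "\<sigma> (b $ j)" \<epsilon>] absval_mult_le_right[of "b $ i" \<epsilon> "\<sigma> (a $ j)"]
    by (auto simp: vec_ball_def)
  then show ?thesis
    by (auto simp: sym_outer_def mat_ball_def intro!: absval_add_le)
qed

text \<open>\<open>X\<close> stands for the product of \<open>A\<close> with the conjugate transpose
  of \<open>B\<close>. Its columns are arbitrary integral combinations of the columns of
  \<open>A\<close>, so the image of the map in \<open>B\<close> is described by their span
  \<open>N\<close>.\<close>

definition sym_image :: "real \<Rightarrow> ('e ^ 'd) set \<Rightarrow> ('e ^ 'd ^ 'd) set" where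
  "sym_image \<epsilon> N = {Y. \<exists>X. (\<forall>j. column j X \<in> N) \<and> Y - (X + ctrans X) \<in> mat_ball \<epsilon>}"

text \<open>
  For \<open>A = (A\<^sub>1, \<dots>, A\<^sub>r)\<close> the map \<open>B \<mapsto> A B\<^sup>* + B A\<^sup>*\<close> has an image that depends on the span of the
  columns of \<open>A\<close> only, and fibres of equal size.
\<close>

lemma card_fibre:
  fixes A :: "nat \<Rightarrow> 'e ^ 'd::finite" and Q :: "('e ^ 'd) set"
  assumes \<epsilon>: "0 < \<epsilon>" "\<epsilon> \<le> 1" and Q: "finite Q" "coset_reps (vec_ball \<epsilon>) (vec_ball 1) Q"
    and A: "\<And>k. k < r \<Longrightarrow> A k \<in> vec_ball 1"
  shows "real (card {B \<in> {..<r} \<rightarrow>\<^sub>E Q. (\<Sum>k<r. sym_outer (A k) (B k)) - S \<in> mat_ball \<epsilon>})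
    = real (card Q ^ r) *
        (if S \<in> sym_image \<epsilon> (int_span \<epsilon> r A)
         then 1 / real (coset_index (mat_ball \<epsilon>) (sym_image \<epsilon> (int_span \<epsilon> r A))) else 0)"
proof -
  let ?\<Omega> = "{..<r} \<rightarrow>\<^sub>E Q" and ?W = "sym_image \<epsilon> (int_span \<epsilon> r A)"
  define L where "L B = (\<Sum>k<r. sym_outer (A k) (B k))" for B
  define F where "F S = {B \<in> ?\<Omega>. L B - S \<in> mat_ball \<epsilon>}" for S
  have \<epsilon>0: "0 \<le> \<epsilon>"
    using \<epsilon> by simp
  note sg = add_subgroup_vec_ball[OF \<epsilon>0]
  note sg1 = add_subgroup_vec_ball[OF zero_le_one]
  note msg = add_subgroup_mat_ball[OF \<epsilon>0]
  have fin\<Omega>: "finite ?\<Omega>"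
    using Q(1) by (intro finite_PiE) auto
  have L_diff: "L (\<lambda>k. B k - B' k) = L B - L B'" and L_add: "L (\<lambda>k. B k + B' k) = L B + L B'" for B B'
    by (simp_all add: L_def sym_outer_diff sym_outer_add sum_subtractf sum.distrib)
  have L_ball: "L B \<in> mat_ball \<epsilon>" if "\<And>k. k < r \<Longrightarrow> B k \<in> vec_ball \<epsilon>" for B
    unfolding L_def using that A by (intro add_subgroup_sum[OF msg] sym_outer_ball) auto
  have red: "\<exists>B'\<in>?\<Omega>. \<forall>k<r. B k - B' k \<in> vec_ball \<epsilon>" if B: "\<And>k. k < r \<Longrightarrow> B k \<in> vec_ball 1" for B
  proof -
    have "\<forall>k. \<exists>y. k < r \<longrightarrow> y \<in> Q \<and> B k - y \<in> vec_ball \<epsilon>"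
      using coset_repsD(2)[OF Q(2)] B by blast
    then obtain f where "\<And>k. k < r \<Longrightarrow> f k \<in> Q \<and> B k - f k \<in> vec_ball \<epsilon>"
      by metis
    then show ?thesis
      by (intro bexI[of _ "restrict f {..<r}"]) auto
  qed
  have QB: "B k \<in> vec_ball 1" if "B \<in> ?\<Omega>" "k < r" for B k
    using that coset_repsD(1)[OF Q(2)] by (auto simp: PiE_iff)
  have F_W: "S \<in> ?W" if "B \<in> F S" for B S
  proof -
    have B: "B \<in> ?\<Omega>" "L B - S \<in> mat_ball \<epsilon>"
      using that by (auto simp: F_def)
    define X where "X = (\<chi> i j. \<Sum>k<r. A k $ i * \<sigma> (B k $ j))"
    have "column j X \<in> int_span \<epsilon> r A" for j
    proof -
      \<comment> \<open>\<open>int_span\<close> wants integral coefficients at every index, but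
        \<open>B k\<close> is an unspecified default from \<open>r\<close> on; hence the
        conditional.\<close>
      have "column j X - (\<Sum>k<r. (if k < r then \<sigma> (B k $ j) else 0) *s A k) = 0"
        by (simp add: X_def column_def vec_eq_iff sum_component mult.commute)
      then have "column j X - (\<Sum>k<r. (if k < r then \<sigma> (B k $ j) else 0) *s A k) \<in> vec_ball \<epsilon>"
        using add_subgroup_0[OF sg] by simp
      moreover have "\<forall>k. absval (if k < r then \<sigma> (B k $ j) else 0) \<le> 1"
        using QB[OF B(1)] by (auto simp: vec_ball_def)
      ultimately show ?thesis
        unfolding int_span_def mem_Collect_eq
        by (intro exI[of _ "\<lambda>k. if k < r then \<sigma> (B k $ j) else 0"] conjI)
    qed
    moreover have "L B = X + ctrans X"
      by (simp add: L_def X_def sym_outer_def vec_eq_iff sum_component conj_sum conj_mult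
          sum.distrib mult.commute)
    ultimately show ?thesis
      using B(2) add_subgroup_diff_commute[OF msg] unfolding sym_image_def by auto
  qed
  have F_ne: "F S \<noteq> {}" if S: "S \<in> ?W" for S
  proof -
    obtain X where X: "\<And>j. column j X \<in> int_span \<epsilon> r A" "S - (X + ctrans X) \<in> mat_ball \<epsilon>"
      using S by (auto simp: sym_image_def)
    have "\<forall>j. \<exists>c. (\<forall>k. absval (c k) \<le> 1) \<and> column j X - (\<Sum>k<r. c k *s A k) \<in> vec_ball \<epsilon>"
      using X(1) by (simp add: int_span_def)
    then obtain c where c: "\<And>j k. absval (c j k) \<le> 1"
        "\<And>j. column j X - (\<Sum>k<r. c j k *s A k) \<in> vec_ball \<epsilon>"
      by metis
    define b where "b k = (\<chi> j. \<sigma> (c j k))" for k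
    have "b k \<in> vec_ball 1" for k
      using c(1) by (simp add: b_def vec_ball_def)
    then obtain B where B: "B \<in> ?\<Omega>" "\<forall>k<r. b k - B k \<in> vec_ball \<epsilon>"
      using red[of b] by blast
    define Y where "Y = (\<chi> i j. \<Sum>k<r. A k $ i * c j k)"
    have "X - Y \<in> mat_ball \<epsilon>"
      using c(2) by (simp add: Y_def vec_ball_def mat_ball_def column_def sum_component mult.commute)
    moreover have Lb: "L b = Y + ctrans Y"
      by (simp add: L_def Y_def b_def sym_outer_def vec_eq_iff sum_component conj_sum conj_mult
          sum.distrib mult.commute)
    ultimately have "(X - Y) + ctrans (X - Y) \<in> mat_ball \<epsilon>"
      by (intro add_subgroup_add[OF msg]) auto
    moreover have "(X - Y) + ctrans (X - Y) = (X + ctrans X) - L b"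
      by (simp add: Lb ctrans_diff)
    ultimately have "(X + ctrans X) - L b \<in> mat_ball \<epsilon>"
      by metis
    then have "L b - (X + ctrans X) \<in> mat_ball \<epsilon>"
      by (rule add_subgroup_diff_commute[OF msg])
    then have "L b - S \<in> mat_ball \<epsilon>"
      using X(2) add_subgroup_diff_trans[OF msg] add_subgroup_diff_commute[OF msg] by blast
    moreover have "L b - L B \<in> mat_ball \<epsilon>"
      using L_ball[of "\<lambda>k. b k - B k"] B(2) by (simp add: L_diff)
    ultimately have "L B - S \<in> mat_ball \<epsilon>"
      using add_subgroup_diff_trans[OF msg] add_subgroup_diff_commute[OF msg] by blast
    then show ?thesis
      using B by (auto simp: F_def)
  qed
  \<comment> \<open>Shifting by \<open>B2 - B1\<close> carries one fibre to the other. The result is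
    integral but need not consist of representatives, so it is reduced by \<open>t\<close>; the
    reduction moves \<open>L\<close> within \<open>mat_ball \<epsilon>\<close> and keeps distinct
    points distinct.\<close>
  have le: "card (F S) \<le> card (F S')" if S: "S \<in> ?W" "S' \<in> ?W" for S S'
  proof -
    obtain B1 B2 where B1: "B1 \<in> F S" and B2: "B2 \<in> F S'"
      using F_ne S by blast
    have "\<exists>B'\<in>?\<Omega>. \<forall>k<r. (B k - B1 k + B2 k) - B' k \<in> vec_ball \<epsilon>" if "B \<in> F S" for B
    proof (rule red)
      fix k assume k: "k < r"
      have "B k \<in> vec_ball 1" "B1 k \<in> vec_ball 1" "B2 k \<in> vec_ball 1"
        using that B1 B2 QB k by (auto simp: F_def)
      then show "B k - B1 k + B2 k \<in> vec_ball 1"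
        using add_subgroup_add[OF sg1] add_subgroup_diff[OF sg1] by blast
    qed
    then obtain t where t: "\<And>B. B \<in> F S \<Longrightarrow> t B \<in> ?\<Omega>"
        "\<And>B k. B \<in> F S \<Longrightarrow> k < r \<Longrightarrow> (B k - B1 k + B2 k) - t B k \<in> vec_ball \<epsilon>"
      by metis
    have "inj_on t (F S)"
    proof (rule inj_onI)
      fix B B' assume B: "B \<in> F S" "B' \<in> F S" "t B = t B'"
      have "B k = B' k" if "k < r" for k
      proof (rule coset_reps_unique[OF sg Q(2)])
        have "((B k - B1 k + B2 k) - t B k) - ((B' k - B1 k + B2 k) - t B' k) \<in> vec_ball \<epsilon>"
          using B that by (intro add_subgroup_diff[OF sg t(2) t(2)])
        then show "B k - B' k \<in> vec_ball \<epsilon>"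
          using B(3) by simp
      qed (use B that in \<open>auto simp: F_def PiE_iff\<close>)
      then show "B = B'"
        using B by (intro PiE_ext[of B "{..<r}" "\<lambda>_. Q"]) (auto simp: F_def)
    qed
    moreover have "t ` F S \<subseteq> F S'"
    proof clarify
      fix B assume B: "B \<in> F S"
      have "L (\<lambda>k. (B k - B1 k + B2 k) - t B k) \<in> mat_ball \<epsilon>"
        using t(2)[OF B] by (intro L_ball)
      then have 1: "L B - L B1 + L B2 - L (t B) \<in> mat_ball \<epsilon>"
        by (simp add: L_diff L_add)
      have 2: "L B - S \<in> mat_ball \<epsilon>" "L B1 - S \<in> mat_ball \<epsilon>" "L B2 - S' \<in> mat_ball \<epsilon>"
        using B B1 B2 by (auto simp: F_def)
      have "L (t B) - S' = (L B - S) - (L B1 - S) + (L B2 - S') - (L B - L B1 + L B2 - L (t B))"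
        by (simp add: algebra_simps)
      also have "\<dots> \<in> mat_ball \<epsilon>"
        by (rule add_subgroup_diff[OF msg add_subgroup_add[OF msg add_subgroup_diff[OF msg 2(1,2)] 2(3)] 1])
      finally show "t B \<in> F S'"
        using t(1)[OF B] by (simp add: F_def)
    qed
    ultimately show ?thesis
      using fin\<Omega> by (intro card_inj_on_le[of t]) (auto simp: F_def)
  qed
  have F_eq: "{B \<in> ?\<Omega>. (\<Sum>k<r. sym_outer (A k) (B k)) - S \<in> mat_ball \<epsilon>} = F S"
    by (simp add: F_def L_def)
  show ?thesis
  proof (cases "S \<in> ?W")
    case False
    then have "F S = {}"
      using F_W by blast
    with False show ?thesis
      unfolding F_eq by simp
  next
    case True
    obtain I where I: "coset_reps (mat_ball \<epsilon>) ?W I"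
        "\<forall>F. finite F \<longrightarrow> (\<forall>x\<in>?W. \<exists>f\<in>F. f \<in> ?W \<and> x - f \<in> mat_ball \<epsilon>) \<longrightarrow> finite I"
      using exists_coset_reps[OF msg] by blast
    have L_W: "L B \<in> ?W" if "B \<in> ?\<Omega>" for B
      using F_W[of B "L B"] that add_subgroup_0[OF msg] by (simp add: F_def)
    \<comment> \<open>The index of \<open>?W\<close> is finite, as every class of \<open>?W\<close>
      contains a value of \<open>L\<close> on the finite set \<open>?\<Omega>\<close>.\<close>
    have "\<forall>x\<in>?W. \<exists>f\<in>L ` ?\<Omega>. f \<in> ?W \<and> x - f \<in> mat_ball \<epsilon>"
      using F_ne L_W add_subgroup_diff_commute[OF msg] unfolding F_def by blast
    then have finI: "finite I"
      using I(2) fin\<Omega> by blast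
    have "?\<Omega> = (\<Union>S\<in>I. F S)"
    proof (intro equalityI subsetI)
      fix B assume B: "B \<in> ?\<Omega>"
      then obtain i where "i \<in> I" "L B - i \<in> mat_ball \<epsilon>"
        using coset_repsD(2)[OF I(1) L_W] by blast
      then show "B \<in> (\<Union>S\<in>I. F S)"
        using B by (auto simp: F_def)
    qed (auto simp: F_def)
    moreover have "card (\<Union>S\<in>I. F S) = (\<Sum>S\<in>I. card (F S))"
    proof (rule card_UN_disjoint[OF finI])
      show "\<forall>i\<in>I. finite (F i)"
        using fin\<Omega> by (simp add: F_def)
      show "\<forall>i\<in>I. \<forall>j\<in>I. i \<noteq> j \<longrightarrow> F i \<inter> F j = {}"
      proof (intro ballI impI equals0I)
        fix i j B assume *: "i \<in> I" "j \<in> I" "i \<noteq> j" "B \<in> F i \<inter> F j"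
        then have "i - j \<in> mat_ball \<epsilon>"
          using add_subgroup_diff_trans[OF msg] add_subgroup_diff_commute[OF msg]
          unfolding F_def by blast
        then show False
          using coset_reps_unique[OF msg I(1)] * by blast
      qed
    qed
    moreover have "(\<Sum>S'\<in>I. card (F S')) = (\<Sum>S'\<in>I. card (F S))"
      using le True coset_repsD(1)[OF I(1)] by (intro sum.cong refl antisym) auto
    ultimately have "card ?\<Omega> = card I * card (F S)"
      by simp
    moreover have "card ?\<Omega> = card Q ^ r"
      by (simp add: card_PiE)
    ultimately have eq: "card Q ^ r = card I * card (F S)"
      by simp
    have "I \<noteq> {}"
      using coset_repsD(2)[OF I(1) True] by blast
    then have "real (card I) \<noteq> 0"
      using finI by simp
    then have "real (card (F S)) = real (card Q ^ r) * (1 / real (card I))"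
      using eq by simp
    then show ?thesis
      using True coset_index_eq_card[OF msg I(1)] unfolding F_eq by simp
  qed
qed

text \<open>Exchanging the sums over \<open>A\<close> and over \<open>N\<close> leaves an index set
  of submodules that does not involve \<open>r\<close>. The Moebius coefficients are fixed by
  \<open>S\<close> and \<open>\<epsilon>\<close> before \<open>r\<close> appears, so one polynomial
  serves all \<open>r\<close>.\<close>

lemma count_pairs:
  fixes Q :: "('e ^ 'd::finite) set"
  assumes \<epsilon>: "0 < \<epsilon>" "\<epsilon> \<le> 1" and Q: "finite Q" "coset_reps (vec_ball \<epsilon>) (vec_ball 1) Q"
  shows "\<exists>P :: real poly. \<forall>r.
    real (card {(A, B) \<in> ({..<r} \<rightarrow>\<^sub>E Q) \<times> ({..<r} \<rightarrow>\<^sub>E Q). (\<Sum>k<r. sym_outer (A k) (B k)) - S \<in> mat_ball \<epsilon>})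
      = real (card Q ^ (2 * r)) * poly P ((1 / real (residue_card TYPE('e))) ^ r)"
proof -
  let ?\<L> = "{N :: ('e ^ 'd) set. int_submodule \<epsilon> N}"
  define \<phi> :: "('e ^ 'd) set \<Rightarrow> real" where
    "\<phi> N = (if S \<in> sym_image \<epsilon> N then 1 / real (coset_index (mat_ball \<epsilon>) (sym_image \<epsilon> N)) else 0)" for N
  have fin: "finite ?\<L>"
    by (rule finite_int_submodules[OF \<epsilon> Q])
  obtain c where c: "\<And>M. M \<in> ?\<L> \<Longrightarrow> \<phi> M = (\<Sum>N\<in>{N\<in>?\<L>. M \<subseteq> N}. c N)"
    using moebius_expansion[OF fin, of \<phi>] by blast
  obtain e where e: "\<And>N. N \<in> ?\<L> \<Longrightarrow> card Q = residue_card TYPE('e) ^ e N * card (Q \<inter> N)"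
    using card_int_submodule[OF \<epsilon> Q] by (metis mem_Collect_eq)
  let ?q = "real (residue_card TYPE('e))"
  have q: "?q > 0"
    using residue_card_pos[where ?'a = 'e] by simp
  \<comment> \<open>The index of \<open>N\<close> in \<open>vec_ball 1\<close> is
    \<open>residue_card\<close> to the power \<open>e N\<close>, and the proportion of
    \<open>A\<close> with all columns in \<open>N\<close> is the inverse of this index to the power
    \<open>r\<close>: hence a monomial of degree \<open>e N\<close>.\<close>
  define P where "P = (\<Sum>N\<in>?\<L>. monom (c N) (e N))"
  have Q1: "Q \<subseteq> vec_ball 1"
    using coset_repsD(1)[OF Q(2)] .
  have "real (card {(A, B) \<in> ({..<r} \<rightarrow>\<^sub>E Q) \<times> ({..<r} \<rightarrow>\<^sub>E Q). (\<Sum>k<r. sym_outer (A k) (B k)) - S \<in> mat_ball \<epsilon>})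
      = real (card Q ^ (2 * r)) * poly P ((1 / ?q) ^ r)" for r
  proof -
    let ?\<Omega> = "{..<r} \<rightarrow>\<^sub>E Q"
    have fin\<Omega>: "finite ?\<Omega>"
      using Q(1) by (intro finite_PiE) auto
    have A1: "A k \<in> vec_ball 1" if "A \<in> ?\<Omega>" "k < r" for A k
      using that Q1 by (auto simp: PiE_iff)
    have span: "int_span \<epsilon> r A \<in> ?\<L>" if "A \<in> ?\<Omega>" for A
      using int_submodule_int_span[of r A \<epsilon>] A1 that \<epsilon> by simp
    have "{(A, B) \<in> ?\<Omega> \<times> ?\<Omega>. (\<Sum>k<r. sym_outer (A k) (B k)) - S \<in> mat_ball \<epsilon>}
        = Sigma ?\<Omega> (\<lambda>A. {B \<in> ?\<Omega>. (\<Sum>k<r. sym_outer (A k) (B k)) - S \<in> mat_ball \<epsilon>})"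
      by auto
    then have "real (card {(A, B) \<in> ?\<Omega> \<times> ?\<Omega>. (\<Sum>k<r. sym_outer (A k) (B k)) - S \<in> mat_ball \<epsilon>})
        = (\<Sum>A\<in>?\<Omega>. real (card {B \<in> ?\<Omega>. (\<Sum>k<r. sym_outer (A k) (B k)) - S \<in> mat_ball \<epsilon>}))"
      using fin\<Omega> by (simp add: card_SigmaI)
    also have "\<dots> = (\<Sum>A\<in>?\<Omega>. real (card Q ^ r) * \<phi> (int_span \<epsilon> r A))"
      unfolding \<phi>_def by (intro sum.cong refl card_fibre[OF \<epsilon> Q]) (rule A1)
    also have "\<dots> = real (card Q ^ r) * (\<Sum>A\<in>?\<Omega>. \<phi> (int_span \<epsilon> r A))"
      by (rule sum_distrib_left[symmetric])
    also have "(\<Sum>A\<in>?\<Omega>. \<phi> (int_span \<epsilon> r A))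
        = (\<Sum>A\<in>?\<Omega>. \<Sum>N\<in>{N\<in>?\<L>. int_span \<epsilon> r A \<subseteq> N}. c N)"
      using c span by (intro sum.cong) auto
    also have "\<dots> = (\<Sum>N\<in>?\<L>. \<Sum>A\<in>{A\<in>?\<Omega>. int_span \<epsilon> r A \<subseteq> N}. c N)"
      by (rule sum.swap_restrict[OF fin\<Omega> fin])
    also have "\<dots> = (\<Sum>N\<in>?\<L>. real (card Q ^ r) * (c N * ((1 / ?q) ^ r) ^ e N))"
    proof (intro sum.cong refl)
      fix N assume N: "N \<in> ?\<L>"
      have "{A\<in>?\<Omega>. int_span \<epsilon> r A \<subseteq> N} = {..<r} \<rightarrow>\<^sub>E (Q \<inter> N)"
        using int_span_subset_iff[of \<epsilon> N r] N \<epsilon> by (auto simp: PiE_iff extensional_def)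
      then have "card {A\<in>?\<Omega>. int_span \<epsilon> r A \<subseteq> N} = card (Q \<inter> N) ^ r"
        by (simp add: card_PiE)
      moreover have "real (card (Q \<inter> N)) = real (card Q) * (1 / ?q) ^ e N"
        using e[OF N] q by (simp add: power_divide)
      ultimately show "(\<Sum>A\<in>{A\<in>?\<Omega>. int_span \<epsilon> r A \<subseteq> N}. c N)
          = real (card Q ^ r) * (c N * ((1 / ?q) ^ r) ^ e N)"
        by (simp add: power_mult_distrib power_mult[symmetric] mult.commute)
    qed
    also have "\<dots> = real (card Q ^ r) * poly P ((1 / ?q) ^ r)"
      by (simp add: P_def poly_sum poly_monom sum_distrib_left)
    finally show ?thesis
      by (simp add: mult_2 power_add)
  qed
  then show ?thesis
    by blast
qed

end

subsection \<open>Topology of Hermitian matrices\<close>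

lemma mat_translate_eq:
  "{X. X - T \<in> mat_ball \<epsilon>} = {X. \<forall>i. X $ i \<in> {y. \<forall>j. y $ j \<in> {x. absval (x - T $ i $ j) \<le> \<epsilon>}}}"
  by (auto simp: mat_ball_def)

lemma compact_mat_translate: "compact {X. X - (T :: 'a::nonarch_local_field ^ 'm::finite ^ 'n::finite) \<in> mat_ball \<epsilon>}"
  unfolding mat_translate_eq by (intro compact_vec compact_val_cball)

lemma open_mat_translate:
  "0 < \<epsilon> \<Longrightarrow> open {X. X - (T :: 'a::nonarch_local_field ^ 'm::finite ^ 'n::finite) \<in> mat_ball \<epsilon>}"
  unfolding mat_translate_eq by (intro open_vec_all open_val_cball)

lemma open_imp_mat_translate:
  fixes T :: "'a::nonarch_local_field ^ 'm::finite ^ 'n::finite"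
  assumes "open N" "T \<in> N"
  shows "\<exists>\<epsilon>>0. \<forall>X. X - T \<in> mat_ball \<epsilon> \<longrightarrow> X \<in> N"
proof -
  obtain e where e: "e > 0" "ball T e \<subseteq> N"
    using assms open_contains_ball by blast
  \<comment> \<open>The distance of matrices is Euclidean, hence at most the sum of the distances of
    the entries; the factor 2 makes the final inequality strict.\<close>
  define \<epsilon> where "\<epsilon> = e / (2 * (real CARD('n) * real CARD('m)))"
  have pos: "0 < real CARD('n) * real CARD('m)"
    by simp
  then have \<epsilon>: "\<epsilon> > 0"
    using e by (simp add: \<epsilon>_def)
  have "X \<in> N" if X: "X - T \<in> mat_ball \<epsilon>" for X
  proof -
    have "dist X T \<le> (\<Sum>i\<in>UNIV. dist (X $ i) (T $ i))"
      unfolding dist_vec_def by (rule L2_set_le_sum) simp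
    also have "\<dots> \<le> (\<Sum>i\<in>(UNIV :: 'n set). \<Sum>j\<in>(UNIV :: 'm set). \<epsilon>)"
    proof (rule sum_mono)
      fix i :: 'n
      have "dist (X $ i) (T $ i) \<le> (\<Sum>j\<in>UNIV. dist (X $ i $ j) (T $ i $ j))"
        unfolding dist_vec_def[of "X $ i"] by (rule L2_set_le_sum) simp
      also have "\<dots> \<le> (\<Sum>j\<in>(UNIV :: 'm set). \<epsilon>)"
        using X by (intro sum_mono) (simp add: dist_absval mat_ball_def)
      finally show "dist (X $ i) (T $ i) \<le> (\<Sum>j\<in>(UNIV :: 'm set). \<epsilon>)" .
    qed
    also have "\<dots> = real CARD('n) * real CARD('m) * \<epsilon>"
      by simp
    also have "\<dots> = e / 2"
      using pos by (simp add: \<epsilon>_def)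
    also have "\<dots> < e"
      using e by simp
    finally show ?thesis
      using e by (auto simp: dist_commute)
  qed
  with \<epsilon> show ?thesis
    by blast
qed

lemma haar_measure_onD:
  assumes "haar_measure_on G \<mu>"
  shows "openin (top_of_set G) A \<Longrightarrow> A \<in> sets \<mu>"
    and "openin (top_of_set G) A \<Longrightarrow> A \<noteq> {} \<Longrightarrow> 0 < emeasure \<mu> A"
    and "K \<subseteq> G \<Longrightarrow> compact K \<Longrightarrow> emeasure \<mu> K < \<infinity>"
    and "a \<in> G \<Longrightarrow> A \<in> sets \<mu> \<Longrightarrow> emeasure \<mu> ((\<lambda>x. a + x) ` A) = emeasure \<mu> A"
proof -
  show "A \<in> sets \<mu>" if "openin (top_of_set G) A"
  proof -
    obtain B where "open B" "A = G \<inter> B"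
      using \<open>openin (top_of_set G) A\<close> openin_open by blast
    then have "A \<in> sets (restrict_space borel G)"
      by (auto simp: sets_restrict_space)
    then show ?thesis
      using assms unfolding haar_measure_on_def by blast
  qed
qed (use assms in \<open>auto simp: haar_measure_on_def\<close>)

context separable_quadratic_extension
begin

lemma herm_diff: "X \<in> herm \<sigma> \<Longrightarrow> Y \<in> herm \<sigma> \<Longrightarrow> X - Y \<in> herm \<sigma>"
  by (simp add: herm_iff_ctrans ctrans_diff)

lemma herm_add: "X \<in> herm \<sigma> \<Longrightarrow> Y \<in> herm \<sigma> \<Longrightarrow> X + Y \<in> herm \<sigma>"
  by (simp add: herm_iff_ctrans ctrans_add)

lemma zero_in_herm: "0 \<in> herm \<sigma>"
  by (simp add: herm_def)

lemma closed_herm: "closed (herm \<sigma> :: ('e ^ 'd::finite ^ 'd) set)"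
proof -
  have \<sigma>: "continuous_on UNIV \<sigma>"
    by (rule continuous_on_lipschitz_absval[of _ 1]) (simp flip: conj_diff)
  have "continuous_on UNIV (\<lambda>A :: 'e ^ 'd ^ 'd. \<sigma> (A $ i $ j))" for i j
    by (intro continuous_on_compose2[OF \<sigma>] continuous_intros) auto
  then show ?thesis
    unfolding herm_def
    by (intro closed_Collect_all closed_Collect_eq continuous_intros) auto
qed

definition herm_ball :: "real \<Rightarrow> ('e ^ 'd ^ 'd) set" where
  "herm_ball \<epsilon> = herm \<sigma> \<inter> mat_ball \<epsilon>"

lemma add_subgroup_herm_ball: "0 \<le> \<epsilon> \<Longrightarrow> add_subgroup (herm_ball \<epsilon>)"
  using add_subgroup_diff[OF add_subgroup_mat_ball] add_subgroup_0[OF add_subgroup_mat_ball]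
  by (auto simp: add_subgroup_def herm_ball_def zero_in_herm intro: herm_diff)

lemma herm_ball_mono: "\<epsilon> \<le> \<epsilon>' \<Longrightarrow> herm_ball \<epsilon> \<subseteq> herm_ball \<epsilon>'"
  using mat_ball_mono by (fastforce simp: herm_ball_def)

definition herm_coset :: "'e ^ 'd ^ 'd \<Rightarrow> real \<Rightarrow> ('e ^ 'd ^ 'd) set" where
  "herm_coset T \<epsilon> = {S \<in> herm \<sigma>. S - T \<in> mat_ball \<epsilon>}"

lemma openin_herm_coset:
  "0 < \<epsilon> \<Longrightarrow> openin (top_of_set (herm \<sigma>)) (herm_coset (T :: 'e ^ 'd::finite ^ 'd) \<epsilon>)"
  using openin_open_Int[OF open_mat_translate[of \<epsilon> T], of "herm \<sigma>"]
  by (simp add: herm_coset_def Int_def)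

lemma compact_herm_coset: "compact (herm_coset (T :: 'e ^ 'd::finite ^ 'd) \<epsilon>)"
  using closed_Int_compact[OF closed_herm compact_mat_translate[of T \<epsilon>]]
  by (simp add: herm_coset_def Int_def)

lemma herm_ball_eq_coset: "herm_ball \<epsilon> = herm_coset 0 \<epsilon>"
  by (auto simp: herm_ball_def herm_coset_def)

lemma openin_herm_imp_coset:
  assumes "openin (top_of_set (herm \<sigma>)) N" "(T :: 'e ^ 'd::finite ^ 'd) \<in> N"
  shows "\<exists>\<epsilon>>0. herm_coset T \<epsilon> \<subseteq> N"
proof -
  obtain O' where O': "open O'" "N = herm \<sigma> \<inter> O'"
    using assms(1) openin_open by blast
  then obtain \<epsilon> where "\<epsilon> > 0" "\<forall>X. X - T \<in> mat_ball \<epsilon> \<longrightarrow> X \<in> O'"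
    using open_imp_mat_translate assms(2) by blast
  then show ?thesis
    using O' by (auto simp: herm_coset_def)
qed

lemma herm_nbhd:
  assumes "0 < \<epsilon>" "U \<subseteq> herm \<sigma>" "(u :: 'e ^ 'd::finite ^ 'd) \<in> U"
  shows "\<exists>O'. open O' \<and> u \<in> O' \<and> (\<forall>y\<in>O' \<inter> U. y - u \<in> herm_ball \<epsilon>)"
  using open_mat_translate[OF assms(1), of u] add_subgroup_0[OF add_subgroup_mat_ball, of \<epsilon>] assms
  by (intro exI[of _ "{X. X - u \<in> mat_ball \<epsilon>}"]) (auto simp: herm_ball_def intro: herm_diff)

lemma compact_open_herm_stable:
  assumes U: "compact U" "openin (top_of_set (herm \<sigma>)) (U :: ('e ^ 'd::finite ^ 'd) set)"
  shows "\<exists>\<epsilon>>0. \<forall>\<epsilon>'\<le>\<epsilon>. coset_stable (herm_ball \<epsilon>') U"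
proof (rule compact_coset_stable[OF add_subgroup_herm_ball herm_ball_mono U(1)])
  have U_herm: "U \<subseteq> herm \<sigma>"
    using U(2) openin_imp_subset by blast
  show "\<exists>\<epsilon>>0. \<forall>k\<in>herm_ball \<epsilon>. u + k \<in> U" if u: "u \<in> U" for u
  proof -
    obtain e where e: "e > 0" "herm_coset u e \<subseteq> U"
      using openin_herm_imp_coset[OF U(2) u] by blast
    have "u + k \<in> herm_coset u e" if "k \<in> herm_ball e" for k
      using that u U_herm herm_add by (auto simp: herm_coset_def herm_ball_def)
    then show ?thesis
      using e by blast
  qed
  show "\<exists>O'. open O' \<and> u \<in> O' \<and> (\<forall>y\<in>O' \<inter> U. y - u \<in> herm_ball \<epsilon>)" if "u \<in> U" "0 < \<epsilon>" for u \<epsilon>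
    by (rule herm_nbhd[OF that(2) U_herm that(1)])
qed auto

text \<open>For integral Hermitian \<open>k\<close> and \<open>s\<close> the trace of
  \<open>k ** s\<close> is integral and fixed by \<open>\<sigma>\<close>, so it comes from the
  valuation ring of \<open>F\<close>. The dual therefore absorbs
  \<open>herm_ball \<epsilon>\<close>, and its volume becomes a coset count as well.\<close>

lemma coset_stable_herm_int_dual:
  assumes "\<epsilon> \<le> 1"
  shows "coset_stable (herm_ball \<epsilon>) (herm_int_dual \<iota> \<sigma> :: ('e ^ 'd::finite ^ 'd) set)"
  unfolding coset_stable_def
proof (intro ballI)
  fix t k :: "'e ^ 'd ^ 'd" assume t: "t \<in> herm_int_dual \<iota> \<sigma>" and k: "k \<in> herm_ball \<epsilon>"
  have kh: "ctrans k = k" and k1: "k \<in> mat_ball 1"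
    using k assms mat_ball_mono by (auto simp: herm_ball_def herm_iff_ctrans)
  have "trace ((t + k) ** s) \<in> \<iota> ` valuation_ring" if s: "s \<in> herm_int \<sigma>" for s
  proof -
    have sh: "ctrans s = s" and s1: "s \<in> mat_ball 1"
      using s by (auto simp: herm_int_def herm_iff_ctrans mat_ball_def valuation_ring_def)
    have "\<sigma> (trace (k ** s)) = trace (ctrans (k ** s))"
      by (simp add: trace_def conj_sum)
    also have "\<dots> = trace (k ** s)"
      by (simp only: ctrans_mult kh sh trace_mul_sym[of s k])
    finally obtain a where a: "trace (k ** s) = \<iota> a"
      using fixed_imp_range by blast
    have "k ** s \<in> mat_ball 1"
      using k1 s1 by (intro mat_ball_mult_left) auto
    then have "absval (trace (k ** s)) \<le> 1"
      by (auto simp: trace_def mat_ball_def intro!: absval_sum_le)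
    then have a1: "absval a \<le> 1"
      by (simp add: a emb_absval)
    obtain b where b: "trace (t ** s) = \<iota> b" "absval b \<le> 1"
      using t s by (auto simp: herm_int_dual_def valuation_ring_def)
    have "trace ((t + k) ** s) = \<iota> (b + a)"
      by (simp add: matrix_add_left trace_add a b emb_add)
    then show ?thesis
      using a1 b by (auto simp: valuation_ring_def intro!: imageI absval_add_le)
  qed
  then show "t + k \<in> herm_int_dual \<iota> \<sigma>"
    using t k herm_add by (auto simp: herm_int_dual_def herm_ball_def)
qed

end

subsection \<open>The extended space\<close>

locale hermitian_over_extension =
  separable_quadratic_extension \<iota> \<sigma> + V: hermitian_space scale \<sigma> h
  for \<iota> :: "'f::nonarch_local_field \<Rightarrow> 'e::nonarch_local_field" and \<sigma> :: "'e \<Rightarrow> 'e"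
    and scale :: "'e \<Rightarrow> 'v::{topological_ab_group_add, t2_space} \<Rightarrow> 'v"
    and h :: "'v \<Rightarrow> 'v \<Rightarrow> 'e"
begin

definition ext_scale :: "'e \<Rightarrow> 'v \<times> (nat \<Rightarrow> 'e) \<Rightarrow> 'v \<times> (nat \<Rightarrow> 'e)" where
  "ext_scale a x = (scale a (fst x), \<lambda>k. a * snd x k)"

lemma split_form_hermitian: "split_form \<sigma> r z w = \<sigma> (split_form \<sigma> r w z)"
proof -
  have "split_form \<sigma> r z w = (\<Sum>k<2 * r. z (2 * r - Suc k) * \<sigma> (w (2 * r - 1 - (2 * r - Suc k))))"
    unfolding split_form_def
    by (rule sum.nat_diff_reindex[symmetric, of "\<lambda>k. z k * \<sigma> (w (2 * r - 1 - k))"])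
  also have "\<dots> = (\<Sum>k<2 * r. \<sigma> (w k * \<sigma> (z (2 * r - 1 - k))))"
    by (intro sum.cong) (auto simp: conj_mult mult.commute)
  finally show ?thesis
    by (simp add: split_form_def conj_sum)
qed

lemma ext_form_sesquilinear: "sesquilinear_form \<iota> \<sigma> ext_scale (ext_form \<sigma> h r)"
proof (unfold_locales)
  show "ext_scale a (x + y) = ext_scale a x + ext_scale a y" for a x y
    by (simp add: ext_scale_def prod_eq_iff fun_eq_iff V.scale_right_distrib algebra_simps)
  show "ext_scale (a + b) x = ext_scale a x + ext_scale b x" for a b x
    by (simp add: ext_scale_def prod_eq_iff fun_eq_iff V.scale_left_distrib algebra_simps)
  show "ext_scale a (ext_scale b x) = ext_scale (a * b) x" for a b x
    by (simp add: ext_scale_def algebra_simps)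
  show "ext_scale 1 x = x" for x
    by (simp add: ext_scale_def)
  show "ext_form \<sigma> h r (x + y) z = ext_form \<sigma> h r x z + ext_form \<sigma> h r y z" for x y z
    by (simp add: ext_form_def split_form_def V.form_add_left sum.distrib algebra_simps)
  show "ext_form \<sigma> h r (ext_scale a x) y = a * ext_form \<sigma> h r x y" for a x y
    by (simp add: ext_form_def split_form_def ext_scale_def V.form_scale_left sum_distrib_left algebra_simps)
  show "ext_form \<sigma> h r y x = \<sigma> (ext_form \<sigma> h r x y)" for x y
    unfolding ext_form_def conj_add
    by (simp only: V.form_hermitian[of "fst y" "fst x"] split_form_hermitian[of r "snd y" "snd x"])
qed

lemma V_sesquilinear: "sesquilinear_form \<iota> \<sigma> scale h"
  by (unfold_locales) (rule V.form_add_left V.form_scale_left V.form_hermitian)+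

end

text \<open>Fixes one norm with the properties from \<open>exists_norm\<close>, so that balls and
  levels can be definitions.\<close>

locale normed_hermitian_space = hermitian_over_extension \<iota> \<sigma> scale h
  for \<iota> :: "'f::nonarch_local_field \<Rightarrow> 'e::nonarch_local_field" and \<sigma> :: "'e \<Rightarrow> 'e"
    and scale :: "'e \<Rightarrow> 'v::{topological_ab_group_add, t2_space} \<Rightarrow> 'v"
    and h :: "'v \<Rightarrow> 'v \<Rightarrow> 'e" +
  fixes nv :: "'v \<Rightarrow> real" and H :: real
  assumes nv_nonneg: "\<And>v. 0 \<le> nv v"
    and nv_add: "\<And>v w. nv (v + w) \<le> max (nv v) (nv w)"
    and nv_scale: "\<And>a v. nv (scale a v) = absval a * nv v"
    and nv_open: "\<And>r. 0 < r \<Longrightarrow> open {v. nv v \<le> r}"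
    and nv_nbhd: "\<And>U. open U \<Longrightarrow> 0 \<in> U \<Longrightarrow> \<exists>r>0. \<forall>v. nv v \<le> r \<longrightarrow> v \<in> U"
    and H: "0 \<le> H" "\<And>v w. absval (h v w) \<le> H * nv v * nv w"
begin

lemma nv_add_le: "nv v \<le> r \<Longrightarrow> nv w \<le> r \<Longrightarrow> nv (v + w) \<le> r"
  using nv_add[of v w] by simp

lemma nv_diff_le:
  assumes "nv v \<le> r" "nv w \<le> r"
  shows "nv (v - w) \<le> r"
proof -
  have "nv (- w) = nv w"
    using nv_scale[of "- 1" w] by simp
  then show ?thesis
    using nv_add_le[of v r "- w"] assms by simp
qed

lemma nv_0: "nv 0 = 0"
  using nv_scale[of 0 0] by simp

lemma nv_sum_le:
  assumes "\<And>i. i \<in> A \<Longrightarrow> nv (f i) \<le> r" "0 \<le> r"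
  shows "nv (sum f A) \<le> r"
  using assms by (induction A rule: infinite_finite_induct) (auto simp: nv_0 intro: nv_add_le)

lemma open_nv_cball:
  assumes "0 < r"
  shows "open {w. nv (w - v) \<le> r}"
proof -
  have "continuous_on UNIV (\<lambda>w. w - v)"
    by (intro continuous_intros)
  from open_vimage[OF nv_open[OF assms] this] show ?thesis
    by (simp add: vimage_def)
qed

definition nv_ball :: "real \<Rightarrow> ('v ^ 'd) set" where
  "nv_ball r = {x. \<forall>i. nv (x $ i) \<le> r}"

lemma add_subgroup_nv_ball: "0 \<le> r \<Longrightarrow> add_subgroup (nv_ball r)"
  by (auto simp: add_subgroup_def nv_ball_def nv_0 intro: nv_diff_le)

lemma open_nv_ball_translate:
  assumes "0 < r"
  shows "open {y :: 'v ^ 'd::finite. y - x \<in> nv_ball r}"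
proof -
  have "open {y :: 'v ^ 'd. \<forall>i. y $ i \<in> {w. nv (w - x $ i) \<le> r}}"
    by (intro open_vec_all open_nv_cball assms)
  then show ?thesis
    by (simp add: nv_ball_def)
qed

lemma nv_nbhd_tuple:
  fixes x :: "'v ^ 'd::finite"
  assumes "0 < r"
  shows "\<exists>O'. open O' \<and> x \<in> O' \<and> (\<forall>y\<in>O' \<inter> C. y - x \<in> nv_ball r)"
  using open_nv_ball_translate[OF assms, of x] assms
  by (intro exI[of _ "{y. y - x \<in> nv_ball r}"]) (auto simp: nv_ball_def nv_0)

lemma finite_reps_nv_ball:
  assumes "0 < r" "compact (C :: ('v ^ 'd::finite) set)"
  shows "\<exists>I. finite I \<and> coset_reps (nv_ball r) C I"
  using assms by (intro exists_finite_coset_reps add_subgroup_nv_ball nv_nbhd_tuple) auto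

lemma compact_nv_bounded:
  assumes C: "compact (C :: ('v ^ 'd::finite) set)"
  obtains R where "1 \<le> R" "C \<subseteq> nv_ball R"
proof -
  obtain I where I: "finite I" "coset_reps (nv_ball 1) C I"
    using finite_reps_nv_ball[OF zero_less_one C] by blast
  define R where "R = Max (insert 1 ((\<lambda>(x, i). nv (x $ i)) ` (I \<times> UNIV)))"
  have R: "1 \<le> R"
    using I(1) by (simp add: R_def)
  have "nv (x $ j) \<le> R" if x: "x \<in> C" for x j
  proof -
    obtain y where y: "y \<in> I" "x - y \<in> nv_ball 1"
      using coset_repsD(2)[OF I(2) x] by blast
    have "nv (y $ j) \<in> (\<lambda>(x, i). nv (x $ i)) ` (I \<times> UNIV)"
      using y by (intro image_eqI[of _ _ "(y, j)"]) auto
    then have "nv (y $ j) \<le> R"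
      unfolding R_def using I(1) by (intro Max_ge insertI2) auto
    moreover have "nv (x $ j - y $ j) \<le> R"
      using y(2) R by (auto simp: nv_ball_def intro: order_trans)
    ultimately show ?thesis
      using nv_add_le[of "x $ j - y $ j" R "y $ j"] by simp
  qed
  then show ?thesis
    using that[OF R] by (auto simp: nv_ball_def)
qed

lemma compact_open_nv_stable:
  assumes C: "compact (C :: ('v ^ 'd::finite) set)" "open C"
  shows "\<exists>\<delta>>0. \<forall>\<delta>'\<le>\<delta>. coset_stable (nv_ball \<delta>') C"
proof (rule compact_coset_stable[OF add_subgroup_nv_ball _ C(1) _ nv_nbhd_tuple])
  show "nv_ball \<delta> \<subseteq> nv_ball \<delta>'" if "\<delta> \<le> \<delta>'" for \<delta> \<delta>'
    unfolding nv_ball_def using that order_trans by blast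
  show "\<exists>\<delta>>0. \<forall>k\<in>nv_ball \<delta>. u + k \<in> C" if u: "u \<in> C" for u
  proof -
    obtain A where A: "\<And>i. open (A i) \<and> u $ i \<in> A i" "\<And>y. (\<forall>i. y $ i \<in> A i) \<Longrightarrow> y \<in> C"
      using C(2) u unfolding open_vec_def by metis
    have "\<exists>r>0. \<forall>v. nv v \<le> r \<longrightarrow> u $ i + v \<in> A i" for i
    proof -
      have "open ((\<lambda>v. u $ i + v) -` A i)"
        using A(1) by (intro open_vimage continuous_intros) auto
      then show ?thesis
        using nv_nbhd[of "(\<lambda>v. u $ i + v) -` A i"] A(1) by auto
    qed
    then obtain r where r: "\<And>i. 0 < r i" "\<And>i v. nv v \<le> r i \<Longrightarrow> u $ i + v \<in> A i"
      by metis
    have "u + k \<in> C" if "k \<in> nv_ball (Min (range r))" for k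
      using that r(2) by (intro A(2)) (auto simp: nv_ball_def)
    moreover have "0 < Min (range r)"
      using r(1) by simp
    ultimately show ?thesis
      by blast
  qed
qed auto

text \<open>By bilinearity over \<open>F\<close> an entry changes by three values of
  \<open>h\<close>. Each pairs a vector of norm at most \<open>R\<close> with one of norm at most
  \<open>\<delta>\<close>, also the term quadratic in \<open>y\<close>, since
  \<open>\<delta> \<le> R\<close>.\<close>

lemma moment_matrix_perturb:
  fixes x y :: "'v ^ 'd::finite"
  assumes x: "x \<in> nv_ball R" and y: "y \<in> nv_ball \<delta>" and R: "0 \<le> \<delta>" "\<delta> \<le> R" "H * R * \<delta> \<le> \<epsilon>"
  shows "moment_matrix h (x + y) - moment_matrix h x \<in> mat_ball \<epsilon>"
proof -
  interpret sesquilinear_form \<iota> \<sigma> scale h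
    by (rule V_sesquilinear)
  have le: "absval (h v w) \<le> \<epsilon>" if "nv v \<le> R" "nv w \<le> \<delta>" for v w
  proof -
    have "absval (h v w) \<le> H * nv v * nv w"
      by (rule H)
    also have "\<dots> \<le> H * R * \<delta>"
      using that H(1) nv_nonneg R order_trans[OF nv_nonneg that(1)] by (intro mult_mono) auto
    finally show ?thesis
      using R by simp
  qed
  have le': "absval (h v w) \<le> \<epsilon>" if "nv v \<le> \<delta>" "nv w \<le> R" for v w
    using le[OF that(2,1)] hermitian[of v w] by simp
  have "absval (h (x $ i) (y $ j) + h (y $ i) (x $ j) + h (y $ i) (y $ j)) \<le> \<epsilon>" for i j
    using x y R by (intro absval_add_le le le') (auto simp: nv_ball_def intro: order_trans)
  then show ?thesis
    by (auto simp: mat_ball_def moment_matrix_def add_left add_right algebra_simps)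
qed

text \<open>Two radii are needed. On the split part the coordinates are integral and the form has
  coefficients 0 and 1, so moving by \<open>\<epsilon>\<close> changes the moments by at most
  \<open>\<epsilon>\<close>; on \<open>V\<close> the sizes of \<open>C\<close> and of
  \<open>h\<close> intervene and force a separate \<open>\<delta>\<close>.\<close>

definition level :: "real \<Rightarrow> real \<Rightarrow> nat \<Rightarrow> (('v \<times> (nat \<Rightarrow> 'e)) ^ 'd) set" where
  "level \<delta> \<epsilon> r = {x. \<forall>i. nv (fst (x $ i)) \<le> \<delta> \<and> snd (x $ i) \<in> split_space r \<and>
     (\<forall>k<2 * r. absval (snd (x $ i) k) \<le> \<epsilon>)}"

lemma add_subgroup_level: "0 \<le> \<delta> \<Longrightarrow> 0 \<le> \<epsilon> \<Longrightarrow> add_subgroup (level \<delta> \<epsilon> r)"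
  by (auto simp: add_subgroup_def level_def nv_0 split_space_def intro: nv_diff_le absval_diff_le)

lemma level_subset: "level \<delta> \<epsilon> r \<subseteq> ext_space_power r"
  by (auto simp: level_def ext_space_power_def)

text \<open>An open set of sequences may constrain finitely many coordinates only. Those below
  \<open>2 * r\<close> suffice, because the others vanish on
  \<open>ext_space_power r\<close>.\<close>

lemma level_translate_open:
  fixes x :: "('v \<times> (nat \<Rightarrow> 'e)) ^ 'd::finite"
  assumes "0 < \<delta>" "0 < \<epsilon>" and x: "x \<in> ext_space_power r"
  obtains O' where "open O'" "x \<in> O'" "\<And>y. y \<in> ext_space_power r \<Longrightarrow> y \<in> O' \<longleftrightarrow> y - x \<in> level \<delta> \<epsilon> r"
proof -
  define O' where "O' = {y :: ('v \<times> (nat \<Rightarrow> 'e)) ^ 'd. \<forall>i. y $ i \<in>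
      (fst -` {w. nv (w - fst (x $ i)) \<le> \<delta>}) \<inter>
      (\<Inter>k\<in>{..<2 * r}. (\<lambda>p. snd p k) -` {a. absval (a - snd (x $ i) k) \<le> \<epsilon>})}"
  have "open (fst -` {w. nv (w - fst (x $ i)) \<le> \<delta>} :: ('v \<times> (nat \<Rightarrow> 'e)) set)" for i
    using open_nv_cball[OF assms(1)] by (intro open_vimage) (auto intro: continuous_intros)
  moreover have "open ((\<lambda>p :: 'v \<times> (nat \<Rightarrow> 'e). snd p k) -` {a. absval (a - snd (x $ i) k) \<le> \<epsilon>})" for i k
  proof (rule open_vimage[OF open_val_cball[OF assms(2)]])
    show "continuous_on UNIV (\<lambda>p :: 'v \<times> (nat \<Rightarrow> 'e). snd p k)"
      by (rule continuous_on_product_then_coordinatewise) (intro continuous_intros)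
  qed
  ultimately have "open O'"
    unfolding O'_def by (intro open_vec_all open_Int open_INT) auto
  moreover have "x \<in> O'"
    using assms by (simp add: O'_def nv_0)
  moreover have "y \<in> O' \<longleftrightarrow> y - x \<in> level \<delta> \<epsilon> r" if "y \<in> ext_space_power r" for y
    using that x by (auto simp: O'_def level_def ext_space_power_def split_space_def)
  ultimately show ?thesis
    using that by blast
qed

lemma openin_level:
  assumes "0 < \<delta>" "0 < \<epsilon>"
  shows "openin (top_of_set (ext_space_power r)) (level \<delta> \<epsilon> r :: (('v \<times> (nat \<Rightarrow> 'e)) ^ 'd::finite) set)"
proof -
  have "(0 :: ('v \<times> (nat \<Rightarrow> 'e)) ^ 'd) \<in> ext_space_power r"
    by (simp add: ext_space_power_def split_space_def)
  then obtain O' :: "(('v \<times> (nat \<Rightarrow> 'e)) ^ 'd) set" where O': "open O'"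
      "\<And>y. y \<in> ext_space_power r \<Longrightarrow> y \<in> O' \<longleftrightarrow> y - 0 \<in> level \<delta> \<epsilon> r"
    using level_translate_open[OF assms] by metis
  then have "level \<delta> \<epsilon> r = ext_space_power r \<inter> O'"
    using level_subset by fastforce
  then show ?thesis
    using O'(1) openin_open by blast
qed

lemma ext_set_subset: "ext_set C r \<subseteq> ext_space_power r"
  by (auto simp: ext_set_def ext_space_power_def split_lattice_def)

lemma compact_split_lattice: "compact (split_lattice r :: (nat \<Rightarrow> 'e) set)"
proof -
  have "compactin (product_topology (\<lambda>_. euclidean) UNIV)
      (PiE UNIV (\<lambda>k. if k < 2 * r then val_ball 1 else {0 :: 'e}))"
    by (simp add: compactin_PiE compact_val_ball)
  moreover have "PiE UNIV (\<lambda>k. if k < 2 * r then val_ball 1 else {0 :: 'e}) = split_lattice r"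
    by (auto simp: split_lattice_def split_space_def val_ball_def valuation_ring_def PiE_iff split: if_splits)
  ultimately show ?thesis
    by (simp add: euclidean_product_topology)
qed

lemma compact_ext_set:
  assumes "compact (C :: ('v ^ 'd::finite) set)"
  shows "compact (ext_set C r :: (('v \<times> (nat \<Rightarrow> 'e)) ^ 'd) set)"
proof -
  let ?f = "\<lambda>p :: ('v ^ 'd) \<times> ((nat \<Rightarrow> 'e) ^ 'd). (\<chi> i. (fst p $ i, snd p $ i)) :: ('v \<times> (nat \<Rightarrow> 'e)) ^ 'd"
  have "compact (C \<times> {y :: (nat \<Rightarrow> 'e) ^ 'd. \<forall>i. y $ i \<in> split_lattice r})"
    by (intro compact_Times assms compact_vec compact_split_lattice)
  then have "compact (?f ` (C \<times> {y. \<forall>i. y $ i \<in> split_lattice r}))"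
    by (intro compact_continuous_image continuous_intros)
  moreover have "?f ` (C \<times> {y. \<forall>i. y $ i \<in> split_lattice r}) = (ext_set C r :: (('v \<times> (nat \<Rightarrow> 'e)) ^ 'd) set)"
  proof
    show "?f ` (C \<times> {y. \<forall>i. y $ i \<in> split_lattice r}) \<subseteq> ext_set C r"
      by (auto simp: ext_set_def vec_lambda_eta)
    show "ext_set C r \<subseteq> ?f ` (C \<times> {y. \<forall>i. y $ i \<in> split_lattice r})"
    proof
      fix x :: "('v \<times> (nat \<Rightarrow> 'e)) ^ 'd" assume "x \<in> ext_set C r"
      then show "x \<in> ?f ` (C \<times> {y. \<forall>i. y $ i \<in> split_lattice r})"
        by (intro image_eqI[of _ _ "(\<chi> i. fst (x $ i), \<chi> i. snd (x $ i))"])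
           (auto simp: ext_set_def vec_eq_iff)
    qed
  qed
  ultimately show ?thesis
    by simp
qed

lemma fst_vec_add: "(\<chi> i. fst ((x + y) $ i)) = (\<chi> i. fst (x $ i)) + (\<chi> i. fst (y $ i))"
  by (simp add: vec_eq_iff)

lemma coset_stable_ext_set:
  assumes C: "coset_stable (nv_ball \<delta>) (C :: ('v ^ 'd::finite) set)" and \<epsilon>: "\<epsilon> \<le> 1"
  shows "coset_stable (level \<delta> \<epsilon> r) (ext_set C r)"
  unfolding coset_stable_def
proof (intro ballI)
  fix x k :: "('v \<times> (nat \<Rightarrow> 'e)) ^ 'd" assume x: "x \<in> ext_set C r" and k: "k \<in> level \<delta> \<epsilon> r"
  have "(\<chi> i. fst (k $ i)) \<in> nv_ball \<delta>"
    using k by (auto simp: level_def nv_ball_def)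
  then have "(\<chi> i. fst ((x + k) $ i)) \<in> C"
    using C x unfolding fst_vec_add coset_stable_def ext_set_def by blast
  moreover have "snd ((x + k) $ i) \<in> split_lattice r" for i
    using x k \<epsilon>
    by (auto simp: ext_set_def level_def split_lattice_def split_space_def valuation_ring_def
        intro!: absval_add_le intro: order_trans)
  ultimately show "x + k \<in> ext_set C r"
    by (simp add: ext_set_def)
qed

text \<open>A product of two integral factors changes by at most the change of its factors, and the
  ultrametric sum over \<open>2 * r\<close> terms loses nothing; so the estimate is the same for all
  \<open>r\<close>.\<close>

lemma split_form_perturb:
  assumes w: "w \<in> split_lattice r" "z \<in> split_lattice r"
    and u: "\<And>k. k < 2 * r \<Longrightarrow> absval (u k) \<le> \<epsilon>" "\<And>k. k < 2 * r \<Longrightarrow> absval (t k) \<le> \<epsilon>"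
    and \<epsilon>: "0 \<le> \<epsilon>" "\<epsilon> \<le> 1"
  shows "absval (split_form \<sigma> r (w + u) (z + t) - split_form \<sigma> r w z) \<le> \<epsilon>"
proof -
  have "absval ((w + u) k * \<sigma> ((z + t) (2 * r - 1 - k)) - w k * \<sigma> (z (2 * r - 1 - k))) \<le> \<epsilon>"
    if k: "k < 2 * r" for k
  proof -
    let ?l = "2 * r - 1 - k"
    have l: "?l < 2 * r"
      using k by simp
    have "absval (w k) \<le> 1" "absval (z ?l) \<le> 1" "absval (t ?l) \<le> 1"
      using w u(2)[OF l] k l \<epsilon> by (auto simp: split_lattice_def valuation_ring_def)
    then have "absval (w k * \<sigma> (t ?l)) \<le> \<epsilon>" "absval (u k * \<sigma> (z ?l + t ?l)) \<le> \<epsilon>"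
      using absval_mult_le_left[of "w k" "\<sigma> (t ?l)" \<epsilon>] u(1)[OF k] u(2)[OF l]
        absval_mult_le_right[of "u k" \<epsilon> "\<sigma> (z ?l + t ?l)"] absval_add_le[of "z ?l" 1 "t ?l"]
      by simp_all
    then have "absval (w k * \<sigma> (t ?l) + u k * \<sigma> (z ?l + t ?l)) \<le> \<epsilon>"
      by (rule absval_add_le)
    moreover have "(w + u) k * \<sigma> ((z + t) ?l) - w k * \<sigma> (z ?l) = w k * \<sigma> (t ?l) + u k * \<sigma> (z ?l + t ?l)"
      by (simp add: conj_add algebra_simps)
    ultimately show ?thesis
      by simp
  qed
  then show ?thesis
    unfolding split_form_def sum_subtractf[symmetric] using \<epsilon> by (intro absval_sum_le) auto
qed

lemma ext_moment_perturb:
  fixes C :: "('v ^ 'd::finite) set" and x :: "('v \<times> (nat \<Rightarrow> 'e)) ^ 'd"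
  assumes C: "C \<subseteq> nv_ball R" and x: "x \<in> ext_set C r" and k: "k \<in> level \<delta> \<epsilon> r"
    and R: "0 \<le> \<delta>" "\<delta> \<le> R" "H * R * \<delta> \<le> \<epsilon>" and \<epsilon>: "0 \<le> \<epsilon>" "\<epsilon> \<le> 1"
  shows "moment_matrix (ext_form \<sigma> h r) (x + k) - moment_matrix (ext_form \<sigma> h r) x \<in> mat_ball \<epsilon>"
proof -
  have "moment_matrix h ((\<chi> i. fst (x $ i)) + (\<chi> i. fst (k $ i))) - moment_matrix h (\<chi> i. fst (x $ i)) \<in> mat_ball \<epsilon>"
    using C x k R by (intro moment_matrix_perturb) (auto simp: ext_set_def level_def nv_ball_def)
  then have 1: "absval (h (fst (x $ i) + fst (k $ i)) (fst (x $ j) + fst (k $ j)) - h (fst (x $ i)) (fst (x $ j))) \<le> \<epsilon>" for i j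
    by (simp add: mat_ball_def moment_matrix_def)
  have 2: "absval (split_form \<sigma> r (snd (x $ i) + snd (k $ i)) (snd (x $ j) + snd (k $ j))
      - split_form \<sigma> r (snd (x $ i)) (snd (x $ j))) \<le> \<epsilon>" for i j
    using x k \<epsilon> by (intro split_form_perturb) (auto simp: ext_set_def level_def)
  have "absval (ext_form \<sigma> h r (x $ i + k $ i) (x $ j + k $ j) - ext_form \<sigma> h r (x $ i) (x $ j)) \<le> \<epsilon>" for i j
    using absval_add_le[OF 1[of i j] 2[of i j]] by (simp add: ext_form_def algebra_simps)
  then show ?thesis
    by (simp add: mat_ball_def moment_matrix_def)
qed

lemma act_ext:
  fixes x :: "('v \<times> (nat \<Rightarrow> 'e)) ^ 'd::finite"
  shows "fst (sesquilinear_form.act ext_scale g x $ i) = (\<Sum>j\<in>UNIV. scale (g $ i $ j) (fst (x $ j)))"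
    and "snd (sesquilinear_form.act ext_scale g x $ i) k = (\<Sum>j\<in>UNIV. g $ i $ j * snd (x $ j) k)"
proof -
  \<comment> \<open>\<open>act\<close> depends on the scalar multiplication alone, so the form may
    be taken with \<open>r = 0\<close>.\<close>
  interpret sesquilinear_form \<iota> \<sigma> ext_scale "ext_form \<sigma> h 0"
    by (rule ext_form_sesquilinear)
  have "(\<Sum>j\<in>A. f j) k = (\<Sum>j\<in>A. f j k)" for f :: "'d \<Rightarrow> nat \<Rightarrow> 'e" and A k
    by (induction A rule: infinite_finite_induct) auto
  then show "fst (act g x $ i) = (\<Sum>j\<in>UNIV. scale (g $ i $ j) (fst (x $ j)))"
    and "snd (act g x $ i) k = (\<Sum>j\<in>UNIV. g $ i $ j * snd (x $ j) k)"
    by (simp_all add: act_def ext_scale_def fst_sum snd_sum)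
qed

lemma act_level:
  fixes x :: "('v \<times> (nat \<Rightarrow> 'e)) ^ 'd::finite"
  assumes g: "g \<in> mat_ball 1" and x: "x \<in> level \<delta> \<epsilon> r" and "0 \<le> \<delta>" "0 \<le> \<epsilon>"
  shows "sesquilinear_form.act ext_scale g x \<in> level \<delta> \<epsilon> r"
proof -
  have "nv (scale (g $ i $ j) (fst (x $ j))) \<le> \<delta>" for i j
    using g x mult_mono[of "absval (g $ i $ j)" 1 "nv (fst (x $ j))" \<delta>] nv_nonneg assms(3)
    by (simp add: nv_scale mat_ball_def level_def)
  moreover have "absval (g $ i $ j * snd (x $ j) k) \<le> \<epsilon>" if "k < 2 * r" for i j k
    using g x that by (intro absval_mult_le_left) (auto simp: mat_ball_def level_def)
  moreover have "snd (x $ j) k = 0" if "2 * r \<le> k" for j k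
    using x that by (auto simp: level_def split_space_def)
  ultimately show ?thesis
    using assms(3,4) by (auto simp: level_def split_space_def act_ext intro!: nv_sum_le absval_sum_le)
qed

text \<open>On \<open>V\<close> the action of \<open>g\<close> moves \<open>x\<close> by
  \<open>g - mat 1\<close> applied to \<open>x\<close>, of norm at most \<open>s * R\<close>, which
  is a step that \<open>C\<close> tolerates. On the lattice part integrality of \<open>g\<close> is
  enough.\<close>

lemma act_ext_set:
  fixes C :: "('v ^ 'd::finite) set" and x :: "('v \<times> (nat \<Rightarrow> 'e)) ^ 'd"
  assumes C: "C \<subseteq> nv_ball R" "coset_stable (nv_ball \<delta>) C" and g: "g \<in> one_ball s"
    and s: "s \<le> 1" "s * R \<le> \<delta>" and x: "x \<in> ext_set C r" and R: "0 \<le> \<delta>" "0 \<le> R"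
  shows "sesquilinear_form.act ext_scale g x \<in> ext_set C r"
proof -
  let ?y = "sesquilinear_form.act ext_scale g x"
  have g1: "g \<in> mat_ball 1"
    using g one_ball_subset[OF s(1)] by blast
  have xR: "nv (fst (x $ j)) \<le> R" for j
    using x C(1) by (auto simp: ext_set_def nv_ball_def)
  have "fst (?y $ i) - fst (x $ i) = (\<Sum>j\<in>UNIV. scale ((g - mat 1) $ i $ j) (fst (x $ j)))" for i
  proof -
    have "scale ((mat 1 :: 'e ^ 'd ^ 'd) $ i $ j) (fst (x $ j)) = (if j = i then fst (x $ j) else 0)" for j
      by (simp add: mat_def)
    then have "fst (x $ i) = (\<Sum>j\<in>UNIV. scale ((mat 1 :: 'e ^ 'd ^ 'd) $ i $ j) (fst (x $ j)))"
      by simp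
    then show ?thesis
      by (simp add: act_ext V.scale_left_diff_distrib sum_subtractf)
  qed
  moreover have "nv (scale ((g - mat 1) $ i $ j) (fst (x $ j))) \<le> \<delta>" for i j
  proof -
    have "absval ((g - mat 1) $ i $ j) * nv (fst (x $ j)) \<le> s * R"
      using g xR R nv_nonneg one_ball_nonneg[OF g] unfolding one_ball_def mat_ball_def
      by (intro mult_mono) auto
    then show ?thesis
      using s by (simp add: nv_scale del: vector_minus_component)
  qed
  ultimately have "nv (fst (?y $ i) - fst (x $ i)) \<le> \<delta>" for i
    using R by (simp add: nv_sum_le del: vector_minus_component)
  then have "(\<chi> i. fst (?y $ i) - fst (x $ i)) \<in> nv_ball \<delta>"
    by (simp add: nv_ball_def)
  moreover have "(\<chi> i. fst (x $ i)) \<in> C"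
    using x by (simp add: ext_set_def)
  ultimately have "(\<chi> i. fst (x $ i)) + (\<chi> i. fst (?y $ i) - fst (x $ i)) \<in> C"
    using C(2) unfolding coset_stable_def by blast
  moreover have "(\<chi> i. fst (x $ i)) + (\<chi> i. fst (?y $ i) - fst (x $ i)) = (\<chi> i. fst (?y $ i))"
    by (simp add: vec_eq_iff)
  ultimately have "(\<chi> i. fst (?y $ i)) \<in> C"
    by simp
  moreover have "snd (?y $ i) \<in> split_lattice r" for i
  proof -
    have "absval (snd (x $ j) k) \<le> 1" if "k < 2 * r" for j k
      using x that by (auto simp: ext_set_def split_lattice_def valuation_ring_def)
    moreover have "snd (x $ j) k = 0" if "2 * r \<le> k" for j k
      using x that by (auto simp: ext_set_def split_lattice_def split_space_def)
    ultimately show ?thesis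
      using g1 by (auto simp: split_lattice_def split_space_def valuation_ring_def act_ext mat_ball_def
          intro!: absval_sum_le absval_mult_le_left)
  qed
  ultimately show ?thesis
    by (simp add: ext_set_def)
qed

end

subsection \<open>The representation density\<close>

context normed_hermitian_space
begin

text \<open>The antidiagonal form pairs the coordinates \<open>k\<close> and
  \<open>2 * r - 1 - k\<close>. So \<open>A\<close> fills the first half and \<open>B\<close> the
  second in reverse order, which brings \<open>A k\<close> opposite \<open>B k\<close>; from
  \<open>2 * r\<close> on the sequence must vanish.\<close>

definition ext_vector ::
    "nat \<Rightarrow> 'v ^ 'd \<Rightarrow> (nat \<Rightarrow> 'e ^ 'd) \<Rightarrow> (nat \<Rightarrow> 'e ^ 'd) \<Rightarrow> ('v \<times> (nat \<Rightarrow> 'e)) ^ 'd" where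
  "ext_vector r v A B = (\<chi> i. (v $ i, \<lambda>k. if k < r then A k $ i else if k < 2 * r then B (2 * r - 1 - k) $ i else 0))"

lemma ext_vector_component:
  assumes "k < r"
  shows "snd (ext_vector r v A B $ i) k = A k $ i"
    and "snd (ext_vector r v A B $ i) (2 * r - 1 - k) = B k $ i"
proof -
  have "\<not> 2 * r - 1 - k < r" "2 * r - 1 - k < 2 * r" "2 * r - 1 - (2 * r - 1 - k) = k"
    using assms by auto
  then show "snd (ext_vector r v A B $ i) k = A k $ i"
    and "snd (ext_vector r v A B $ i) (2 * r - 1 - k) = B k $ i"
    unfolding ext_vector_def using assms by (simp_all only: vec_lambda_beta snd_conv if_True if_False)
qed

lemma moment_matrix_ext_vector:
  "moment_matrix (ext_form \<sigma> h r) (ext_vector r v A B) = moment_matrix h v + (\<Sum>k<r. sym_outer (A k) (B k))"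
proof -
  define a where "a i k = (if k < r then A k $ i else if k < 2 * r then B (2 * r - 1 - k) $ i else 0)" for i k
  have "split_form \<sigma> r (a i) (a j) = (\<Sum>k<r. A k $ i * \<sigma> (B k $ j)) + (\<Sum>k<r. B k $ i * \<sigma> (A k $ j))" for i j
  proof -
    let ?f = "\<lambda>k. a i k * \<sigma> (a j (2 * r - 1 - k))"
    have "{..<2 * r} = {..<r} \<union> {r..<2 * r}"
      by auto
    then have "split_form \<sigma> r (a i) (a j) = sum ?f {..<r} + sum ?f {r..<2 * r}"
      unfolding split_form_def by (simp add: sum.union_disjoint ivl_disj_int)
    also have "sum ?f {r..<2 * r} = (\<Sum>k<r. ?f (2 * r - 1 - k))"
      by (rule sum.reindex_bij_witness[of _ "\<lambda>k. 2 * r - 1 - k" "\<lambda>k. 2 * r - 1 - k"]) auto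
    also have "\<dots> = (\<Sum>k<r. B k $ i * \<sigma> (A k $ j))"
      by (intro sum.cong) (auto simp: a_def)
    also have "sum ?f {..<r} = (\<Sum>k<r. A k $ i * \<sigma> (B k $ j))"
      by (intro sum.cong) (auto simp: a_def)
    finally show ?thesis .
  qed
  then show ?thesis
    by (simp add: moment_matrix_def ext_form_def ext_vector_def sym_outer_def vec_eq_iff sum_component
        sum.distrib flip: a_def)
qed

lemma diff_ext_vector_in_level:
  assumes "x \<in> ext_space_power r"
  shows "x - ext_vector r v A B \<in> level \<delta> \<epsilon> r \<longleftrightarrow>
    (\<chi> i. fst (x $ i)) - v \<in> nv_ball \<delta> \<and>
    (\<forall>k<r. (\<chi> i. snd (x $ i) k) - A k \<in> vec_ball \<epsilon> \<and>
           (\<chi> i. snd (x $ i) (2 * r - 1 - k)) - B k \<in> vec_ball \<epsilon>)" (is "?L \<longleftrightarrow> ?R")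
proof
  assume L: ?L
  have lvl: "absval (snd ((x - ext_vector r v A B) $ i) k) \<le> \<epsilon>" if "k < 2 * r" for i k
    using L that by (simp add: level_def)
  have "absval (snd (x $ i) k - A k $ i) \<le> \<epsilon>" if "k < r" for i k
    using lvl[of k i] that by (simp add: ext_vector_component)
  moreover have "absval (snd (x $ i) (2 * r - 1 - k) - B k $ i) \<le> \<epsilon>" if "k < r" for i k
    using lvl[of "2 * r - 1 - k" i] that
    by (simp only: vector_minus_component snd_diff minus_apply ext_vector_component)
  moreover have "nv (fst (x $ i) - v $ i) \<le> \<delta>" for i
    using L by (simp add: level_def ext_vector_def)
  ultimately show ?R
    by (simp add: nv_ball_def vec_ball_def)
next
  assume R: ?R
  have "absval (snd ((x - ext_vector r v A B) $ i) k) \<le> \<epsilon>" if k: "k < 2 * r" for i k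
  proof (cases "k < r")
    case True
    then show ?thesis
      using R by (simp add: ext_vector_def vec_ball_def)
  next
    case False
    then have l: "2 * r - 1 - k < r" "2 * r - 1 - (2 * r - 1 - k) = k"
      using k by auto
    then have "(\<chi> i. snd (x $ i) k) - B (2 * r - 1 - k) \<in> vec_ball \<epsilon>"
      using R by metis
    then show ?thesis
      using False k by (simp add: ext_vector_def vec_ball_def)
  qed
  moreover have "nv (fst ((x - ext_vector r v A B) $ i)) \<le> \<delta>" for i
    using R by (simp add: nv_ball_def ext_vector_def)
  moreover have "snd ((x - ext_vector r v A B) $ i) \<in> split_space r" for i
    using assms by (simp add: ext_space_power_def split_space_def ext_vector_def)
  ultimately show ?L
    by (simp add: level_def)
qed

text \<open>The triples \<open>(v, A, B)\<close> give one point in each class of the extended set.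
  Since \<open>X\<close> is stable under the level, it contains that point as soon as it meets the
  class.\<close>

lemma coset_index_ext_set:
  fixes C :: "('v ^ 'd::finite) set" and Q :: "('e ^ 'd) set"
  assumes \<delta>: "0 \<le> \<delta>" and \<epsilon>: "0 \<le> \<epsilon>" and I: "coset_reps (nv_ball \<delta>) C I"
    and Q: "coset_reps (vec_ball \<epsilon>) (vec_ball 1) Q"
    and X: "X \<subseteq> ext_set C r" "coset_stable (level \<delta> \<epsilon> r) X"
  shows "coset_index (level \<delta> \<epsilon> r) X
    = card {(v, A, B) \<in> I \<times> ({..<r} \<rightarrow>\<^sub>E Q) \<times> ({..<r} \<rightarrow>\<^sub>E Q). ext_vector r v A B \<in> X}"
proof (rule coset_index_eq_card_indexed)
  let ?\<Omega> = "{..<r} \<rightarrow>\<^sub>E Q"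
  let ?J = "{(v, A, B) \<in> I \<times> ?\<Omega> \<times> ?\<Omega>. ext_vector r v A B \<in> X}"
  let ?f = "\<lambda>(v, A, B). ext_vector r v A B"
  show K: "add_subgroup (level \<delta> \<epsilon> r :: (('v \<times> (nat \<Rightarrow> 'e)) ^ 'd) set)"
    by (rule add_subgroup_level[OF \<delta> \<epsilon>])
  show "?f ` ?J \<subseteq> X"
    by auto
  have X_pow: "x \<in> ext_space_power r" if "x \<in> X" for x
    using that X(1) ext_set_subset by blast
  show "\<exists>j\<in>?J. x - ?f j \<in> level \<delta> \<epsilon> r" if x: "x \<in> X" for x
  proof -
    have xC: "x \<in> ext_set C r"
      using x X(1) by blast
    then obtain v where v: "v \<in> I" "(\<chi> i. fst (x $ i)) - v \<in> nv_ball \<delta>"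
      using coset_repsD(2)[OF I, of "\<chi> i. fst (x $ i)"] by (auto simp: ext_set_def)
    have "(\<chi> i. snd (x $ i) k) \<in> vec_ball 1" if "k < 2 * r" for k
      using xC that by (auto simp: ext_set_def split_lattice_def vec_ball_def valuation_ring_def)
    then have "\<forall>k. \<exists>y. k < 2 * r \<longrightarrow> y \<in> Q \<and> (\<chi> i. snd (x $ i) k) - y \<in> vec_ball \<epsilon>"
      using coset_repsD(2)[OF Q] by blast
    then obtain f where f: "\<And>k. k < 2 * r \<Longrightarrow> f k \<in> Q \<and> (\<chi> i. snd (x $ i) k) - f k \<in> vec_ball \<epsilon>"
      by metis
    define A where "A = restrict f {..<r}"
    define B where "B = restrict (\<lambda>k. f (2 * r - 1 - k)) {..<r}"
    have AB: "A \<in> ?\<Omega>" "B \<in> ?\<Omega>"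
      using f by (auto simp: A_def B_def)
    have d: "x - ext_vector r v A B \<in> level \<delta> \<epsilon> r"
      unfolding diff_ext_vector_in_level[OF X_pow[OF x]]
      using v(2) f by (auto simp: A_def B_def)
    have "x + - (x - ext_vector r v A B) \<in> X"
      using X(2) x add_subgroup_minus[OF K d] unfolding coset_stable_def by blast
    then show ?thesis
      using v(1) AB d by (intro bexI[of _ "(v, A, B)"]) auto
  qed
  show "i = j" if ij: "i \<in> ?J" "j \<in> ?J" "?f i - ?f j \<in> level \<delta> \<epsilon> r" for i j
  proof -
    obtain v A B v' A' B' where i: "i = (v, A, B)" and j: "j = (v', A', B')"
      by (metis prod_cases3)
    have mem: "v \<in> I" "v' \<in> I" "A \<in> ?\<Omega>" "A' \<in> ?\<Omega>" "B \<in> ?\<Omega>" "B' \<in> ?\<Omega>" "ext_vector r v A B \<in> X"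
      using ij by (auto simp: i j)
    have d: "ext_vector r v A B - ext_vector r v' A' B' \<in> level \<delta> \<epsilon> r"
      using ij(3) by (simp add: i j)
    note * = d[unfolded diff_ext_vector_in_level[OF X_pow[OF mem(7)]]]
    have "v - v' \<in> nv_ball \<delta>"
      using * by (simp add: ext_vector_def vec_lambda_eta)
    then have v: "v = v'"
      using coset_reps_unique[OF add_subgroup_nv_ball[OF \<delta>] I] mem by blast
    have AB: "A k - A' k \<in> vec_ball \<epsilon>" "B k - B' k \<in> vec_ball \<epsilon>" if "k < r" for k
    proof -
      have "(\<chi> i. snd (ext_vector r v A B $ i) k) = A k"
        "(\<chi> i. snd (ext_vector r v A B $ i) (2 * r - 1 - k)) = B k"
        unfolding ext_vector_component[OF that] by (simp_all add: vec_lambda_eta)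
      then show "A k - A' k \<in> vec_ball \<epsilon>" "B k - B' k \<in> vec_ball \<epsilon>"
        using * that by metis+
    qed
    have un: "F = F'" if "F \<in> ?\<Omega>" "F' \<in> ?\<Omega>" "\<And>k. k < r \<Longrightarrow> F k - F' k \<in> vec_ball \<epsilon>" for F F'
    proof (rule PiE_ext[OF that(1,2)])
      show "F k = F' k" if "k \<in> {..<r}" for k
        using coset_reps_unique[OF add_subgroup_vec_ball[OF \<epsilon>] Q, of "F k" "F' k"] that
          \<open>F \<in> ?\<Omega>\<close> \<open>F' \<in> ?\<Omega>\<close> \<open>\<And>k. k < r \<Longrightarrow> F k - F' k \<in> vec_ball \<epsilon>\<close> by (auto simp: PiE_iff)
    qed
    have "A = A'" "B = B'"
      using un mem AB by blast+
    with v show ?thesis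
      by (simp add: i j)
  qed
qed

lemma ext_vector_in_ext_set:
  fixes C :: "('v ^ 'd::finite) set"
  assumes "v \<in> C" "\<And>k. k < r \<Longrightarrow> A k \<in> vec_ball 1" "\<And>k. k < r \<Longrightarrow> B k \<in> vec_ball 1"
  shows "ext_vector r v A B \<in> ext_set C r"
  using assms
  by (auto simp: ext_set_def ext_vector_def split_lattice_def split_space_def valuation_ring_def
      vec_ball_def vec_lambda_eta)

definition solutions ::
    "('v ^ 'd) set \<Rightarrow> nat \<Rightarrow> real \<Rightarrow> 'e ^ 'd ^ 'd \<Rightarrow> (('v \<times> (nat \<Rightarrow> 'e)) ^ 'd) set" where
  "solutions C r \<epsilon> T = {x \<in> ext_set C r. moment_matrix (ext_form \<sigma> h r) x - T \<in> mat_ball \<epsilon>}"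

text \<open>The volume quotient of the density on the side of the Hermitian space, written with
  counts. The remaining factor, for the dual lattice, is an index that does not vary with
  \<open>r\<close>.\<close>

definition level_density :: "('v ^ 'd) set \<Rightarrow> 'e ^ 'd ^ 'd \<Rightarrow> real \<Rightarrow> real \<Rightarrow> nat \<Rightarrow> real" where
  "level_density C T \<delta> \<epsilon> r = real (coset_index (level \<delta> \<epsilon> r) (solutions C r \<epsilon> T))
     / real (coset_index (level \<delta> \<epsilon> r) (ext_set C r))"

text \<open>For a fixed representative \<open>v\<close> of \<open>C\<close> the split part has to
  supply \<open>T - moment_matrix h v\<close>, a problem covered by \<open>count_pairs\<close>. The
  factor \<open>card Q ^ (2 * r)\<close> cancels against the size of the extended set, and
  \<open>v\<close> runs through a finite set independent of \<open>r\<close>.\<close>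

lemma level_density_polynomial:
  fixes C :: "('v ^ 'd::finite) set" and T :: "'e ^ 'd ^ 'd"
  assumes C: "compact C" "C \<noteq> {}" and \<delta>: "0 < \<delta>" and \<epsilon>: "0 < \<epsilon>" "\<epsilon> \<le> 1"
    and stable: "\<And>r. coset_stable (level \<delta> \<epsilon> r) (ext_set C r)"
      "\<And>r. coset_stable (level \<delta> \<epsilon> r) (solutions C r \<epsilon> T)"
  obtains P :: "real poly" where
    "\<And>r. level_density C T \<delta> \<epsilon> r = poly P ((1 / real (residue_card TYPE('e))) ^ r)"
proof -
  have \<delta>0: "0 \<le> \<delta>" and \<epsilon>0: "0 \<le> \<epsilon>"
    using \<delta> \<epsilon> by auto
  obtain Q :: "('e ^ 'd) set" where Q: "finite Q" "coset_reps (vec_ball \<epsilon>) (vec_ball 1) Q"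
    using exists_finite_reps_vec_ball[OF \<epsilon>(1)] by blast
  obtain I where I: "finite I" "coset_reps (nv_ball \<delta>) C I"
    using finite_reps_nv_ball[OF \<delta> C(1)] by blast
  have I_ne: "I \<noteq> {}"
    using coset_repsD(2)[OF I(2)] C(2) by blast
  have Q_ne: "Q \<noteq> {}"
    using coset_repsD(2)[OF Q(2), of 0] by (auto simp: vec_ball_def)
  have "\<forall>v. \<exists>P :: real poly. \<forall>r.
      real (card {(A, B) \<in> ({..<r} \<rightarrow>\<^sub>E Q) \<times> ({..<r} \<rightarrow>\<^sub>E Q). (\<Sum>k<r. sym_outer (A k) (B k)) - (T - moment_matrix h v) \<in> mat_ball \<epsilon>})
        = real (card Q ^ (2 * r)) * poly P ((1 / real (residue_card TYPE('e))) ^ r)"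
    using count_pairs[OF \<epsilon> Q] by blast
  then obtain P where P: "\<And>v r. real (card {(A, B) \<in> ({..<r} \<rightarrow>\<^sub>E Q) \<times> ({..<r} \<rightarrow>\<^sub>E Q).
        (\<Sum>k<r. sym_outer (A k) (B k)) - (T - moment_matrix h v) \<in> mat_ball \<epsilon>})
        = real (card Q ^ (2 * r)) * poly (P v) ((1 / real (residue_card TYPE('e))) ^ r)"
    by metis
  show ?thesis
  proof (rule that[of "smult (1 / real (card I)) (\<Sum>v\<in>I. P v)"])
    fix r :: nat
    let ?\<Omega> = "{..<r} \<rightarrow>\<^sub>E Q"
    let ?X = "solutions C r \<epsilon> T"
    have fin\<Omega>: "finite ?\<Omega>"
      using Q(1) by (intro finite_PiE) auto
    have mem: "ext_vector r v A B \<in> ext_set C r" if "v \<in> I" "A \<in> ?\<Omega>" "B \<in> ?\<Omega>" for v A B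
      using that coset_repsD(1)[OF I(2)] coset_repsD(1)[OF Q(2)]
      by (intro ext_vector_in_ext_set) (auto simp: PiE_iff)
    have "{(v, A, B) \<in> I \<times> ?\<Omega> \<times> ?\<Omega>. ext_vector r v A B \<in> ext_set C r} = I \<times> ?\<Omega> \<times> ?\<Omega>"
      using mem by auto
    then have total: "coset_index (level \<delta> \<epsilon> r) (ext_set C r) = card I * card Q ^ (2 * r)"
      using coset_index_ext_set[OF \<delta>0 \<epsilon>0 I(2) Q(2) subset_refl stable(1)]
      by (simp add: card_cartesian_product card_PiE mult_2 power_add)
    have "{(v, A, B) \<in> I \<times> ?\<Omega> \<times> ?\<Omega>. ext_vector r v A B \<in> ?X}
        = Sigma I (\<lambda>v. {(A, B) \<in> ?\<Omega> \<times> ?\<Omega>. (\<Sum>k<r. sym_outer (A k) (B k)) - (T - moment_matrix h v) \<in> mat_ball \<epsilon>})"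
      using mem by (auto simp: solutions_def moment_matrix_ext_vector algebra_simps)
    moreover have "finite {(A, B) \<in> ?\<Omega> \<times> ?\<Omega>. (\<Sum>k<r. sym_outer (A k) (B k)) - (T - moment_matrix h v) \<in> mat_ball \<epsilon>}" for v
      by (rule finite_subset[of _ "?\<Omega> \<times> ?\<Omega>"]) (use fin\<Omega> in auto)
    ultimately have "real (coset_index (level \<delta> \<epsilon> r) ?X)
        = (\<Sum>v\<in>I. real (card {(A, B) \<in> ?\<Omega> \<times> ?\<Omega>. (\<Sum>k<r. sym_outer (A k) (B k)) - (T - moment_matrix h v) \<in> mat_ball \<epsilon>}))"
      using coset_index_ext_set[OF \<delta>0 \<epsilon>0 I(2) Q(2) _ stable(2), of r] I(1)
      by (simp add: card_SigmaI solutions_def)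
    also have "\<dots> = real (card Q ^ (2 * r)) * (\<Sum>v\<in>I. poly (P v) ((1 / real (residue_card TYPE('e))) ^ r))"
      by (simp only: P sum_distrib_left)
    finally show "level_density C T \<delta> \<epsilon> r
        = poly (smult (1 / real (card I)) (\<Sum>v\<in>I. P v)) ((1 / real (residue_card TYPE('e))) ^ r)"
      using I I_ne Q Q_ne by (simp add: level_density_def total poly_sum)
  qed
qed

text \<open>One pair of radii has to serve all \<open>r\<close> and all Haar measures, since the
  polynomial is built from it; hence the radii are chosen from \<open>C\<close>, \<open>h\<close>
  and \<open>T\<close> before \<open>r\<close> appears.\<close>

lemma rep_density_eq:
  fixes C :: "('v ^ 'd::finite) set" and T :: "'e ^ 'd ^ 'd"
  assumes C: "compact C" "open C" "C \<noteq> {}" and T: "T \<in> herm \<sigma>" "det T \<noteq> 0"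
  obtains \<delta> \<epsilon> where "0 < \<delta>" "0 < \<epsilon>" "\<epsilon> \<le> 1"
    "\<And>r. coset_stable (level \<delta> \<epsilon> r) (ext_set C r)"
    "\<And>r. coset_stable (level \<delta> \<epsilon> r) (solutions C r \<epsilon> T)"
    "\<And>r \<mu> \<nu>. haar_measure_on (ext_space_power r) \<mu> \<Longrightarrow> haar_measure_on (herm \<sigma>) \<nu> \<Longrightarrow>
       rep_density \<iota> \<sigma> (ext_form \<sigma> h r) \<mu> \<nu> T (ext_set C r)
         = level_density C T \<delta> \<epsilon> r * real (coset_index (herm_ball \<epsilon>) (herm_int_dual \<iota> \<sigma> :: ('e ^ 'd ^ 'd) set))"
proof -

  \<comment> \<open>Radii determined by \<open>C\<close>, \<open>h\<close> and
    \<open>T\<close>\<close>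
  obtain R where R: "1 \<le> R" "C \<subseteq> nv_ball R"
    using compact_nv_bounded[OF C(1)] by blast
  obtain \<delta>' where "0 < \<delta>'" "\<forall>\<delta>\<le>\<delta>'. coset_stable (nv_ball \<delta>) C"
    using compact_open_nv_stable[OF C(1,2)] by blast
  then obtain \<delta>\<^sub>0 where \<delta>0: "0 < \<delta>\<^sub>0" "\<delta>\<^sub>0 \<le> 1" "\<And>\<delta>. \<delta> \<le> \<delta>\<^sub>0 \<Longrightarrow> coset_stable (nv_ball \<delta>) C"
    by (meson min.cobounded1 min.cobounded2 min_less_iff_conj order_trans zero_less_one)
  \<comment> \<open>The action moves points of \<open>C\<close> by at most \<open>s * R\<close>,
    which has to stay within the stability radius \<open>\<delta>\<^sub>0\<close>;
    \<open>s < 1\<close> makes the matrices of \<open>one_ball s\<close> invertible.\<close>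
  define s where "s = min (1 / 2) (\<delta>\<^sub>0 / R)"
  have s: "0 < s" "s < 1" "s * R \<le> \<delta>\<^sub>0"
  proof -
    have "s * R \<le> \<delta>\<^sub>0 / R * R"
      using R by (intro mult_right_mono) (auto simp: s_def)
    then show "s * R \<le> \<delta>\<^sub>0"
      using R by simp
  qed (use \<delta>0 R in \<open>auto simp: s_def\<close>)
  obtain \<rho> where \<rho>: "0 < \<rho>"
      "\<And>S \<epsilon>. S \<in> herm \<sigma> \<Longrightarrow> S - T \<in> mat_ball \<rho> \<Longrightarrow> 0 < \<epsilon> \<Longrightarrow>
         \<exists>g\<in>one_ball s. S - g ** T ** ctrans g \<in> mat_ball \<epsilon>"
    using approximate_congruence[OF T s(1,2)] by blast
  \<comment> \<open>Within \<open>\<epsilon>\<^sub>0\<close> of \<open>T\<close> every Hermitian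
    matrix is congruent to \<open>T\<close> to any precision; the cap 1 keeps the split part of the
    level inside the integral lattice.\<close>
  define \<epsilon>\<^sub>0 where "\<epsilon>\<^sub>0 = min \<rho> 1"
  have \<epsilon>0: "0 < \<epsilon>\<^sub>0" "\<epsilon>\<^sub>0 \<le> \<rho>" "\<epsilon>\<^sub>0 \<le> 1"
    using \<rho>(1) by (auto simp: \<epsilon>\<^sub>0_def)
  \<comment> \<open>Chosen so that moving by \<open>\<delta> \<epsilon>\<close> in \<open>V\<close>
    costs at most \<open>\<epsilon>\<close> in the moment matrix; the added 1 covers
    \<open>H = 0\<close>.\<close>
  define \<delta> where "\<delta> \<epsilon> = min \<delta>\<^sub>0 (\<epsilon> / (H * R + 1))" for \<epsilon>
  have HR: "0 \<le> H * R"
    using H(1) R(1) by simp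
  have \<delta>: "0 < \<delta> \<epsilon>" "\<delta> \<epsilon> \<le> \<delta>\<^sub>0" "\<delta> \<epsilon> \<le> R" "H * R * \<delta> \<epsilon> \<le> \<epsilon>" if "0 < \<epsilon>" for \<epsilon>
  proof -
    show "0 < \<delta> \<epsilon>" "\<delta> \<epsilon> \<le> \<delta>\<^sub>0"
      using that \<delta>0(1) HR by (auto simp: \<delta>_def)
    then show "\<delta> \<epsilon> \<le> R"
      using \<delta>0(2) R(1) by linarith
    have "H * R * \<delta> \<epsilon> \<le> (H * R + 1) * (\<epsilon> / (H * R + 1))"
      using that HR \<open>0 < \<delta> \<epsilon>\<close> by (intro mult_mono) (auto simp: \<delta>_def)
    then show "H * R * \<delta> \<epsilon> \<le> \<epsilon>"
      using HR by simp
  qed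

  \<comment> \<open>Stability under levels and equal solution counts near \<open>T\<close>\<close>
  have stable_C: "coset_stable (level (\<delta> \<epsilon>) \<epsilon> r) (ext_set C r)" if "0 < \<epsilon>" "\<epsilon> \<le> 1" for \<epsilon> r
    using coset_stable_ext_set[OF \<delta>0(3)[OF \<delta>(2)[OF that(1)]] that(2)] .
  have perturb: "moment_matrix (ext_form \<sigma> h r) (x + k) - moment_matrix (ext_form \<sigma> h r) x \<in> mat_ball \<epsilon>"
    if "0 < \<epsilon>" "\<epsilon> \<le> 1" "x \<in> ext_set C r" "k \<in> level (\<delta> \<epsilon>) \<epsilon> r" for \<epsilon> r x k
    using that \<delta>[OF that(1)] by (intro ext_moment_perturb[OF R(2)]) auto
  let ?X = "solutions C"
  have stable_X: "coset_stable (level (\<delta> \<epsilon>) \<epsilon> r) (?X r \<epsilon> S)" if \<epsilon>: "0 < \<epsilon>" "\<epsilon> \<le> 1" for \<epsilon> r S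
    unfolding coset_stable_def
  proof (intro ballI)
    fix x k :: "('v \<times> (nat \<Rightarrow> 'e)) ^ 'd" assume x: "x \<in> ?X r \<epsilon> S" and k: "k \<in> level (\<delta> \<epsilon>) \<epsilon> r"
    have "x + k \<in> ext_set C r"
      using stable_C[OF \<epsilon>] x k unfolding coset_stable_def solutions_def by blast
    moreover have "moment_matrix (ext_form \<sigma> h r) (x + k) - S \<in> mat_ball \<epsilon>"
      using perturb[OF \<epsilon> _ k] x add_subgroup_diff_trans[OF add_subgroup_mat_ball[OF less_imp_le[OF \<epsilon>(1)]]]
      unfolding solutions_def by blast
    ultimately show "x + k \<in> ?X r \<epsilon> S"
      by (simp add: solutions_def)
  qed
  \<comment> \<open>The precision \<open>\<epsilon>\<close> is not tied to
    \<open>\<epsilon>\<^sub>0\<close>: at every precision up to 1, all targets in the same fixed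
    neighbourhood of \<open>T\<close> have equally many solutions.\<close>
  have idx: "coset_index (level (\<delta> \<epsilon>) \<epsilon> r) (?X r \<epsilon> S) = coset_index (level (\<delta> \<epsilon>) \<epsilon> r) (?X r \<epsilon> T)"
    if \<epsilon>: "0 < \<epsilon>" "\<epsilon> \<le> 1" and S: "S \<in> herm_coset T \<epsilon>\<^sub>0" for \<epsilon> r S
  proof -
    interpret E: sesquilinear_form \<iota> \<sigma> ext_scale "ext_form \<sigma> h r"
      by (rule ext_form_sesquilinear)
    have "S - T \<in> mat_ball \<rho>"
      using S mat_ball_mono[OF \<epsilon>0(2)] by (auto simp: herm_coset_def)
    then obtain g where g: "g \<in> one_ball s" "S - g ** T ** ctrans g \<in> mat_ball \<epsilon>"
      using \<rho>(2)[of S \<epsilon>] S \<epsilon> by (auto simp: herm_coset_def)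
    have sg: "add_subgroup (level (\<delta> \<epsilon>) \<epsilon> r :: (('v \<times> (nat \<Rightarrow> 'e)) ^ 'd) set)"
      using \<epsilon> \<delta>[OF \<epsilon>(1)] by (intro add_subgroup_level) auto
    show ?thesis
      unfolding solutions_def
    proof (rule E.coset_index_congruent[OF sg s(2) _ _ g])
      show "E.act g x \<in> ext_set C r" if "g \<in> one_ball s" "x \<in> ext_set C r" for g x
        using that s \<delta>0 R by (intro act_ext_set[OF R(2) \<delta>0(3)[OF order_refl] that(1)]) auto
      show "E.act g x \<in> level (\<delta> \<epsilon>) \<epsilon> r" if "g \<in> one_ball s" "x \<in> level (\<delta> \<epsilon>) \<epsilon> r"
        for g and x :: "('v \<times> (nat \<Rightarrow> 'e)) ^ 'd"
        using that one_ball_subset[of s] s \<epsilon> \<delta>[OF \<epsilon>(1)] by (intro act_level) auto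
    qed (use \<epsilon> in auto)
  qed

  \<comment> \<open>Evaluation of the density for given \<open>r\<close> and Haar measures\<close>
  have main: "rep_density \<iota> \<sigma> (ext_form \<sigma> h r) \<mu> \<nu> T (ext_set C r)
         = level_density C T (\<delta> \<epsilon>\<^sub>0) \<epsilon>\<^sub>0 r
           * real (coset_index (herm_ball \<epsilon>\<^sub>0) (herm_int_dual \<iota> \<sigma> :: ('e ^ 'd ^ 'd) set))"
    if \<mu>: "haar_measure_on (ext_space_power r) \<mu>" and \<nu>: "haar_measure_on (herm \<sigma>) \<nu>" for r \<mu> \<nu>
  proof -
    let ?\<tau> = "moment_matrix (ext_form \<sigma> h r)" and ?C = "ext_set C r :: (('v \<times> (nat \<Rightarrow> 'e)) ^ 'd) set"
    let ?dual = "herm_int_dual \<iota> \<sigma> :: ('e ^ 'd ^ 'd) set"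
    interpret E: sesquilinear_form \<iota> \<sigma> ext_scale "ext_form \<sigma> h r"
      by (rule ext_form_sesquilinear)
    have C_cpt: "compact ?C"
      by (rule compact_ext_set[OF C(1)])
    have C_ne: "?C \<noteq> {}"
    proof -
      obtain c where "c \<in> C"
        using C(3) by blast
      then have "ext_vector r c (\<lambda>_. 0) (\<lambda>_. 0) \<in> ?C"
        by (intro ext_vector_in_ext_set) (auto simp: vec_ball_def)
      then show ?thesis
        by blast
    qed
    have C_sets: "?C \<in> sets \<mu>"
    proof (rule haar_measure_onD(1)[OF \<mu>])
      have "\<exists>U. openin (top_of_set (ext_space_power r)) U \<and> x \<in> U \<and> U \<subseteq> ?C" if x: "x \<in> ?C" for x
      proof -
        have xG: "x \<in> ext_space_power r"
          using x ext_set_subset by blast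
        obtain O' where O': "open O'" "x \<in> O'"
            "\<And>y. y \<in> ext_space_power r \<Longrightarrow> y \<in> O' \<longleftrightarrow> y - x \<in> level (\<delta> \<epsilon>\<^sub>0) \<epsilon>\<^sub>0 r"
          using level_translate_open[OF \<delta>(1)[OF \<epsilon>0(1)] \<epsilon>0(1) xG] by blast
        have "y \<in> ?C" if "y \<in> ext_space_power r \<inter> O'" for y
        proof -
          have "x + (y - x) \<in> ?C"
            using stable_C[OF \<epsilon>0(1,3), of r] x O'(3)[of y] that unfolding coset_stable_def by blast
          then show ?thesis
            by simp
        qed
        then show ?thesis
          using O'(1,2) xG openin_open_Int by blast
      qed
      then show "openin (top_of_set (ext_space_power r)) ?C"
        using openin_subopen by metis
    qed
    have sgL: "add_subgroup (level (\<delta> \<epsilon>) \<epsilon> r :: (('v \<times> (nat \<Rightarrow> 'e)) ^ 'd) set)" if "0 < \<epsilon>" for \<epsilon>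
      using that \<delta>[OF that] by (intro add_subgroup_level) auto
    have level_meas: "level (\<delta> \<epsilon>) \<epsilon> r \<in> sets \<mu>" "0 < emeasure \<mu> (level (\<delta> \<epsilon>) \<epsilon> r)"
        "emeasure \<mu> (level (\<delta> \<epsilon>) \<epsilon> r) < \<infinity>"
      if \<epsilon>: "0 < \<epsilon>" "\<epsilon> \<le> 1" for \<epsilon>
    proof -
      note op = openin_level[OF \<delta>(1)[OF \<epsilon>(1)] \<epsilon>(1), of r]
      show K: "level (\<delta> \<epsilon>) \<epsilon> r \<in> sets \<mu>"
        by (rule haar_measure_onD(1)[OF \<mu> op])
      show "0 < emeasure \<mu> (level (\<delta> \<epsilon>) \<epsilon> r)"
        using add_subgroup_0[OF sgL[OF \<epsilon>(1)]] by (intro haar_measure_onD(2)[OF \<mu> op]) blast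
      obtain x where x: "x \<in> ?C"
        using C_ne by blast
      \<comment> \<open>A translate of the level lies in the compact set \<open>?C\<close>, which
        makes the mass finite.\<close>
      have "emeasure \<mu> (level (\<delta> \<epsilon>) \<epsilon> r) = emeasure \<mu> ((\<lambda>y. x + y) ` level (\<delta> \<epsilon>) \<epsilon> r)"
        using haar_measure_onD(4)[OF \<mu> _ K] x ext_set_subset by fastforce
      also have "\<dots> \<le> emeasure \<mu> ?C"
        using stable_C[OF \<epsilon>, of r] x C_sets unfolding coset_stable_def by (intro emeasure_mono) auto
      also have "\<dots> < \<infinity>"
        by (rule haar_measure_onD(3)[OF \<mu> ext_set_subset C_cpt])
      finally show "emeasure \<mu> (level (\<delta> \<epsilon>) \<epsilon> r) < \<infinity>" .
    qed
    have meas_\<mu>: "measure \<mu> Y = real (coset_index (level (\<delta> \<epsilon>) \<epsilon> r) Y) * measure \<mu> (level (\<delta> \<epsilon>) \<epsilon> r)"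
      if "0 < \<epsilon>" "\<epsilon> \<le> 1" "Y \<subseteq> ?C" "coset_stable (level (\<delta> \<epsilon>) \<epsilon> r) Y" for \<epsilon> Y
      using that ext_set_subset[of C r]
      by (intro haar_measure_coset_index[OF \<mu> sgL level_meas]) auto
    have pos_\<mu>: "0 < measure \<mu> (level (\<delta> \<epsilon>) \<epsilon> r)" if "0 < \<epsilon>" "\<epsilon> \<le> 1" for \<epsilon>
      using level_meas[OF that] by (simp add: measure_def enn2real_positive_iff)
    have herm_meas: "herm_ball \<epsilon> \<in> sets \<nu>" "0 < emeasure \<nu> (herm_ball \<epsilon> :: ('e ^ 'd ^ 'd) set)"
        "emeasure \<nu> (herm_ball \<epsilon> :: ('e ^ 'd ^ 'd) set) < \<infinity>" if \<epsilon>: "0 < \<epsilon>" for \<epsilon>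
    proof -
      have op: "openin (top_of_set (herm \<sigma>)) (herm_ball \<epsilon> :: ('e ^ 'd ^ 'd) set)"
        unfolding herm_ball_eq_coset by (rule openin_herm_coset[OF \<epsilon>])
      show "herm_ball \<epsilon> \<in> sets \<nu>"
        by (rule haar_measure_onD(1)[OF \<nu> op])
      show "0 < emeasure \<nu> (herm_ball \<epsilon> :: ('e ^ 'd ^ 'd) set)"
        using add_subgroup_0[OF add_subgroup_herm_ball, of \<epsilon>] \<epsilon>
        by (intro haar_measure_onD(2)[OF \<nu> op]) auto
      show "emeasure \<nu> (herm_ball \<epsilon> :: ('e ^ 'd ^ 'd) set) < \<infinity>"
      proof (rule haar_measure_onD(3)[OF \<nu>])
        show "compact (herm_ball \<epsilon> :: ('e ^ 'd ^ 'd) set)"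
          unfolding herm_ball_eq_coset by (rule compact_herm_coset)
      qed (simp add: herm_ball_def)
    qed
    have meas_\<nu>: "measure \<nu> Y = real (coset_index (herm_ball \<epsilon>) Y) * measure \<nu> (herm_ball \<epsilon> :: ('e ^ 'd ^ 'd) set)"
      if "0 < \<epsilon>" "Y \<subseteq> herm \<sigma>" "coset_stable (herm_ball \<epsilon>) Y" for \<epsilon> Y
      using that by (intro haar_measure_coset_index[OF \<nu> add_subgroup_herm_ball herm_meas]) auto
    have pos_\<nu>: "0 < measure \<nu> (herm_ball \<epsilon> :: ('e ^ 'd ^ 'd) set)" if "0 < \<epsilon>" for \<epsilon>
      using herm_meas[OF that] by (simp add: measure_def enn2real_positive_iff)
    \<comment> \<open>This is the quotient expected for the neighbourhood
      \<open>herm_coset T \<epsilon>\<close>, whose volume equals that of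
      \<open>herm_ball \<epsilon>\<close> by invariance.\<close>
    define \<Phi> where "\<Phi> \<epsilon> = measure \<mu> (?X r \<epsilon> T) / measure \<mu> ?C
      * (measure \<nu> ?dual / measure \<nu> (herm_ball \<epsilon> :: ('e ^ 'd ^ 'd) set))" for \<epsilon>
    \<comment> \<open>\<open>U\<close> is a union of \<open>card I\<close> cosets of
      \<open>herm_ball \<epsilon>\<close>. By \<open>idx\<close> each of them receives the same
      number of solutions, so the factor \<open>card I\<close> in the numerator cancels against the
      one in the volume of \<open>U\<close>.\<close>
    have quot: "density_quotient \<iota> \<sigma> (ext_form \<sigma> h r) \<mu> \<nu> ?C U = \<Phi> \<epsilon>"
      if U: "U \<subseteq> herm_coset T \<epsilon>\<^sub>0" "T \<in> U" "compact U" and \<epsilon>: "0 < \<epsilon>" "\<epsilon> \<le> \<epsilon>\<^sub>0"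
        and U_st: "coset_stable (herm_ball \<epsilon>) U" for U \<epsilon>
    proof -
      have \<epsilon>1: "\<epsilon> \<le> 1"
        using \<epsilon> \<epsilon>0 by linarith
      have U_herm: "U \<subseteq> herm \<sigma>"
        using U(1) by (auto simp: herm_coset_def)
      let ?K = "level (\<delta> \<epsilon>) \<epsilon> r :: (('v \<times> (nat \<Rightarrow> 'e)) ^ 'd) set"
      note sgH = add_subgroup_herm_ball[OF less_imp_le[OF \<epsilon>(1)]]
      note sgM = add_subgroup_mat_ball[OF less_imp_le[OF \<epsilon>(1)]]
      obtain I where I: "finite I" "coset_reps (herm_ball \<epsilon>) U I"
        using exists_finite_coset_reps[OF sgH U(3) herm_nbhd[OF \<epsilon>(1) U_herm]] by blast
      have "\<exists>O'. open O' \<and> x \<in> O' \<and> (\<forall>y\<in>O' \<inter> ?C. y - x \<in> ?K)" if x: "x \<in> ?C" for x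
      proof -
        have "x \<in> ext_space_power r"
          using x ext_set_subset by blast
        then obtain O' where "open O'" "x \<in> O'" "\<And>y. y \<in> ext_space_power r \<Longrightarrow> y \<in> O' \<longleftrightarrow> y - x \<in> ?K"
          using level_translate_open[OF \<delta>(1)[OF \<epsilon>(1)] \<epsilon>(1)] by blast
        then show ?thesis
          using ext_set_subset by (intro exI[of _ O']) blast
      qed
      then obtain J where J: "finite J" "coset_reps ?K ?C J"
        using exists_finite_coset_reps[OF sgL[OF \<epsilon>(1)] C_cpt] by blast
      define Y where "Y = {x \<in> ?C. ?\<tau> x \<in> U}"
      have Y_eq: "Y = (\<Union>S\<in>I. ?X r \<epsilon> S)"
      proof (intro equalityI subsetI)
        fix x assume x: "x \<in> Y"
        then obtain S where "S \<in> I" "?\<tau> x - S \<in> herm_ball \<epsilon>"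
          using coset_repsD(2)[OF I(2), of "?\<tau> x"] by (auto simp: Y_def)
        then show "x \<in> (\<Union>S\<in>I. ?X r \<epsilon> S)"
          using x by (auto simp: solutions_def Y_def herm_ball_def)
      next
        fix x assume "x \<in> (\<Union>S\<in>I. ?X r \<epsilon> S)"
        then obtain S where S: "S \<in> I" "x \<in> ?C" "?\<tau> x - S \<in> mat_ball \<epsilon>"
          by (auto simp: solutions_def)
        have "S \<in> U"
          using S coset_repsD(1)[OF I(2)] by blast
        moreover have "?\<tau> x - S \<in> herm_ball \<epsilon>"
          using S \<open>S \<in> U\<close> U_herm E.moment_matrix_in_herm herm_diff by (auto simp: herm_ball_def)
        ultimately have "S + (?\<tau> x - S) \<in> U"
          using U_st unfolding coset_stable_def by blast
        then show "x \<in> Y"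
          using S by (simp add: Y_def)
      qed
      have Y_st: "coset_stable ?K Y"
        using stable_X[OF \<epsilon>(1) \<epsilon>1] unfolding Y_eq coset_stable_def by blast
      have X_card: "card (J \<inter> ?X r \<epsilon> S) = coset_index ?K (?X r \<epsilon> S)" for S
        using coset_index_eq_card[OF sgL[OF \<epsilon>(1)] coset_reps_Int[OF sgL[OF \<epsilon>(1)] J(2) _ stable_X[OF \<epsilon>(1) \<epsilon>1]]]
        by (simp add: solutions_def)
      have "coset_index ?K Y = card (J \<inter> Y)"
        using coset_index_eq_card[OF sgL[OF \<epsilon>(1)] coset_reps_Int[OF sgL[OF \<epsilon>(1)] J(2) _ Y_st]]
        by (simp add: Y_def)
      also have "J \<inter> Y = (\<Union>S\<in>I. J \<inter> ?X r \<epsilon> S)"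
        by (auto simp: Y_eq)
      also have "card \<dots> = (\<Sum>S\<in>I. card (J \<inter> ?X r \<epsilon> S))"
      proof (rule card_UN_disjoint[OF I(1)])
        show "\<forall>i\<in>I. finite (J \<inter> ?X r \<epsilon> i)"
          using J by simp
        show "\<forall>i\<in>I. \<forall>j\<in>I. i \<noteq> j \<longrightarrow> J \<inter> ?X r \<epsilon> i \<inter> (J \<inter> ?X r \<epsilon> j) = {}"
        proof (intro ballI impI equals0I)
          fix i j x assume *: "i \<in> I" "j \<in> I" "i \<noteq> j" "x \<in> J \<inter> ?X r \<epsilon> i \<inter> (J \<inter> ?X r \<epsilon> j)"
          then have "?\<tau> x - i \<in> mat_ball \<epsilon>" "?\<tau> x - j \<in> mat_ball \<epsilon>"
            by (auto simp: solutions_def)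
          then have "i - j \<in> mat_ball \<epsilon>"
            using add_subgroup_diff_trans[OF sgM] add_subgroup_diff_commute[OF sgM] by blast
          moreover have "i - j \<in> herm \<sigma>"
            using * coset_repsD(1)[OF I(2)] U_herm herm_diff by blast
          ultimately show False
            using coset_reps_unique[OF sgH I(2)] * by (auto simp: herm_ball_def)
        qed
      qed
      also have "\<dots> = (\<Sum>S\<in>I. coset_index ?K (?X r \<epsilon> T))"
        using idx[OF \<epsilon>(1) \<epsilon>1] U(1) coset_repsD(1)[OF I(2)] by (intro sum.cong) (auto simp: X_card)
      finally have "coset_index ?K Y = card I * coset_index ?K (?X r \<epsilon> T)"
        by simp
      then have "measure \<mu> Y = real (card I) * measure \<mu> (?X r \<epsilon> T)"
        using meas_\<mu>[OF \<epsilon>(1) \<epsilon>1 _ Y_st] meas_\<mu>[OF \<epsilon>(1) \<epsilon>1 _ stable_X[OF \<epsilon>(1) \<epsilon>1], of T]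
        by (simp add: Y_def solutions_def)
      moreover have "measure \<nu> U = real (card I) * measure \<nu> (herm_ball \<epsilon> :: ('e ^ 'd ^ 'd) set)"
        using meas_\<nu>[OF \<epsilon>(1) U_herm U_st] coset_index_eq_card[OF sgH I(2)] by simp
      moreover have "card I \<noteq> 0"
        using I(1) coset_repsD(2)[OF I(2) U(2)] by auto
      ultimately show ?thesis
        using pos_\<nu>[OF \<epsilon>(1)] by (simp add: density_quotient_def \<Phi>_def flip: Y_def)
    qed
    have coset_stable: "coset_stable (herm_ball \<epsilon>) (herm_coset T \<epsilon>')" if "0 < \<epsilon>" "\<epsilon> \<le> \<epsilon>'" for \<epsilon> \<epsilon>'
      unfolding coset_stable_def
    proof (intro ballI)
      fix S k :: "'e ^ 'd ^ 'd" assume S: "S \<in> herm_coset T \<epsilon>'" and k: "k \<in> herm_ball \<epsilon>"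
      have "k \<in> mat_ball \<epsilon>'"
        using k mat_ball_mono[OF that(2)] by (auto simp: herm_ball_def)
      then have "k + (S - T) \<in> mat_ball \<epsilon>'"
        using S that by (intro add_subgroup_add[OF add_subgroup_mat_ball]) (auto simp: herm_coset_def)
      then show "S + k \<in> herm_coset T \<epsilon>'"
        using S k herm_add by (auto simp: herm_coset_def herm_ball_def algebra_simps)
    qed
    have T_coset: "T \<in> herm_coset T \<epsilon>" if "0 < \<epsilon>" for \<epsilon>
      using T(1) that add_subgroup_0[OF add_subgroup_mat_ball, of \<epsilon>] by (simp add: herm_coset_def)
    have const: "density_quotient \<iota> \<sigma> (ext_form \<sigma> h r) \<mu> \<nu> ?C U = \<Phi> \<epsilon>\<^sub>0"
      if U: "U \<subseteq> herm_coset T \<epsilon>\<^sub>0" "T \<in> U" "compact U" "openin (top_of_set (herm \<sigma>)) U" for U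
    proof -
      obtain \<epsilon>' where "0 < \<epsilon>'" "\<forall>\<epsilon>\<le>\<epsilon>'. coset_stable (herm_ball \<epsilon>) U"
        using compact_open_herm_stable[OF U(3,4)] by blast
      then obtain \<epsilon> where \<epsilon>: "0 < \<epsilon>" "\<epsilon> \<le> \<epsilon>\<^sub>0" "coset_stable (herm_ball \<epsilon>) U"
        using \<epsilon>0(1) by (meson min.cobounded1 min.cobounded2 min_less_iff_conj)
      \<comment> \<open>Both precisions are tested on the same neighbourhood
        \<open>herm_coset T \<epsilon>\<^sub>0\<close>, for which \<open>quot\<close> gives
        \<open>\<Phi> \<epsilon>\<close> as well as
        \<open>\<Phi> \<epsilon>\<^sub>0\<close>.\<close>
      have "\<Phi> \<epsilon> = \<Phi> \<epsilon>\<^sub>0"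
        using quot[OF subset_refl T_coset[OF \<epsilon>0(1)] compact_herm_coset \<epsilon>(1,2) coset_stable[OF \<epsilon>(1,2)]]
          quot[OF subset_refl T_coset[OF \<epsilon>0(1)] compact_herm_coset \<epsilon>0(1) order_refl coset_stable[OF \<epsilon>0(1) order_refl]]
        by simp
      then show ?thesis
        using quot[OF U(1-3) \<epsilon>] by simp
    qed
    have "rep_density \<iota> \<sigma> (ext_form \<sigma> h r) \<mu> \<nu> T ?C = \<Phi> \<epsilon>\<^sub>0"
    proof -
      have "(THE c. \<exists>N. openin (top_of_set (herm \<sigma>)) N \<and> T \<in> N \<and>
             (\<forall>U. U \<subseteq> N \<and> T \<in> U \<and> compact U \<and> openin (top_of_set (herm \<sigma>)) U \<longrightarrow>
                density_quotient \<iota> \<sigma> (ext_form \<sigma> h r) \<mu> \<nu> ?C U = c)) = \<Phi> \<epsilon>\<^sub>0"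
      proof (rule the_equality)
        show "\<exists>N. openin (top_of_set (herm \<sigma>)) N \<and> T \<in> N \<and>
             (\<forall>U. U \<subseteq> N \<and> T \<in> U \<and> compact U \<and> openin (top_of_set (herm \<sigma>)) U \<longrightarrow>
                density_quotient \<iota> \<sigma> (ext_form \<sigma> h r) \<mu> \<nu> ?C U = \<Phi> \<epsilon>\<^sub>0)"
          using openin_herm_coset[OF \<epsilon>0(1)] T_coset[OF \<epsilon>0(1)] const by blast
        fix c assume "\<exists>N. openin (top_of_set (herm \<sigma>)) N \<and> T \<in> N \<and>
             (\<forall>U. U \<subseteq> N \<and> T \<in> U \<and> compact U \<and> openin (top_of_set (herm \<sigma>)) U \<longrightarrow>
                density_quotient \<iota> \<sigma> (ext_form \<sigma> h r) \<mu> \<nu> ?C U = c)"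
        then obtain N where N: "openin (top_of_set (herm \<sigma>)) N" "T \<in> N"
            "\<And>U. U \<subseteq> N \<Longrightarrow> T \<in> U \<Longrightarrow> compact U \<Longrightarrow> openin (top_of_set (herm \<sigma>)) U \<Longrightarrow>
                density_quotient \<iota> \<sigma> (ext_form \<sigma> h r) \<mu> \<nu> ?C U = c"
          by blast
        \<comment> \<open>The two candidate values are compared on a compact open coset of
          \<open>T\<close> that is small enough for both.\<close>
        obtain \<epsilon> where \<epsilon>: "0 < \<epsilon>" "herm_coset T \<epsilon> \<subseteq> N"
          using openin_herm_imp_coset[OF N(1,2)] by blast
        define \<epsilon>' where "\<epsilon>' = min \<epsilon> \<epsilon>\<^sub>0"
        have \<epsilon>': "0 < \<epsilon>'" "herm_coset T \<epsilon>' \<subseteq> N" "herm_coset T \<epsilon>' \<subseteq> herm_coset T \<epsilon>\<^sub>0"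
          using \<epsilon> \<epsilon>0(1) mat_ball_mono[of \<epsilon>' \<epsilon>] mat_ball_mono[of \<epsilon>' \<epsilon>\<^sub>0]
          by (auto simp: \<epsilon>'_def herm_coset_def)
        show "c = \<Phi> \<epsilon>\<^sub>0"
          using N(3)[OF \<epsilon>'(2) T_coset[OF \<epsilon>'(1)] compact_herm_coset openin_herm_coset[OF \<epsilon>'(1)]]
            const[OF \<epsilon>'(3) T_coset[OF \<epsilon>'(1)] compact_herm_coset openin_herm_coset[OF \<epsilon>'(1)]]
          by simp
      qed
      then show ?thesis
        using C_ne by (simp add: rep_density_def)
    qed
    moreover have "\<Phi> \<epsilon>\<^sub>0 = level_density C T (\<delta> \<epsilon>\<^sub>0) \<epsilon>\<^sub>0 r * real (coset_index (herm_ball \<epsilon>\<^sub>0) ?dual)"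
    proof -
      have "measure \<mu> (?X r \<epsilon>\<^sub>0 T) = real (coset_index (level (\<delta> \<epsilon>\<^sub>0) \<epsilon>\<^sub>0 r) (?X r \<epsilon>\<^sub>0 T)) * measure \<mu> (level (\<delta> \<epsilon>\<^sub>0) \<epsilon>\<^sub>0 r)"
        using \<epsilon>0 stable_X by (intro meas_\<mu>) (auto simp: solutions_def)
      moreover have "measure \<mu> ?C = real (coset_index (level (\<delta> \<epsilon>\<^sub>0) \<epsilon>\<^sub>0 r) ?C) * measure \<mu> (level (\<delta> \<epsilon>\<^sub>0) \<epsilon>\<^sub>0 r)"
        using \<epsilon>0 stable_C by (intro meas_\<mu>) auto
      moreover have "measure \<nu> ?dual = real (coset_index (herm_ball \<epsilon>\<^sub>0) ?dual) * measure \<nu> (herm_ball \<epsilon>\<^sub>0 :: ('e ^ 'd ^ 'd) set)"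
        using \<epsilon>0 coset_stable_herm_int_dual[OF \<epsilon>0(3)]
        by (intro meas_\<nu>) (auto simp: herm_int_dual_def)
      ultimately show ?thesis
        using pos_\<mu>[OF \<epsilon>0(1,3)] pos_\<nu>[OF \<epsilon>0(1)] by (simp add: \<Phi>_def level_density_def)
    qed
    ultimately show ?thesis
      by simp
  qed
  show ?thesis
    using that[OF \<delta>(1)[OF \<epsilon>0(1)] \<epsilon>0(1,3) stable_C[OF \<epsilon>0(1,3)] stable_X[OF \<epsilon>0(1,3)] main] .
qed

end

lemma complex_nat_powr_minus:
  assumes "0 < q"
  shows "(of_nat q :: complex) powr (- of_nat r) = of_real ((1 / real q) ^ r)"
proof -
  have "(of_nat q :: complex) powr (of_nat r) = of_nat q ^ r"
    using assms by (simp add: powr_nat')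
  then show ?thesis
    by (simp add: powr_minus power_divide inverse_eq_divide)
qed

lemma poly_map_poly_of_real:
  "poly (map_poly complex_of_real P) (of_real x) = of_real (poly P x)"
  by (induction P) (auto simp: map_poly_pCons)

theorem proposition2p4p1:
  fixes \<iota> :: "'f::nonarch_local_field \<Rightarrow> 'e::nonarch_local_field"
    and \<sigma> :: "'e \<Rightarrow> 'e"
    and scale :: "'e \<Rightarrow> 'v::{topological_ab_group_add, t2_space} \<Rightarrow> 'v"
    and h :: "'v \<Rightarrow> 'v \<Rightarrow> 'e"
    and C :: "('v ^ 'd::finite) set"
    and T :: "'e ^ 'd ^ 'd"
    and q :: nat
  assumes "separable_quadratic_extension \<iota> \<sigma>"
    and "q = residue_card TYPE('f)"
    and "hermitian_space scale \<sigma> h"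
    and "compact C" and "open C"
    and "T \<in> herm \<sigma>" and "det T \<noteq> 0"
  shows "\<exists>D. D \<in> polynomials_in (\<lambda>s. of_nat q powr (- s)) \<and>
      (\<forall>r \<mu> \<nu>. haar_measure_on (ext_space_power r) \<mu> \<and> haar_measure_on (herm \<sigma>) \<nu> \<longrightarrow>
         D (of_nat r) = of_real (rep_density \<iota> \<sigma> (ext_form \<sigma> h r) \<mu> \<nu> T (ext_set C r))) \<and>
      (unramified \<iota> \<longrightarrow> D \<in> polynomials_in (\<lambda>s. of_nat q powr (- 2 * s)))"
proof -
  interpret hermitian_over_extension \<iota> \<sigma> scale h
    using assms by (simp add: hermitian_over_extension_def)
  let ?q' = "residue_card TYPE('e)"
  have "\<exists>P :: real poly. \<forall>r \<mu> \<nu>. haar_measure_on (ext_space_power r) \<mu> \<and> haar_measure_on (herm \<sigma>) \<nu> \<longrightarrow>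
      rep_density \<iota> \<sigma> (ext_form \<sigma> h r) \<mu> \<nu> T (ext_set C r) = poly P ((1 / real ?q') ^ r)"
  proof (cases "C = {}")
    case True
    then have "ext_set C r = ({} :: (('v \<times> (nat \<Rightarrow> 'e)) ^ 'd) set)" for r
      by (simp add: ext_set_def)
    then show ?thesis
      by (intro exI[of _ 0]) (simp add: rep_density_def)
  next
    case False
    obtain nv H where nv: "\<And>v. 0 \<le> nv v" "\<And>v w. nv (v + w) \<le> max (nv v) (nv w)"
        "\<And>a v. nv (scale a v) = absval a * nv v"
        "\<And>r. 0 < r \<Longrightarrow> open {v. nv v \<le> r}"
        "\<And>U. open U \<Longrightarrow> 0 \<in> U \<Longrightarrow> \<exists>r>0. \<forall>v. nv v \<le> r \<longrightarrow> v \<in> U"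
        "0 \<le> H" "\<And>v w. absval (h v w) \<le> H * nv v * nv w"
      using V.exists_norm[OF absval_conj] by blast
    interpret normed_hermitian_space \<iota> \<sigma> scale h nv H
      by unfold_locales (rule nv; assumption)+
    obtain \<delta> \<epsilon> where \<delta>: "0 < \<delta>" and \<epsilon>: "0 < \<epsilon>" "\<epsilon> \<le> 1"
      and stable: "\<And>r. coset_stable (level \<delta> \<epsilon> r) (ext_set C r)"
        "\<And>r. coset_stable (level \<delta> \<epsilon> r) (solutions C r \<epsilon> T)"
      and density: "\<And>r \<mu> \<nu>. haar_measure_on (ext_space_power r) \<mu> \<Longrightarrow> haar_measure_on (herm \<sigma>) \<nu> \<Longrightarrow>
         rep_density \<iota> \<sigma> (ext_form \<sigma> h r) \<mu> \<nu> T (ext_set C r)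
           = level_density C T \<delta> \<epsilon> r * real (coset_index (herm_ball \<epsilon>) (herm_int_dual \<iota> \<sigma> :: ('e ^ 'd ^ 'd) set))"
      using rep_density_eq[OF assms(4,5) False assms(6,7)] by blast
    obtain P :: "real poly" where P: "\<And>r. level_density C T \<delta> \<epsilon> r = poly P ((1 / real ?q') ^ r)"
      using level_density_polynomial[OF assms(4) False \<delta> \<epsilon> stable] by blast
    show ?thesis
      by (intro exI[of _ "smult (real (coset_index (herm_ball \<epsilon>) (herm_int_dual \<iota> \<sigma> :: ('e ^ 'd ^ 'd) set))) P"])
         (simp add: density P mult.commute)
  qed
  then obtain P :: "real poly" where P: "\<And>r \<mu> \<nu>. haar_measure_on (ext_space_power r) \<mu> \<Longrightarrow>
      haar_measure_on (herm \<sigma>) \<nu> \<Longrightarrow>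
      rep_density \<iota> \<sigma> (ext_form \<sigma> h r) \<mu> \<nu> T (ext_set C r) = poly P ((1 / real ?q') ^ r)"
    by blast
  obtain f where f: "?q' = q ^ f" "unramified \<iota> \<Longrightarrow> f = 2"
  proof (rule residue_card_extension)
    fix f assume f: "?q' = residue_card TYPE('f) ^ f" "unramified \<iota> \<Longrightarrow> f = 2"
    show thesis
      by (rule that[of f]) (use f assms(2) in simp_all)
  qed
  have q: "0 < q"
    using residue_card_pos[where ?'a = 'f] assms(2) by simp
  let ?P = "map_poly complex_of_real P"
  \<comment> \<open>As \<open>?q'\<close> is \<open>q ^ f\<close>, the \<open>f\<close>-th power of
    \<open>q powr (- s)\<close> extends the inverse of \<open>?q' ^ r\<close> from natural numbers
    \<open>r\<close> to complex \<open>s\<close>; for \<open>f = 2\<close> it is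
    \<open>q powr (- 2 * s)\<close>.\<close>
  define D where "D s = poly ?P ((of_nat q powr (- s)) ^ f)" for s
  have "D = (\<lambda>s. poly (pcompose ?P (monom 1 f)) (of_nat q powr (- s)))"
    by (simp add: D_def fun_eq_iff poly_pcompose poly_monom)
  then have "D \<in> polynomials_in (\<lambda>s. of_nat q powr (- s))"
    unfolding polynomials_in_def by blast
  moreover have "D (of_nat r) = of_real (rep_density \<iota> \<sigma> (ext_form \<sigma> h r) \<mu> \<nu> T (ext_set C r))"
    if "haar_measure_on (ext_space_power r) \<mu>" "haar_measure_on (herm \<sigma>) \<nu>" for r \<mu> \<nu>
  proof -
    have "((of_nat q :: complex) powr (- of_nat r)) ^ f = of_real ((1 / real ?q') ^ r)"
      unfolding complex_nat_powr_minus[OF q]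
      by (simp add: f(1) power_divide power_mult[symmetric] mult.commute)
    then have "D (of_nat r) = of_real (poly P ((1 / real ?q') ^ r))"
      by (simp only: D_def poly_map_poly_of_real)
    then show ?thesis
      using P[OF that] by simp
  qed
  moreover have "D \<in> polynomials_in (\<lambda>s. of_nat q powr (- 2 * s))" if "unramified \<iota>"
  proof -
    have "(of_nat q powr (- s)) ^ 2 = (of_nat q :: complex) powr (- 2 * s)" for s
      by (simp add: power2_eq_square flip: powr_add)
    then have "D = (\<lambda>s. poly ?P (of_nat q powr (- 2 * s)))"
      using f(2)[OF that] by (simp add: D_def fun_eq_iff)
    then show ?thesis
      unfolding polynomials_in_def by blast
  qed
  ultimately show ?thesis
    by blast
qed

end
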